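(* Let $n\ge 3$ and $p\in\mathbb R\setminus\{1\}$. A map $\mu:\mathcal P_o^n\to\mathcal M(S^{n-1})$ is a $\operatorname{GL}(n)$ contravariant valuation of degree $p$ if and only if there exist nonnegative constants $c_1,c_2\in\mathbb R$ such that $$\mu(P,\cdot)=c_1S_p(P,\cdot)+c_2S_p(-P,\cdot)$$ for every $P\in\mathcal P_o^n$.
   Context: $\mathcal P_o^n$ denotes the set of all convex polytopes in $\mathbb R^n$ (of any dimension, including $\{o\}$) that contain the origin $o$. $S^{n-1}$ is the Euclidean unit sphere of $\mathbb R^n$ and $\mathcal M(S^{n-1})$ is the space of finite positive Borel measures on $S^{n-1}$. A map $\mu:\mathcal P_o^n\to\mathcal M(S^{n-1})$ is a valuation if $\mu(P\cup Q,\cdot)+\mu(P\cap Q,\cdot)=\mu(P,\cdot)+\mu(Q,\cdot)$ whenever $P,Q,P\cup Q,P\cap Q\in\mathcal P_o^n$. For a subgroup $G$ of $\operatorname{GL}(n)$ and $p\in\mathbb R$, $\mu$ is called $G$ contravariant of degree $p$ if $$\int_{S^{n-1}}f\,d\mu(\phi P,\cdot)=|\det\phi|\int_{S^{n-1}}f\circ\phi^{-t}\,d\mu(P,\cdot)$$ for every $\phi\in G$, every $P\in\mathcal P_o^n$, and every continuous function $f:\mathbb R^n\setminus\{o\}\to\mathbb R$ that is $p$-homogeneous (i.e. $f(tx)=t^pf(x)$ for $t>0$). Here $\phi^{-t}$ is the transpose of the inverse of $\phi$. The $L_p$ surface area measure of $P\in\mathcal P_o^n$ is $S_p(P,\cdot)=\sum_{u\in\mathcal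 N^*(P)}h(P,u)^{1-p}V_{n-1}(F_u)\,\delta_u$, where $\mathcal N^*(P)$ is the set of outer unit normals $u$ of facets ($(n-1)$-dimensional faces) $F_u$ of $P$ that do not contain the origin, $h(P,u)=\max\{u\cdot y: y\in P\}$ is the support function, $V_{n-1}$ is $(n-1)$-dimensional volume, and $\delta_u$ is the Dirac probability measure at $u$. *)

theory Defs
  imports "HOL-Probability.Giry_Monad"
begin

definition polytopes_o :: "'a::euclidean_space set set" where
  "polytopes_o = {P. polytope P \<and> 0 \<in> P}"

definition sphere_borel :: "'a::euclidean_space measure" where
  "sphere_borel = restrict_space borel (sphere 0 1)"

definition sphere_measures :: "'a::euclidean_space measure set" where
  "sphere_measures = {M. finite_measure M \<and> sets M = sets sphere_borel}"

definition valuation :: "('a::euclidean_space set \<Rightarrow> 'a measure) \<Rightarrow> bool" where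
  "valuation \<mu> \<longleftrightarrow>
    (\<forall>P Q. P \<in> polytopes_o \<longrightarrow> Q \<in> polytopes_o \<longrightarrow> P \<union> Q \<in> polytopes_o \<longrightarrow> P \<inter> Q \<in> polytopes_o \<longrightarrow>
      (\<forall>A \<in> sets sphere_borel.
        measure (\<mu> (P \<union> Q)) A + measure (\<mu> (P \<inter> Q)) A = measure (\<mu> P) A + measure (\<mu> Q) A))"

definition GL :: "(real^'n^'n) set" where
  "GL = {\<phi>. invertible \<phi>}"

(* Functions on the punctured space are total functions whose value at 0 plays no role. *)
definition homogeneous :: "real \<Rightarrow> ('a::euclidean_space \<Rightarrow> real) \<Rightarrow> bool" where
  "homogeneous p f \<longleftrightarrow> (\<forall>x t. x \<noteq> 0 \<longrightarrow> t > 0 \<longrightarrow> f (t *\<^sub>R x) = t powr p * f x)"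

definition contravariant ::
  "(real^'n^'n) set \<Rightarrow> real \<Rightarrow> ((real^'n) set \<Rightarrow> (real^'n) measure) \<Rightarrow> bool" where
  "contravariant G p \<mu> \<longleftrightarrow>
    (\<forall>\<phi> \<in> G. \<forall>P \<in> polytopes_o. \<forall>f. continuous_on (- {0}) f \<longrightarrow> homogeneous p f \<longrightarrow>
      (\<integral>x. f x \<partial>\<mu> ((\<lambda>x. \<phi> *v x) ` P)) =
        \<bar>det \<phi>\<bar> * (\<integral>x. f (transpose (matrix_inv \<phi>) *v x) \<partial>\<mu> P))"

definition support_fun :: "'a::euclidean_space set \<Rightarrow> 'a \<Rightarrow> real" where
  "support_fun P u = (SUP y\<in>P. u \<bullet> y)"

definition support_face :: "'a::euclidean_space set \<Rightarrow> 'a \<Rightarrow> 'a set" where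
  "support_face P u = {y \<in> P. u \<bullet> y = support_fun P u}"

(* The facet condition fixes the dimension n - 1, independently of the dimension of P; the library
   predicate facet_of is relative to the dimension of P. *)
definition facet_normals_off_origin :: "'a::euclidean_space set \<Rightarrow> 'a set" where
  "facet_normals_off_origin P =
    {u. norm u = 1 \<and> support_face P u face_of P \<and>
        aff_dim (support_face P u) = int DIM('a) - 1 \<and> 0 \<notin> support_face P u}"

(* The k-dimensional volume of a k-dimensional set F: Lebesgue measure of F in orthonormal
   coordinates on the linear space parallel to the affine hull of F. It does not depend on the
   chosen orthonormal basis B. *)
definition affine_volume :: "'a::euclidean_space set \<Rightarrow> real" where
  "affine_volume F =
    (let B = (SOME B. pairwise orthogonal B \<and> (\<forall>b\<in>B. norm b = 1) \<and>
                      span B = span {x - y | x y. x \<in> F \<and> y \<in> F})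
     in measure (\<Pi>\<^sub>M b\<in>B. lborel) ((\<lambda>x. \<lambda>b\<in>B. x \<bullet> b) ` F))"

(* On facet_normals_off_origin P the support function is positive when 0 lies in P, so powr is the
   ordinary real power there. The Dirac measure at u is written return sphere_borel u. *)
definition Lp_surface_area_measure :: "real \<Rightarrow> 'a::euclidean_space set \<Rightarrow> 'a measure" where
  "Lp_surface_area_measure p P =
    measure_of (sphere 0 1) (sets sphere_borel)
      (\<lambda>A. \<Sum>u\<in>facet_normals_off_origin P.
         ennreal (support_fun P u powr (1 - p) * affine_volume (support_face P u)) *
         emeasure (return sphere_borel u) A)"

end

theory Submission
  imports Defs "HOL-Analysis.Analysis"
begin

text \<open>
Why the theorem holds. The coefficient of \<open>S\<^sub>p(P)\<close> at a facet normal \<open>u\<close> with facet \<open>F\<close> and support number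
\<open>h\<close> is \<open>h powr (1 - p)\<close> times the area of \<open>F\<close>, and since \<open>h\<close> times the area of \<open>F\<close> is \<open>n\<close> times the volume
of the pyramid over \<open>F\<close> with apex at the origin (\<open>affine_volume_pyramid\<close>), it equals \<open>n * h powr (- p)\<close> times
that volume. This weight depends on the polytope only through its support function, its support
sets and Lebesgue measure. So it can be handled direction by direction: when \<open>P \<union> Q\<close> is convex,
the supporting hyperplanes of \<open>P\<close> and \<open>Q\<close> with normal \<open>u\<close> are either different, and then the
one that lies further out belongs to the union and the other to the intersection, or they coincide, and
then the pyramids satisfy inclusion and exclusion (\<open>facet_weight_valuation\<close>). Contravariance
is the determinant formula for volumes (\<open>facet_weight_linear_image\<close>) and the homogeneity of the support
function. Hence every combination of \<open>S\<^sub>p(P)\<close> and \<open>S\<^sub>p(- P)\<close> with nonnegative coefficients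
is a contravariant valuation (\<open>weighted_valuation_contravariant\<close>).

For the converse, let \<open>\<mu>\<close> be a contravariant valuation of degree \<open>p \<noteq> 1\<close>. If \<open>P\<close> lies in a
hyperplane through the origin, then a map that fixes this hyperplane and stretches transversally to it
fixes \<open>P\<close>, but it may have any determinant \<open>s > 0\<close>. Contravariance forces the measure of \<open>P\<close> to sit on the two unit normals of the
hyperplane and its mass to equal \<open>s powr (1 - p)\<close> times itself. As \<open>p \<noteq> 1\<close>, the measure is zero
(\<open>contravariant_null_of_empty_interior\<close>), so \<open>\<mu>\<close> is a simple valuation.

Next let \<open>T\<close> be the convex hull of the origin and the standard basis. The hyperplane \<open>x\<^sub>i = x\<^sub>j\<close> cuts \<open>T\<close>
into two linear images of \<open>T\<close> of half the volume. This gives, for each pair \<open>i \<noteq> j\<close>, a functional equation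
for the measure of \<open>T\<close> (\<open>simplex_integral_halving\<close>). Testing it with suitable homogeneous functions, which
depend on the sign of \<open>p\<close>, shows that the measure is concentrated on the diagonal
(\<open>simplex_measure_on_diagonal\<close>). For \<open>p = 0\<close> this uses \<open>n \<ge> 3\<close>. So the measure of \<open>T\<close> has two atoms at
most, at the unit vectors \<open>v\<close> and \<open>- v\<close> of the diagonal. The measure \<open>S\<^sub>p(T)\<close> is a positive multiple of the
point mass at \<open>v\<close>, and \<open>S\<^sub>p(- T)\<close> of the one at \<open>- v\<close>, which determines \<open>c\<^sub>1\<close> and \<open>c\<^sub>2\<close>.

It remains to see that a contravariant valuation is determined by its value at \<open>T\<close>
(\<open>contravariant_valuation_unique\<close>). Contravariance determines it at all invertible linear images of \<open>T\<close>,
that is, at all full-dimensional simplices with a vertex at the origin. A triangulation of those faces of \<open>P\<close> that miss the origin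
dissects \<open>P\<close> into such simplices, and a simple valuation is additive for this dissection
although the intermediate unions need not be convex. The reason is that both sides can be refined by cutting
with all hyperplanes through the origin that bound the pieces (\<open>simple_valuation_dissection\<close>).
\<close>

section \<open>Simple valuations and dissections by hyperplanes through the origin\<close>

definition simple_valuation :: "('a::euclidean_space set \<Rightarrow> real) \<Rightarrow> bool" where
  "simple_valuation \<nu> \<longleftrightarrow>
    (\<forall>P Q. P \<in> polytopes_o \<longrightarrow> Q \<in> polytopes_o \<longrightarrow> P \<union> Q \<in> polytopes_o \<longrightarrow> P \<inter> Q \<in> polytopes_o \<longrightarrow>
      \<nu> (P \<union> Q) + \<nu> (P \<inter> Q) = \<nu> P + \<nu> Q) \<and>
    (\<forall>P \<in> polytopes_o. interior P = {} \<longrightarrow> \<nu> P = 0)"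

text \<open>The cells of the arrangement of hyperplanes through the origin with normals in \<open>H\<close>; the subset \<open>s\<close> of \<open>H\<close>
records on which hyperplanes the cell lies on the nonnegative side.\<close>

definition sign_cell :: "'a::euclidean_space set \<Rightarrow> 'a set \<Rightarrow> 'a set" where
  "sign_cell H s = {x. \<forall>a\<in>H. (a \<in> s \<longrightarrow> 0 \<le> a \<bullet> x) \<and> (a \<notin> s \<longrightarrow> a \<bullet> x \<le> 0)}"

lemma polytopes_o_Int_halfspaces:
  fixes a :: "'a::euclidean_space"
  assumes "P \<in> polytopes_o"
  shows "P \<inter> {x. a \<bullet> x \<le> 0} \<in> polytopes_o" "P \<inter> {x. 0 \<le> a \<bullet> x} \<in> polytopes_o"
    "P \<inter> {x. a \<bullet> x = 0} \<in> polytopes_o"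
  using assms unfolding polytopes_o_def
  by (auto intro!: polytope_Int_polyhedron polyhedron_halfspace_le polyhedron_halfspace_ge
    polyhedron_hyperplane)

lemma interior_subset_hyperplane_empty:
  fixes a :: "'a::euclidean_space"
  assumes "S \<subseteq> {x. a \<bullet> x = 0}" "a \<noteq> 0"
  shows "interior S = {}"
  using assms interior_mono[of S "{x. a \<bullet> x = 0}"] by simp

lemma simple_valuation_split:
  assumes \<nu>: "simple_valuation \<nu>" and P: "P \<in> polytopes_o" and a: "a \<noteq> 0"
  shows "\<nu> P = \<nu> (P \<inter> {x. 0 \<le> a \<bullet> x}) + \<nu> (P \<inter> {x. a \<bullet> x \<le> 0})"
proof -
  let ?A = "P \<inter> {x. 0 \<le> a \<bullet> x}" and ?B = "P \<inter> {x. a \<bullet> x \<le> 0}"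
  have U: "?A \<union> ?B = P" and I: "?A \<inter> ?B = P \<inter> {x. a \<bullet> x = 0}" by auto
  have "interior (P \<inter> {x. a \<bullet> x = 0}) = {}"
    by (rule interior_subset_hyperplane_empty[of _ a]) (use a in auto)
  then have "\<nu> (?A \<inter> ?B) = 0"
    using \<nu> polytopes_o_Int_halfspaces[OF P, of a] unfolding I simple_valuation_def by blast
  moreover have "\<nu> (?A \<union> ?B) + \<nu> (?A \<inter> ?B) = \<nu> ?A + \<nu> ?B"
    using \<nu> polytopes_o_Int_halfspaces[OF P, of a] P U I unfolding simple_valuation_def by metis
  ultimately show ?thesis using U by simp
qed

lemma polytopes_o_Int_sign_cell:
  assumes "finite H" "P \<in> polytopes_o"
  shows "P \<inter> sign_cell H s \<in> polytopes_o"
  using assms(1)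
proof (induction H)
  case empty
  then show ?case using assms(2) by (simp add: sign_cell_def)
next
  case (insert a H)
  have "P \<inter> sign_cell (insert a H) s =
    (if a \<in> s then (P \<inter> sign_cell H s) \<inter> {x. 0 \<le> a \<bullet> x} else (P \<inter> sign_cell H s) \<inter> {x. a \<bullet> x \<le> 0})"
    by (auto simp: sign_cell_def)
  then show ?case using polytopes_o_Int_halfspaces[OF insert.IH] by auto
qed

lemma simple_valuation_sum_sign_cells:
  assumes \<nu>: "simple_valuation \<nu>" and P: "P \<in> polytopes_o" and H: "finite H" "0 \<notin> H"
  shows "\<nu> P = (\<Sum>s\<in>Pow H. \<nu> (P \<inter> sign_cell H s))"
  using H
proof (induction H)
  case empty
  then show ?case by (simp add: sign_cell_def)
next
  case (insert a H)
  let ?C = "\<lambda>s. P \<inter> sign_cell H s" and ?D = "\<lambda>s. P \<inter> sign_cell (insert a H) s"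
  have neg: "?D s = ?C s \<inter> {x. a \<bullet> x \<le> 0}" and pos: "?D (insert a s) = ?C s \<inter> {x. 0 \<le> a \<bullet> x}"
    if "s \<in> Pow H" for s
    using that insert.hyps by (auto simp: sign_cell_def)
  have "(\<Sum>s\<in>Pow (insert a H). \<nu> (?D s)) =
      (\<Sum>s\<in>Pow H. \<nu> (?D s)) + (\<Sum>s\<in>insert a ` Pow H. \<nu> (?D s))"
    unfolding Pow_insert using insert.hyps by (intro sum.union_disjoint) auto
  also have "(\<Sum>s\<in>insert a ` Pow H. \<nu> (?D s)) = (\<Sum>s\<in>Pow H. \<nu> (?D (insert a s)))"
    using insert.hyps by (subst sum.reindex) (auto simp: inj_on_def insert_ident)
  finally have "(\<Sum>s\<in>Pow (insert a H). \<nu> (?D s)) =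
      (\<Sum>s\<in>Pow H. \<nu> (?C s \<inter> {x. 0 \<le> a \<bullet> x}) + \<nu> (?C s \<inter> {x. a \<bullet> x \<le> 0}))"
    by (simp add: neg pos sum.distrib)
  also have "\<dots> = (\<Sum>s\<in>Pow H. \<nu> (?C s))"
    using simple_valuation_split[OF \<nu> polytopes_o_Int_sign_cell[OF insert.hyps(1) P], of a] insert.prems
    by (intro sum.cong) auto
  finally show ?case using insert by simp
qed

text \<open>The valuation property only speaks about convex unions, but each piece here is cut out of \<open>P\<close> by
hyperplanes through the origin. Cutting \<open>P\<close> and every piece with the whole arrangement expresses all
values by the same cells, and a cell with interior points belongs to exactly one piece.\<close>

lemma simple_valuation_dissection:
  fixes P :: "'a::euclidean_space set"
  assumes \<nu>: "simple_valuation \<nu>" and P: "P \<in> polytopes_o"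
    and fin: "finite \<S>" and cover: "P = \<Union>\<S>" and po: "\<S> \<subseteq> polytopes_o"
    and cone: "\<And>S. S \<in> \<S> \<Longrightarrow> \<exists>A. finite A \<and> 0 \<notin> A \<and> S = P \<inter> {x. \<forall>a\<in>A. a \<bullet> x \<le> 0}"
    and disj: "\<And>S S'. S \<in> \<S> \<Longrightarrow> S' \<in> \<S> \<Longrightarrow> S \<noteq> S' \<Longrightarrow> interior (S \<inter> S') = {}"
  shows "\<nu> P = (\<Sum>S\<in>\<S>. \<nu> S)"
proof -
  have "\<forall>S\<in>\<S>. \<exists>A. finite A \<and> 0 \<notin> A \<and> S = P \<inter> {x. \<forall>a\<in>A. a \<bullet> x \<le> 0}"
    by (rule ballI, rule cone)
  from bchoice[OF this] obtain A
    where A: "\<forall>S\<in>\<S>. finite (A S) \<and> 0 \<notin> A S \<and> S = P \<inter> {x. \<forall>a\<in>A S. a \<bullet> x \<le> 0}" ..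
  note A0 = bspec[OF A]
  have A1: "finite (A S)" "0 \<notin> A S" if "S \<in> \<S>" for S
    by (rule A0[OF that, THEN conjunct1], rule A0[OF that, THEN conjunct2, THEN conjunct1])
  have A2: "y \<in> S \<longleftrightarrow> y \<in> P \<and> (\<forall>a\<in>A S. a \<bullet> y \<le> 0)" if "S \<in> \<S>" for S y
  proof -
    have "(y \<in> S) = (y \<in> P \<inter> {x. \<forall>a\<in>A S. a \<bullet> x \<le> 0})"
      by (rule arg_cong[OF A0[OF that, THEN conjunct2, THEN conjunct2]])
    then show ?thesis by simp
  qed
  define H where "H = \<Union>(A ` \<S>)"
  have H: "finite H" "0 \<notin> H" using A1 fin by (auto simp: H_def)
  have null: "\<nu> Q = 0" if "Q \<in> polytopes_o" "interior Q = {}" for Q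
    using \<nu> that by (auto simp: simple_valuation_def)
  have cell: "\<nu> (P \<inter> sign_cell H s) = (\<Sum>S\<in>\<S>. \<nu> (S \<inter> sign_cell H s))" for s
  proof (cases "\<exists>S\<in>\<S>. interior (S \<inter> sign_cell H s) \<noteq> {}")
    case True
    then obtain S x where S: "S \<in> \<S>" and x: "x \<in> interior (S \<inter> sign_cell H s)" by blast
    have notin: "a \<notin> s" if a: "a \<in> A S" for a
    proof
      assume "a \<in> s"
      \<comment> \<open>\<open>a\<close> is nonpositive on \<open>S\<close> and nonnegative on the cell\<close>
      have "S \<inter> sign_cell H s \<subseteq> {x. a \<bullet> x = 0}"
      proof
        fix y assume "y \<in> S \<inter> sign_cell H s"
        then have "a \<bullet> y \<le> 0" "0 \<le> a \<bullet> y"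
          using A2[OF S, of y] a \<open>a \<in> s\<close> S by (auto simp: sign_cell_def H_def)
        then show "y \<in> {x. a \<bullet> x = 0}" by simp
      qed
      then have "interior (S \<inter> sign_cell H s) = {}"
        by (rule interior_subset_hyperplane_empty) (use A1[OF S] a in auto)
      then show False using x by simp
    qed
    have eq: "S \<inter> sign_cell H s = P \<inter> sign_cell H s"
    proof
      show "S \<inter> sign_cell H s \<subseteq> P \<inter> sign_cell H s" using S cover by auto
      show "P \<inter> sign_cell H s \<subseteq> S \<inter> sign_cell H s"
      proof
        fix y assume y: "y \<in> P \<inter> sign_cell H s"
        have "\<forall>a\<in>A S. a \<bullet> y \<le> 0"
          using y S notin by (auto simp: sign_cell_def H_def)
        then show "y \<in> S \<inter> sign_cell H s" using y A2[OF S, of y] by blast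
      qed
    qed
    have "\<nu> (S' \<inter> sign_cell H s) = 0" if S': "S' \<in> \<S> - {S}" for S'
    proof (rule null)
      show "S' \<inter> sign_cell H s \<in> polytopes_o"
        using S' po by (intro polytopes_o_Int_sign_cell H) auto
      have "S' \<inter> sign_cell H s \<subseteq> S \<inter> S'" using S' cover eq by blast
      then show "interior (S' \<inter> sign_cell H s) = {}"
        using disj[OF S, of S'] S' interior_mono by blast
    qed
    then have "(\<Sum>S'\<in>\<S>. \<nu> (S' \<inter> sign_cell H s)) = \<nu> (S \<inter> sign_cell H s)"
      using fin S by (simp add: sum.remove)
    then show ?thesis using eq by simp
  next
    case False
    have z: "\<nu> (S \<inter> sign_cell H s) = 0" if "S \<in> \<S>" for S
      using that False po by (intro null polytopes_o_Int_sign_cell H) auto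
    have pc: "P \<inter> sign_cell H s \<in> polytopes_o" by (intro polytopes_o_Int_sign_cell H P)
    have "negligible (S \<inter> sign_cell H s)" if "S \<in> \<S>" for S
    proof -
      have "S \<inter> sign_cell H s \<in> polytopes_o"
        using that po by (intro polytopes_o_Int_sign_cell H) auto
      then show ?thesis using that False
        by (auto simp: polytopes_o_def negligible_convex_interior polytope_imp_convex)
    qed
    then have "negligible (\<Union>S\<in>\<S>. S \<inter> sign_cell H s)"
      using fin by (intro negligible_Union) auto
    then have "negligible (P \<inter> sign_cell H s)" by (rule negligible_subset) (use cover in auto)
    then have "interior (P \<inter> sign_cell H s) = {}"
      using open_not_negligible[OF open_interior] negligible_subset[OF _ interior_subset] by blast
    then have "\<nu> (P \<inter> sign_cell H s) = 0" using null pc by blast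
    then show ?thesis using z by simp
  qed
  have "\<nu> P = (\<Sum>s\<in>Pow H. \<nu> (P \<inter> sign_cell H s))"
    by (rule simple_valuation_sum_sign_cells[OF \<nu> P H])
  also have "\<dots> = (\<Sum>S\<in>\<S>. \<Sum>s\<in>Pow H. \<nu> (S \<inter> sign_cell H s))"
    unfolding cell by (rule sum.swap)
  also have "\<dots> = (\<Sum>S\<in>\<S>. \<nu> S)"
    using po by (intro sum.cong refl simple_valuation_sum_sign_cells[OF \<nu> _ H, symmetric]) auto
  finally show ?thesis .
qed

section \<open>Volume of linear images\<close>

lemma det_matrix_add_column:
  "det (matrix (\<lambda>x::real^'n. x + (x $ k) *\<^sub>R c)) = 1 + c $ k"
proof -
  have "matrix (\<lambda>x::real^'n. x + (x $ k) *\<^sub>R c) =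
    (\<chi> i j. if j = k then (mat 1 *v (axis k 1 + c)) $ i else mat 1 $ i $ j)"
    by (simp add: matrix_def vec_eq_iff matrix_vector_mul_lid) (simp add: axis_def mat_def)
  then show ?thesis
    using cramer_lemma[of k "mat 1" "axis k 1 + c"] by (simp add: axis_def)
qed

lemma det_matrix_add_row:
  "det (matrix (\<lambda>x::real^'n. x + (a \<bullet> x) *\<^sub>R axis k 1)) = 1 + a $ k"
proof -
  have "matrix (\<lambda>x::real^'n. x + (a \<bullet> x) *\<^sub>R axis k 1) = transpose (matrix (\<lambda>x. x + (x $ k) *\<^sub>R a))"
    by (simp add: matrix_def transpose_def vec_eq_iff inner_axis) (simp add: axis_def)
  then show ?thesis by (simp add: det_transpose det_matrix_add_column)
qed

text \<open>A translation moves the box to one whose \<open>n\<close>-th coordinates are nonnegative, which is the case covered by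
\<open>measure_shear_interval\<close>. It commutes with the shear up to another translation.\<close>

lemma shear_image_interval:
  fixes a b :: "real^'n"
  assumes "m \<noteq> n" and ne: "cbox a b \<noteq> {}"
  shows "measure lebesgue ((\<lambda>x. \<chi> i. if i = m then x $ m + x $ n else x $ i) ` cbox a b) =
    measure lebesgue (cbox a b)"
proof -
  let ?h = "\<lambda>x::real^'n. \<chi> i. if i = m then x $ m + x $ n else x $ i"
  define v where "v = - (a $ n) *\<^sub>R (axis n 1 :: real^'n)"
  have lin: "?h (v + x) = ?h v + ?h x" for x by (simp add: vec_eq_iff)
  have sh: "cbox (v + a) (v + b) = (+) v ` cbox a b" by (simp add: cbox_translation)
  have "?h ` cbox (v + a) (v + b) = (+) (?h v) ` ?h ` cbox a b"
    unfolding sh image_image by (intro image_cong refl lin)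
  then have "measure lebesgue (?h ` cbox a b) = measure lebesgue (?h ` cbox (v + a) (v + b))"
    by (simp add: measure_translation)
  also have "\<dots> = measure lebesgue (cbox (v + a) (v + b))"
  proof (rule measure_shear_interval[OF \<open>m \<noteq> n\<close>])
    show "cbox (v + a) (v + b) \<noteq> {}" using ne by (simp add: sh del: cbox_translation)
    show "0 \<le> (v + a) $ n" by (simp add: v_def axis_def)
  qed
  also have "\<dots> = measure lebesgue (cbox a b)" unfolding sh by (rule measure_translation)
  finally show ?thesis .
qed

text \<open>Every linear map is a composition of singular maps, diagonal maps, swaps and shears. For the last two it
suffices to compare volumes of boxes.\<close>

lemma volume_linear_image:
  fixes f :: "real^'n \<Rightarrow> real^'n"
  assumes "linear f" "S \<in> lmeasurable"
  shows "f ` S \<in> lmeasurable \<and> measure lebesgue (f ` S) = \<bar>det (matrix f)\<bar> * measure lebesgue S"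
proof -
  define Q :: "(real^'n \<Rightarrow> real^'n) \<Rightarrow> bool" where
    "Q f \<longleftrightarrow> (\<forall>S\<in>lmeasurable. f ` S \<in> lmeasurable \<and>
      measure lebesgue (f ` S) = \<bar>det (matrix f)\<bar> * measure lebesgue S)" for f
  have box_suffices: "Q f"
    if "linear f" "\<bar>det (matrix f)\<bar> = 1"
      "\<And>a b. cbox a b \<noteq> {} \<Longrightarrow> measure lebesgue (f ` cbox a b) = measure lebesgue (cbox a b)" for f
    unfolding Q_def
  proof
    fix S :: "(real^'n) set" assume "S \<in> lmeasurable"
    moreover have "measure lebesgue (f ` cbox a b) = 1 * measure lebesgue (cbox a b)" for a b
      using that(3)[of a b] by (cases "cbox a b = {}") auto
    ultimately show "f ` S \<in> lmeasurable \<and> measure lebesgue (f ` S) = \<bar>det (matrix f)\<bar> * measure lebesgue S"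
      using measure_linear_sufficient[OF that(1), of S 1] that(2) by auto
  qed
  have "Q f"
  proof (rule induct_linear_elementary[OF assms(1)])
    fix f g :: "real^'n \<Rightarrow> real^'n"
    assume "linear f" "linear g" "Q f" "Q g"
    then show "Q (f \<circ> g)"
      unfolding Q_def image_comp[symmetric] by (simp add: matrix_compose det_mul abs_mult)
  next
    fix f :: "real^'n \<Rightarrow> real^'n" and i
    assume lin: "linear f" and z: "\<And>x. f x $ i = 0"
    have "\<not> surj f" by (metis one_index one_neq_zero surj_def z)
    then have ninj: "\<not> inj f" using lin linear_injective_imp_surjective by blast
    then have "det (matrix f) = 0" using det_nz_iff_inj[OF lin] by blast
    then show "Q f"
      using negligible_linear_singular_image[OF lin ninj] negligible_imp_measure0
      by (auto simp: Q_def negligible_imp_measurable)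
  next
    fix c
    show "Q (\<lambda>x. \<chi> i. c i * x $ i)"
      by (auto simp: Q_def measurable_stretch measure_stretch axis_def matrix_def det_diagonal)
  next
    fix m n :: 'n assume "m \<noteq> n"
    let ?t = "Transposition.transpose m n"
    let ?h = "\<lambda>x::real^'n. \<chi> i. x $ ?t i"
    have lin: "linear ?h" by (rule linearI) (simp_all add: vec_eq_iff)
    have inv: "?h (?h x) = x" for x by (simp add: vec_eq_iff)
    show "Q ?h"
    proof (rule box_suffices[OF lin])
      have "matrix ?h ** matrix ?h = matrix (?h \<circ> ?h)" by (rule matrix_compose[OF lin lin, symmetric])
      also have "?h \<circ> ?h = id" by (rule ext) (simp add: vec_eq_iff)
      finally have "det (matrix ?h) * det (matrix ?h) = 1"
        by (metis det_I det_mul matrix_id_mat_1)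
      then show "\<bar>det (matrix ?h)\<bar> = 1" by (auto simp: square_eq_1_iff)
    next
      fix a b :: "real^'n" assume ne: "cbox a b \<noteq> {}"
      have img: "?h ` cbox a b = cbox (?h a) (?h b)"
      proof
        show "?h ` cbox a b \<subseteq> cbox (?h a) (?h b)" by (auto simp: mem_box_cart)
        show "cbox (?h a) (?h b) \<subseteq> ?h ` cbox a b"
        proof
          fix y assume y: "y \<in> cbox (?h a) (?h b)"
          have "?h y \<in> cbox a b"
            unfolding mem_box_cart
          proof
            fix i
            have "?h a $ ?t i \<le> y $ ?t i \<and> y $ ?t i \<le> ?h b $ ?t i" using y unfolding mem_box_cart by blast
            then show "a $ i \<le> ?h y $ i \<and> ?h y $ i \<le> b $ i" by simp
          qed
          moreover have "y = ?h (?h y)" by (simp only: inv)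
          ultimately show "y \<in> ?h ` cbox a b" by blast
        qed
      qed
      then have "cbox (?h a) (?h b) \<noteq> {}" using ne by auto
      then show "measure lebesgue (?h ` cbox a b) = measure lebesgue (cbox a b)"
        unfolding img using ne prod.permute[OF permutes_swap_id, where S=UNIV and g="\<lambda>i. (b - a) $ i", of m n]
        by (simp add: content_cbox_cart)
    qed
  next
    fix m n :: 'n assume mn: "m \<noteq> n"
    let ?h = "\<lambda>x::real^'n. \<chi> i. if i = m then x $ m + x $ n else x $ i"
    have "?h = (\<lambda>x. x + (axis n 1 \<bullet> x) *\<^sub>R axis m 1)"
      by (simp add: fun_eq_iff vec_eq_iff inner_axis') (simp add: axis_def)
    then have "det (matrix ?h) = 1" using mn by (simp only: det_matrix_add_row) (simp add: axis_def)
    moreover have "linear ?h" by (rule linearI) (auto simp: vec_eq_iff algebra_simps)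
    ultimately show "Q ?h" using shear_image_interval[OF mn] by (intro box_suffices) auto
  qed
  then show ?thesis using assms(2) by (simp add: Q_def)
qed

section \<open>Facet area as a pyramid volume\<close>

definition pyramid :: "'a::real_vector set \<Rightarrow> 'a set" where
  "pyramid F = {t *\<^sub>R x | t x. 0 \<le> t \<and> t \<le> 1 \<and> x \<in> F}"

lemma compact_pyramid:
  fixes F :: "'a::real_normed_vector set"
  assumes "compact F" shows "compact (pyramid F)"
proof -
  have "pyramid F = (\<lambda>(t, x). t *\<^sub>R x) ` ({0..1} \<times> F)"
    by (force simp: pyramid_def)
  then show ?thesis
    using assms by (auto intro!: compact_continuous_image continuous_intros compact_Times simp: case_prod_beta)
qed

lemma pyramid_linear_image:
  assumes "linear f" shows "pyramid (f ` F) = f ` pyramid F"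
  by (force simp: pyramid_def linear_cmul[OF assms])

lemma emeasure_lborel_scale_vimage:
  fixes c :: real
  assumes "c > 0" "X \<in> sets borel"
  shows "emeasure lborel ((*) c -` X) = ennreal (1 / c) * emeasure lborel X"
proof -
  have "emeasure lborel ((*) c -` X) = emeasure (distr lborel borel ((*) c)) X"
    using assms by (subst emeasure_distr) auto
  also have "\<dots> = ennreal (1 / c) * emeasure lborel X"
    using assms by (subst lborel_distr_mult) (auto simp: emeasure_density_const divide_inverse)
  finally show ?thesis .
qed

lemma emeasure_PiM_lborel_scale_vimage:
  fixes c :: real
  assumes B: "finite B" and c: "c > 0" and A: "A \<in> sets (\<Pi>\<^sub>M b\<in>B. lborel)"
  shows "emeasure (\<Pi>\<^sub>M b\<in>B. lborel) {x \<in> space (\<Pi>\<^sub>M b\<in>B. lborel). (\<lambda>b\<in>B. c * x b) \<in> A} =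
    ennreal ((1 / c) ^ card B) * emeasure (\<Pi>\<^sub>M b\<in>B. lborel) A"
proof -
  interpret product_sigma_finite "\<lambda>_. lborel :: real measure" ..
  let ?P = "\<Pi>\<^sub>M b\<in>B. (lborel :: real measure)" and ?s = "\<lambda>x. \<lambda>b\<in>B. c * x b"
  have s[measurable]: "?s \<in> measurable ?P ?P" by measurable
  define M where "M = scale_measure (ennreal (c ^ card B)) (distr ?P ?P ?s)"
  have "M = ?P"
  proof (rule PiM_eqI[OF B])
    show "sets M = sets ?P" by (simp add: M_def)
    fix X assume X: "\<And>b. b \<in> B \<Longrightarrow> X b \<in> sets (lborel :: real measure)"
    have "?s -` Pi\<^sub>E B X \<inter> space ?P = Pi\<^sub>E B (\<lambda>b. (*) c -` X b)"
      by (auto simp: space_PiM PiE_def Pi_def extensional_def)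
    moreover have "(*) c -` X b \<in> sets borel" if "b \<in> B" for b
      using X[OF that] by (intro measurable_sets_borel[of _ borel]) auto
    ultimately have "emeasure M (Pi\<^sub>E B X) = ennreal (c ^ card B) * (\<Prod>b\<in>B. emeasure lborel ((*) c -` X b))"
      using B X by (simp add: M_def emeasure_distr sets_PiM_I_finite emeasure_PiM)
    also have "(\<Prod>b\<in>B. emeasure lborel ((*) c -` X b)) = (\<Prod>b\<in>B. ennreal (1 / c) * emeasure lborel (X b))"
      using X by (intro prod.cong refl emeasure_lborel_scale_vimage c) auto
    also have "\<dots> = ennreal ((1 / c) ^ card B) * (\<Prod>b\<in>B. emeasure lborel (X b))"
      using c by (simp add: prod.distrib ennreal_power)
    also have "ennreal (c ^ card B) * \<dots> = (\<Prod>b\<in>B. emeasure lborel (X b))"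
      using c by (simp add: mult.assoc[symmetric] ennreal_mult[symmetric] power_mult_distrib[symmetric])
    finally show "emeasure M (Pi\<^sub>E B X) = (\<Prod>b\<in>B. emeasure lborel (X b))" .
  qed
  have "emeasure ?P A = ennreal (c ^ card B) * emeasure (distr ?P ?P ?s) A"
  proof -
    have "emeasure ?P A = emeasure M A" by (simp only: \<open>M = ?P\<close>)
    then show ?thesis by (simp add: M_def)
  qed
  also have "emeasure (distr ?P ?P ?s) A = emeasure ?P (?s -` A \<inter> space ?P)"
    by (rule emeasure_distr[OF s A])
  also have "?s -` A \<inter> space ?P = {x \<in> space ?P. ?s x \<in> A}" by auto
  finally show ?thesis
    using c by (simp add: mult.assoc[symmetric] ennreal_mult[symmetric] power_mult_distrib[symmetric])
qed

lemma prod_Basis_cart: "(\<Prod>b\<in>(Basis :: (real^'n) set). g b) = (\<Prod>i\<in>UNIV. g (axis i 1))"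
proof -
  have B: "(Basis :: (real^'n) set) = range (\<lambda>i. axis i 1)" by (auto simp: Basis_vec_def)
  have inj: "inj (\<lambda>i::'n. axis i 1 :: real^'n)" by (auto simp: inj_on_def axis_eq_axis)
  show ?thesis unfolding B prod.reindex[OF inj] o_def ..
qed

text \<open>The coordinates may be indexed by any finite set of the right size; later that set is an orthonormal basis.\<close>

lemma lborel_cart_PiM:
  fixes c :: "'n::finite \<Rightarrow> 'b"
  assumes c: "bij_betw c UNIV C"
  shows "(lborel :: (real^'n) measure) = distr (\<Pi>\<^sub>M b\<in>C. lborel) borel (\<lambda>x. \<chi> i. x (c i))"
proof (rule lborel_eqI)
  interpret product_sigma_finite "\<lambda>_. lborel :: real measure" ..
  have C: "finite C" using bij_betw_finite[OF c] by simp
  let ?f = "\<lambda>x. (\<chi> i. x (c i)) :: real^'n"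
  have cC: "c i \<in> C" for i using c by (auto simp: bij_betw_def)
  have f[measurable]: "?f \<in> measurable (\<Pi>\<^sub>M b\<in>C. lborel) borel"
    by (subst borel_measurable_euclidean_space)
       (auto simp: Basis_vec_def inner_axis intro!: measurable_component_singleton[of _ C "\<lambda>_. lborel", simplified] cC)
  fix l r :: "real^'n" assume lr: "\<And>b. b \<in> Basis \<Longrightarrow> l \<bullet> b \<le> r \<bullet> b"
  have lr': "l $ i \<le> r $ i" for i using lr[of "axis i 1"] by (simp add: inner_axis)
  let ?I = "\<lambda>b. {l $ inv_into UNIV c b <..< r $ inv_into UNIV c b}"
  have ic: "inv_into UNIV c (c i) = i" for i using c by (simp add: bij_betw_def)
  have "?f -` box l r \<inter> space (\<Pi>\<^sub>M b\<in>C. lborel) = Pi\<^sub>E C ?I"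
  proof (intro set_eqI iffI)
    fix x assume "x \<in> ?f -` box l r \<inter> space (\<Pi>\<^sub>M b\<in>C. lborel)"
    then show "x \<in> Pi\<^sub>E C ?I"
      using c by (auto simp: space_PiM PiE_def Pi_def mem_box_cart bij_betw_def ic)
  next
    fix x assume "x \<in> Pi\<^sub>E C ?I"
    then show "x \<in> ?f -` box l r \<inter> space (\<Pi>\<^sub>M b\<in>C. lborel)"
      using cC by (force simp: space_PiM PiE_def Pi_def mem_box_cart ic)
  qed
  then have "emeasure (distr (\<Pi>\<^sub>M b\<in>C. lborel) borel ?f) (box l r) = (\<Prod>b\<in>C. emeasure lborel (?I b))"
    using C by (simp add: emeasure_distr emeasure_PiM)
  also have "\<dots> = (\<Prod>i\<in>UNIV. emeasure lborel (?I (c i)))"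
    by (rule prod.reindex_bij_betw[OF c, symmetric])
  also have "\<dots> = (\<Prod>i\<in>UNIV. ennreal (r $ i - l $ i))"
    using lr' by (intro prod.cong refl) (simp add: ic emeasure_lborel_Ioo)
  also have "\<dots> = ennreal (\<Prod>b\<in>Basis. (r - l) \<bullet> b)"
    using lr' by (subst prod_ennreal) (auto simp: prod_Basis_cart inner_axis)
  finally show "emeasure (distr (\<Pi>\<^sub>M b\<in>C. lborel) borel ?f) (box l r) = ennreal (\<Prod>b\<in>Basis. (r - l) \<bullet> b)" .
qed simp

text \<open>The matrix whose columns are the vectors of \<open>C\<close> is orthogonal and hence preserves volume. It turns the standard
coordinates into coordinates with respect to \<open>C\<close>.\<close>

lemma emeasure_lborel_orthonormal_coordinates:
  fixes C :: "(real^'n) set"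
  assumes C: "card C = CARD('n)" and orth: "pairwise orthogonal C" and norm1: "\<And>b. b \<in> C \<Longrightarrow> norm b = 1"
    and S: "compact S"
  shows "emeasure lborel S =
    emeasure (\<Pi>\<^sub>M b\<in>C. lborel) {x \<in> space (\<Pi>\<^sub>M b\<in>C. lborel). (\<Sum>b\<in>C. x b *\<^sub>R b) \<in> S}"
proof -
  have finC: "finite C" using C by (metis card.infinite zero_less_card_finite less_irrefl)
  obtain c :: "'n \<Rightarrow> real^'n" where c: "bij_betw c UNIV C"
    using finite_same_card_bij[OF finite_class.finite_UNIV finC] C by metis
  then have inj: "c i = c j \<longleftrightarrow> i = j" and cC: "c i \<in> C" for i j
    by (auto simp: bij_betw_def inj_on_def)
  define A where "A = (\<chi> i j. c j $ i)"
  have col: "column j A = c j" for j by (simp add: column_def A_def)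
  have om: "orthogonal_matrix A"
    unfolding orthogonal_matrix_orthonormal_columns col
    using norm1 cC orth inj by (auto simp: pairwise_def)
  then have AtA: "transpose A ** A = mat 1" and AAt: "A ** transpose A = mat 1"
    by (simp_all add: orthogonal_matrix_def)
  define T where "T = (*v) (transpose A) ` S"
  have T: "compact T" unfolding T_def
    using S by (intro compact_continuous_image matrix_vector_mult_linear_continuous_on)
  have AT: "(*v) A ` T = S"
    by (simp add: T_def image_image matrix_vector_mul_assoc AAt del: transpose_matrix_vector)
  have mem: "A *v z \<in> S \<longleftrightarrow> z \<in> T" for z
  proof
    assume "A *v z \<in> S"
    then have "transpose A *v (A *v z) \<in> T" by (auto simp: T_def)
    then show "z \<in> T" by (simp add: matrix_vector_mul_assoc AtA del: transpose_matrix_vector)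
  qed (use AT in auto)
  have "measure lebesgue S = \<bar>det (matrix ((*v) A))\<bar> * measure lebesgue T"
    using volume_linear_image[of "(*v) A" T] AT T by (simp add: lmeasurable_compact)
  then have "measure lebesgue S = measure lebesgue T"
    using det_orthogonal_matrix[OF om] by auto
  then have "emeasure lborel S = emeasure lborel T"
    using S T emeasure_compact_finite[OF S] emeasure_compact_finite[OF T]
    by (simp add: measure_completion emeasure_eq_ennreal_measure borel_compact less_top)
  also have "\<dots> = emeasure (distr (\<Pi>\<^sub>M b\<in>C. lborel) borel (\<lambda>x. \<chi> i. x (c i))) T"
    by (subst lborel_cart_PiM[OF c]) simp
  also have "\<dots> = emeasure (\<Pi>\<^sub>M b\<in>C. lborel) ((\<lambda>x. \<chi> i. x (c i)) -` T \<inter> space (\<Pi>\<^sub>M b\<in>C. lborel))"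
  proof (rule emeasure_distr)
    show "(\<lambda>x. \<chi> i. x (c i)) \<in> measurable (\<Pi>\<^sub>M b\<in>C. lborel) (borel :: (real^'n) measure)"
      by (subst borel_measurable_euclidean_space)
         (auto simp: Basis_vec_def inner_axis intro!: measurable_component_singleton[of _ C "\<lambda>_. lborel", simplified] cC)
  qed (use borel_compact[OF T] in simp)
  also have "(\<lambda>x. \<chi> i. x (c i)) -` T \<inter> space (\<Pi>\<^sub>M b\<in>C. lborel) =
      {x \<in> space (\<Pi>\<^sub>M b\<in>C. lborel). (\<Sum>b\<in>C. x b *\<^sub>R b) \<in> S}"
  proof -
    have "A *v (\<chi> i. x (c i)) = (\<Sum>b\<in>C. x b *\<^sub>R b)" for x
    proof -
      have "A *v (\<chi> i. x (c i)) = (\<Sum>i\<in>UNIV. x (c i) *\<^sub>R c i)"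
        by (simp add: matrix_mult_sum col scalar_mult_eq_scaleR)
      also have "\<dots> = (\<Sum>b\<in>C. x b *\<^sub>R b)" by (rule sum.reindex_bij_betw[OF c])
      finally show ?thesis .
    qed
    then show ?thesis using mem[symmetric] by auto
  qed
  finally show ?thesis .
qed

lemma ennreal_integral_power_Icc:
  fixes h :: real
  assumes h: "h > 0"
  shows "(\<integral>\<^sup>+s. ennreal ((s / h) ^ k) * indicator {0..h} s \<partial>lborel) = ennreal (h / real (Suc k))"
proof -
  define c where "c = real (Suc k)"
  have c: "c \<noteq> 0" by (simp add: c_def)
  have "(\<integral>\<^sup>+s. ennreal ((s / h) ^ k) * indicator {0..h} s \<partial>lborel) =
      ennreal (1 / (h ^ k * c) * h ^ Suc k - 1 / (h ^ k * c) * 0 ^ Suc k)"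
  proof (rule nn_integral_FTC_Icc)
    fix s assume "s \<in> {0..h}"
    then show "0 \<le> (s / h) ^ k" using h by simp
    have "((\<lambda>s. s ^ Suc k) has_field_derivative c * s ^ k) (at s)"
      using DERIV_pow[of "Suc k" s] by (simp add: c_def)
    from DERIV_cmult[OF this, of "1 / (h ^ k * c)"]
    show "((\<lambda>s. 1 / (h ^ k * c) * s ^ Suc k) has_field_derivative (s / h) ^ k) (at s)"
      using c h by (simp add: power_divide)
  qed (use h in auto)
  then show ?thesis using h c unfolding c_def[symmetric] by simp
qed

text \<open>The formula \<open>volume = height * base / dimension\<close> for a pyramid. In orthonormal coordinates adapted to
the hyperplane, the slice of the pyramid at height \<open>s\<close> is the base scaled by \<open>s / h\<close>,
so Fubini gives the integral of \<open>(s / h) ^ (n - 1)\<close> from \<open>0\<close> to \<open>h\<close>.\<close>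

lemma affine_volume_pyramid:
  fixes F :: "(real^'n) set"
  assumes F: "compact F" and hyp: "F \<subseteq> {x. u \<bullet> x = h}" and u: "norm u = 1" and h: "h > 0"
    and dimF: "aff_dim F = int CARD('n) - 1"
  shows "h * affine_volume F = CARD('n) * measure lebesgue (pyramid F)"
proof -
  interpret product_sigma_finite "\<lambda>_. lborel :: real measure" ..
  define D where "D = {x - y | x y. x \<in> F \<and> y \<in> F}"
  define B where "B = (SOME B. pairwise orthogonal B \<and> (\<forall>b\<in>B. norm b = 1) \<and> span B = span D)"
  obtain B0 where "pairwise orthogonal B0" "\<And>b. b \<in> B0 \<Longrightarrow> norm b = 1" "span B0 = span D"
    using orthonormal_basis_subspace[OF subspace_span, of D] by metis
  then have "\<exists>B. pairwise orthogonal B \<and> (\<forall>b\<in>B. norm b = 1) \<and> span B = span D" by blast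
  from someI_ex[OF this, folded B_def]
  have orthB: "pairwise orthogonal B" and normB: "\<And>b. b \<in> B \<Longrightarrow> norm b = 1" and spanB: "span B = span D"
    by blast+
  have indB: "independent B"
    using normB by (intro pairwise_orthogonal_independent orthB) force
  then have finB: "finite B" by (rule independent_imp_finite)
  have "F \<noteq> {}" using dimF by auto
  then obtain a where a: "a \<in> F" by blast
  have "span D = span ((\<lambda>x. x - a) ` F)"
    unfolding span_eq
  proof (intro conjI subsetI)
    fix z assume "z \<in> D"
    then obtain x y where xy: "x \<in> F" "y \<in> F" and z: "z = (x - a) - (y - a)" by (auto simp: D_def)
    show "z \<in> span ((\<lambda>x. x - a) ` F)" unfolding z by (intro span_diff span_base imageI xy)
  next
    fix z assume "z \<in> (\<lambda>x. x - a) ` F"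
    then show "z \<in> span D" using a by (auto simp: D_def intro!: span_base)
  qed
  then have "int (dim (span D)) = aff_dim F"
    using aff_dim_eq_dim_subtract[of a F] a by (simp add: hull_inc)
  then have cardB: "card B + 1 = CARD('n)"
    using dim_eq_card_independent[OF indB] dimF spanB by (metis add.commute diff_add_cancel dim_span of_nat_1 of_nat_add of_nat_eq_iff)
  have "D \<subseteq> {x. u \<bullet> x = 0}" using subsetD[OF hyp] by (auto simp: D_def inner_diff_right)
  then have "span D \<subseteq> {x. u \<bullet> x = 0}" by (rule span_minimal) (rule subspace_hyperplane)
  then have uB: "u \<bullet> b = 0" if "b \<in> B" for b using that spanB span_base[of b B] by auto
  have "u \<noteq> 0" using u by auto
  then have unB: "u \<notin> B" using uB[of u] by auto
  let ?C = "insert u B"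
  have cardC: "card ?C = CARD('n)" using cardB finB unB by simp
  have orthC: "pairwise orthogonal ?C"
    using orthB uB by (auto simp: pairwise_insert orthogonal_def inner_commute)
  have normC: "norm b = 1" if "b \<in> ?C" for b using that normB u by auto
  let ?P = "\<Pi>\<^sub>M b\<in>B. (lborel :: real measure)"
  let ?L = "\<lambda>x. \<Sum>b\<in>B. x b *\<^sub>R b"
  have Lu: "u \<bullet> ?L x = 0" for x using uB by (simp add: inner_sum_right)
  have Lb: "?L x \<bullet> b = x b" if "b \<in> B" for x b
  proof -
    have "?L x \<bullet> b = (\<Sum>c\<in>B. if c = b then x b else 0)"
      unfolding inner_sum_left
      using orthB normB that by (intro sum.cong refl) (auto simp: pairwise_def orthogonal_def norm_eq_1)
    then show ?thesis using that finB by simp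
  qed
  define K where "K = {x \<in> space ?P. h *\<^sub>R u + ?L x \<in> F}"
  have [measurable]: "F \<in> sets borel" using F by (simp add: borel_compact)
  have K: "K \<in> sets ?P" unfolding K_def by measurable
  have img: "(\<lambda>x. \<lambda>b\<in>B. x \<bullet> b) ` F = K"
  proof (intro equalityI subsetI)
    fix z assume "z \<in> (\<lambda>x. \<lambda>b\<in>B. x \<bullet> b) ` F"
    then obtain x where x: "x \<in> F" and z: "z = (\<lambda>b\<in>B. x \<bullet> b)" by blast
    have "x \<in> span ?C"
    proof -
      have "independent ?C"
        using normC by (intro pairwise_orthogonal_independent orthC) force
      then have "span ?C = UNIV"
        using card_eq_dim[of ?C UNIV] cardC finB by (simp add: dim_UNIV subset_UNIV top.extremum_unique)
      then show ?thesis by simp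
    qed
    then have "(\<Sum>b\<in>?C. (x \<bullet> b) *\<^sub>R b) = x"
      using finB normC by (intro orthonormal_basis_expand orthC) auto
    then have "(x \<bullet> u) *\<^sub>R u + (\<Sum>b\<in>B. (x \<bullet> b) *\<^sub>R b) = x" using finB unB by simp
    moreover have "x \<bullet> u = h" using x hyp by (auto simp: inner_commute)
    moreover have "?L z = (\<Sum>b\<in>B. (x \<bullet> b) *\<^sub>R b)" by (simp add: z)
    ultimately have "h *\<^sub>R u + ?L z = x" by simp
    then show "z \<in> K" using x by (auto simp: K_def z space_PiM)
  next
    fix z assume z: "z \<in> K"
    let ?x = "h *\<^sub>R u + ?L z"
    have zx: "(\<lambda>b\<in>B. ?x \<bullet> b) = z"
      using z uB by (auto simp: K_def space_PiM PiE_def extensional_def inner_add_left Lb)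
    have "?x \<in> F" using z by (simp add: K_def)
    then show "z \<in> (\<lambda>x. \<lambda>b\<in>B. x \<bullet> b) ` F" using imageI[of ?x F "\<lambda>x. \<lambda>b\<in>B. x \<bullet> b"] unfolding zx by blast
  qed
  have av: "affine_volume F = measure ?P K"
    unfolding affine_volume_def Let_def D_def[symmetric] B_def[symmetric] img ..
  have slice: "emeasure ?P {x \<in> space ?P. s *\<^sub>R u + ?L x \<in> pyramid F} =
      ennreal ((s / h) ^ card B) * indicator {0..h} s * emeasure ?P K" if s: "s \<noteq> 0" for s
  proof (cases "s \<in> {0..h}")
    case True
    then have s0: "s > 0" using s by auto
    have "s *\<^sub>R u + ?L x \<in> pyramid F \<longleftrightarrow> h *\<^sub>R u + ?L (\<lambda>b\<in>B. (h / s) * x b) \<in> F" for x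
    proof -
      have L: "?L (\<lambda>b\<in>B. (h / s) * x b) = (h / s) *\<^sub>R ?L x" by (simp add: scaleR_sum_right)
      have y: "h *\<^sub>R u + ?L (\<lambda>b\<in>B. (h / s) * x b) = (h / s) *\<^sub>R (s *\<^sub>R u + ?L x)"
        unfolding L using s0 by (simp add: scaleR_add_right)
      show ?thesis unfolding y
      proof
        assume "s *\<^sub>R u + ?L x \<in> pyramid F"
        then obtain t y where t: "y \<in> F" "s *\<^sub>R u + ?L x = t *\<^sub>R y" by (auto simp: pyramid_def)
        then have "u \<bullet> (s *\<^sub>R u + ?L x) = t * h" using hyp by auto
        then have "s = t * h" using u by (simp add: inner_add_right Lu norm_eq_1)
        moreover have "t \<noteq> 0" using calculation s0 by auto
        ultimately show "(h / s) *\<^sub>R (s *\<^sub>R u + ?L x) \<in> F" using t(1) h unfolding t(2) by simp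
      next
        assume "(h / s) *\<^sub>R (s *\<^sub>R u + ?L x) \<in> F"
        moreover have "s *\<^sub>R u + ?L x = (s / h) *\<^sub>R ((h / s) *\<^sub>R (s *\<^sub>R u + ?L x))" using s0 h by simp
        moreover have "0 \<le> s / h" "s / h \<le> 1" using True h by auto
        ultimately show "s *\<^sub>R u + ?L x \<in> pyramid F" unfolding pyramid_def by blast
      qed
    qed
    then have "{x \<in> space ?P. s *\<^sub>R u + ?L x \<in> pyramid F} = {x \<in> space ?P. (\<lambda>b\<in>B. (h / s) * x b) \<in> K}"
      by (auto simp: K_def space_PiM)
    then show ?thesis
      using emeasure_PiM_lborel_scale_vimage[OF finB _ K, of "h / s"] s0 h True by simp
  next
    case False
    have "s *\<^sub>R u + ?L x \<notin> pyramid F" for x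
    proof
      assume "s *\<^sub>R u + ?L x \<in> pyramid F"
      then obtain t y where t: "y \<in> F" "s *\<^sub>R u + ?L x = t *\<^sub>R y" "0 \<le> t" "t \<le> 1" by (auto simp: pyramid_def)
      then have "u \<bullet> (s *\<^sub>R u + ?L x) = t * h" using hyp by auto
      then have "s = t * h" using u by (simp add: inner_add_right Lu norm_eq_1)
      then show False using False t h by (simp add: mult_le_cancel_right1)
    qed
    then show ?thesis using False by simp
  qed
  have cpt: "compact (pyramid F)" by (rule compact_pyramid[OF F])
  then have [measurable]: "pyramid F \<in> sets borel" by (rule borel_compact)
  let ?E = "{x \<in> space (\<Pi>\<^sub>M b\<in>?C. (lborel :: real measure)). (\<Sum>b\<in>?C. x b *\<^sub>R b) \<in> pyramid F}"
  have E[measurable]: "?E \<in> sets (\<Pi>\<^sub>M b\<in>?C. (lborel :: real measure))" by measurable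
  have "emeasure lborel (pyramid F) = emeasure (\<Pi>\<^sub>M b\<in>?C. lborel) ?E"
    using cardC orthC normC cpt by (rule emeasure_lborel_orthonormal_coordinates)
  also have "\<dots> = (\<integral>\<^sup>+x. indicator ?E x \<partial>(\<Pi>\<^sub>M b\<in>?C. lborel))" using E by simp
  also have "\<dots> = (\<integral>\<^sup>+s. (\<integral>\<^sup>+x. indicator ?E (x(u := s)) \<partial>?P) \<partial>lborel)"
    by (rule product_nn_integral_insert_rev[OF finB unB]) measurable
  also have "\<dots> = (\<integral>\<^sup>+s. emeasure ?P {x \<in> space ?P. s *\<^sub>R u + ?L x \<in> pyramid F} \<partial>lborel)"
  proof (intro nn_integral_cong)
    fix s :: real
    have ind: "(indicator ?E (x(u := s)) :: ennreal) = indicator {x \<in> space ?P. s *\<^sub>R u + ?L x \<in> pyramid F} x"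
      if "x \<in> space ?P" for x
    proof -
      have "(\<Sum>b\<in>?C. (x(u := s)) b *\<^sub>R b) = s *\<^sub>R u + ?L x"
        using finB unB by (simp add: sum.insert) (intro sum.cong, auto)
      moreover have "x(u := s) \<in> space (\<Pi>\<^sub>M b\<in>?C. (lborel :: real measure))"
        using that by (auto simp: space_PiM PiE_def extensional_def)
      ultimately show ?thesis using that by (simp add: indicator_def)
    qed
    have "{x \<in> space ?P. s *\<^sub>R u + ?L x \<in> pyramid F} \<in> sets ?P" by measurable
    then show "(\<integral>\<^sup>+x. indicator ?E (x(u := s)) \<partial>?P) = emeasure ?P {x \<in> space ?P. s *\<^sub>R u + ?L x \<in> pyramid F}"
      by (simp add: ind cong: nn_integral_cong_simp)
  qed
  also have "\<dots> = (\<integral>\<^sup>+s. ennreal ((s / h) ^ card B) * indicator {0..h} s * emeasure ?P K \<partial>lborel)"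
    using slice AE_lborel_singleton[of "0::real"] by (intro nn_integral_cong_AE) auto
  also have "\<dots> = ennreal (h / real (Suc (card B))) * emeasure ?P K"
    by (simp add: nn_integral_multc ennreal_integral_power_Icc[OF h])
  finally have "measure lborel (pyramid F) = h / real (Suc (card B)) * measure ?P K"
    using h by (simp add: measure_def enn2real_mult)
  moreover have "measure lebesgue (pyramid F) = measure lborel (pyramid F)"
    by (simp add: measure_completion)
  moreover have "real CARD('n) = real (Suc (card B))" using cardB by simp
  ultimately show ?thesis unfolding av by simp
qed

section \<open>The weights of the surface area measure\<close>

lemma polytopes_oD:
  assumes "P \<in> polytopes_o"
  shows "polytope P" "compact P" "convex P" "0 \<in> P" "P \<noteq> {}"
  using assms by (auto simp: polytopes_o_def polytope_imp_compact polytope_imp_convex)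

lemma support_fun_eqI:
  assumes "z \<in> P" "\<And>y. y \<in> P \<Longrightarrow> u \<bullet> y \<le> u \<bullet> z"
  shows "support_fun P u = u \<bullet> z"
  unfolding support_fun_def using assms by (intro cSup_eq_maximum) auto

lemma support_face_nonempty:
  assumes "compact P" "P \<noteq> {}"
  shows "support_face P u \<noteq> {}"
proof -
  obtain z where z: "z \<in> P" "\<And>y. y \<in> P \<Longrightarrow> u \<bullet> y \<le> u \<bullet> z"
    using continuous_attains_sup[of P "\<lambda>y. u \<bullet> y"] assms continuous_on_inner[OF continuous_on_const continuous_on_id, of P u]
    by auto
  then show ?thesis using support_fun_eqI[OF z] by (auto simp: support_face_def)
qed

lemma support_fun_ge:
  assumes "compact P" "y \<in> P"
  shows "u \<bullet> y \<le> support_fun P u"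
proof -
  obtain z where z: "z \<in> P" "\<And>y. y \<in> P \<Longrightarrow> u \<bullet> y \<le> u \<bullet> z"
    using continuous_attains_sup[of P "\<lambda>y. u \<bullet> y"] assms continuous_on_inner[OF continuous_on_const continuous_on_id, of P u]
    by auto
  then show ?thesis using support_fun_eqI[OF z] z(2)[OF assms(2)] by simp
qed

lemma support_face_eq: "support_face P u = P \<inter> {x. u \<bullet> x = support_fun P u}"
  by (auto simp: support_face_def)

lemma compact_support_face: "compact P \<Longrightarrow> compact (support_face P u)"
  unfolding support_face_eq by (intro compact_Int_closed closed_hyperplane)

lemma convex_support_face: "convex P \<Longrightarrow> convex (support_face P u)"
  unfolding support_face_eq by (intro convex_Int convex_hyperplane)

lemma support_fun_nonneg: "P \<in> polytopes_o \<Longrightarrow> 0 \<le> support_fun P u"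
  using support_fun_ge[of P 0 u] by (simp add: polytopes_oD)

text \<open>The coefficient of the \<open>L\<^sub>p\<close> surface area measure in the form in which it makes sense for every direction \<open>u\<close>:
it vanishes if \<open>u\<close> is not the normal of a facet off the origin. If the supporting hyperplane contains the
origin, this is because \<open>0 powr (- p) = 0\<close>.\<close>

definition facet_weight :: "real \<Rightarrow> (real^'n) set \<Rightarrow> real^'n \<Rightarrow> real" where
  "facet_weight p P u =
    CARD('n) * (support_fun P u powr (- p) * measure lebesgue (pyramid (support_face P u)))"

lemma facet_weight_nonneg: "0 \<le> facet_weight p P u"
  by (simp add: facet_weight_def)

lemma facet_normals_support_fun_pos:
  assumes "P \<in> polytopes_o" "u \<in> facet_normals_off_origin P"
  shows "0 < support_fun P u"
  using assms support_fun_nonneg[OF assms(1), of u] polytopes_oD(4)[OF assms(1)]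
  by (auto simp: facet_normals_off_origin_def support_face_def less_le)

lemma facet_weight_facet_normal:
  fixes P :: "(real^'n) set"
  assumes P: "P \<in> polytopes_o" and u: "u \<in> facet_normals_off_origin P"
  shows "facet_weight p P u = support_fun P u powr (1 - p) * affine_volume (support_face P u)"
proof -
  let ?h = "support_fun P u"
  have h: "0 < ?h" by (rule facet_normals_support_fun_pos[OF P u])
  have "?h * affine_volume (support_face P u) = CARD('n) * measure lebesgue (pyramid (support_face P u))"
    using u h polytopes_oD(2)[OF P]
    by (intro affine_volume_pyramid compact_support_face)
       (auto simp: facet_normals_off_origin_def support_face_def)
  moreover have "?h powr (1 - p) = ?h powr (- p) * ?h"
    using h by (simp add: powr_diff powr_minus divide_inverse)
  ultimately show ?thesis by (simp add: facet_weight_def mult_ac)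
qed

text \<open>A pyramid with a base of dimension less than \<open>n - 1\<close> lies in a proper subspace.\<close>

lemma negligible_pyramid:
  fixes F :: "'a::euclidean_space set"
  assumes "aff_dim F < int DIM('a) - 1"
  shows "negligible (pyramid F)"
proof -
  have "int (dim F) = aff_dim (insert 0 F)"
    by (subst aff_dim_zero) (auto simp: hull_inc dim_insert span_zero)
  also have "\<dots> \<le> aff_dim F + 1" by (simp add: aff_dim_insert)
  finally have "dim (span F) < DIM('a)" using assms by simp
  then have "negligible (span F)" by (rule negligible_lowdim)
  moreover have "pyramid F \<subseteq> span F"
    by (auto simp: pyramid_def intro: span_mul span_base)
  ultimately show ?thesis by (rule negligible_subset)
qed

lemma facet_weight_not_facet_normal:
  fixes P :: "(real^'n) set"
  assumes P: "P \<in> polytopes_o" and u: "norm u = 1" "u \<notin> facet_normals_off_origin P"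
  shows "facet_weight p P u = 0"
proof (cases "0 \<in> support_face P u")
  case True
  then show ?thesis by (simp add: facet_weight_def support_face_def)
next
  case False
  let ?F = "support_face P u"
  have "?F face_of P"
    unfolding support_face_eq using polytopes_oD[OF P] support_fun_ge
    by (intro face_of_Int_supporting_hyperplane_le) auto
  then have "aff_dim ?F \<noteq> int DIM(real^'n) - 1"
    using u False by (auto simp: facet_normals_off_origin_def)
  moreover have "aff_dim ?F \<le> int DIM(real^'n) - 1"
    using aff_dim_subset[of ?F "{x. u \<bullet> x = support_fun P u}"] aff_dim_hyperplane[of u "support_fun P u"] u
    unfolding support_face_eq by fastforce
  ultimately have "negligible (pyramid ?F)" by (intro negligible_pyramid) simp
  then show ?thesis by (simp add: facet_weight_def negligible_imp_measure0)
qed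

lemma span_off_origin_facet:
  fixes F :: "'a::euclidean_space set"
  assumes F: "F \<subseteq> {x. u \<bullet> x = h}" "h \<noteq> 0" "aff_dim F = int DIM('a) - 1"
  shows "span F = UNIV"
proof -
  have "affine hull F \<subseteq> {x. u \<bullet> x = h}" using F(1) by (intro hull_minimal affine_hyperplane)
  then have "0 \<notin> affine hull F" using F(2) by auto
  then have "aff_dim (insert 0 F) = int DIM('a)" using F(3) by (simp add: aff_dim_insert)
  moreover have "aff_dim (insert 0 F) = int (dim F)"
    by (subst aff_dim_zero) (auto simp: hull_inc dim_insert span_zero)
  ultimately show ?thesis by (simp add: dim_eq_full)
qed

text \<open>A facet off the origin spans the whole space, so it determines the vector \<open>u / h\<close> of its hyperplane
\<open>u \<bullet> x = h\<close> and hence its unit normal. A polytope has finitely many faces.\<close>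

lemma finite_facet_normals:
  fixes P :: "'a::euclidean_space set"
  assumes P: "P \<in> polytopes_o"
  shows "finite (facet_normals_off_origin P)"
proof (rule inj_on_finite)
  show "support_face P ` facet_normals_off_origin P \<subseteq> {F. F face_of P}"
    by (auto simp: facet_normals_off_origin_def)
  show "finite {F. F face_of P}" by (rule finite_polytope_faces) (use P polytopes_oD in blast)
  show "inj_on (support_face P) (facet_normals_off_origin P)"
  proof (rule inj_onI)
    fix u v assume u: "u \<in> facet_normals_off_origin P" and v: "v \<in> facet_normals_off_origin P"
      and eq: "support_face P u = support_face P v"
    let ?F = "support_face P u" and ?h = "support_fun P u" and ?k = "support_fun P v"
    have pos: "0 < ?h" "0 < ?k"
      using support_fun_nonneg[OF P, of u] support_fun_nonneg[OF P, of v] u v polytopes_oD(4)[OF P]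
      by (auto simp: facet_normals_off_origin_def support_face_def less_le)
    have Fu: "x \<in> ?F \<Longrightarrow> u \<bullet> x = ?h" and Fv: "x \<in> ?F \<Longrightarrow> v \<bullet> x = ?k" for x
      using eq by (auto simp: support_face_def)
    have "span ?F = UNIV"
      using Fu pos u by (intro span_off_origin_facet[of _ u ?h]) (auto simp: facet_normals_off_origin_def)
    moreover have "span ?F \<subseteq> {x. (u /\<^sub>R ?h - v /\<^sub>R ?k) \<bullet> x = 0}"
    proof (rule span_minimal)
      show "?F \<subseteq> {x. (u /\<^sub>R ?h - v /\<^sub>R ?k) \<bullet> x = 0}" using Fu Fv pos by (auto simp: inner_diff_left)
    qed (rule subspace_hyperplane)
    ultimately have "(u /\<^sub>R ?h - v /\<^sub>R ?k) \<bullet> (u /\<^sub>R ?h - v /\<^sub>R ?k) = 0" by blast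
    then have e: "u /\<^sub>R ?h = v /\<^sub>R ?k" by simp
    then have "norm (u /\<^sub>R ?h) = norm (v /\<^sub>R ?k)" by simp
    then have "?h = ?k" using u v pos by (simp add: facet_normals_off_origin_def)
    then show "u = v" using e pos by simp
  qed
qed

lemma space_sphere_borel: "space sphere_borel = sphere 0 1"
  by (simp add: sphere_borel_def space_restrict_space)

lemma measurable_sphere_borel:
  fixes f :: "'a::euclidean_space \<Rightarrow> real"
  assumes "continuous_on (- {0}) f"
  shows "f \<in> borel_measurable sphere_borel"
  unfolding sphere_borel_def using assms
  by (intro borel_measurable_continuous_on_restrict) (auto elim: continuous_on_subset)

definition discrete_measure :: "'a::euclidean_space set \<Rightarrow> ('a \<Rightarrow> real) \<Rightarrow> 'a measure" where
  "discrete_measure U w = distr (point_measure U (\<lambda>u. ennreal (w u))) sphere_borel (\<lambda>u. u)"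

lemma sets_discrete_measure [simp]: "sets (discrete_measure U w) = sets sphere_borel"
  by (simp add: discrete_measure_def)

lemma emeasure_discrete_measure:
  assumes U: "finite U" "U \<subseteq> sphere 0 1" and A: "A \<in> sets sphere_borel"
  shows "emeasure (discrete_measure U w) A = (\<Sum>u\<in>U. ennreal (w u) * indicator A u)"
proof -
  have "emeasure (discrete_measure U w) A = emeasure (point_measure U (\<lambda>u. ennreal (w u))) (A \<inter> U)"
    unfolding discrete_measure_def using U A
    by (subst emeasure_distr) (auto simp: measurable_point_measure_eq1 space_sphere_borel space_point_measure)
  also have "\<dots> = (\<Sum>u\<in>A \<inter> U. ennreal (w u))" by (rule emeasure_point_measure_finite) (use U in auto)
  also have "\<dots> = (\<Sum>u\<in>U. ennreal (w u) * indicator A u)"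
    using U by (auto simp: sum.inter_restrict Int_commute indicator_def intro!: sum.cong)
  finally show ?thesis .
qed

lemma measure_discrete_measure:
  assumes U: "finite U" "U \<subseteq> sphere 0 1" and A: "A \<in> sets sphere_borel" and w: "\<And>u. u \<in> U \<Longrightarrow> 0 \<le> w u"
  shows "measure (discrete_measure U w) A = (\<Sum>u\<in>U. w u * indicator A u)"
proof -
  have "emeasure (discrete_measure U w) A = (\<Sum>u\<in>U. ennreal (w u * indicator A u))"
    unfolding emeasure_discrete_measure[OF U A] by (intro sum.cong refl) (simp split: split_indicator)
  also have "\<dots> = ennreal (\<Sum>u\<in>U. w u * indicator A u)" using w by (intro sum_ennreal) auto
  finally show ?thesis using w by (simp add: measure_def sum_nonneg)
qed

lemma discrete_measure_in_sphere_measures: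
  assumes U: "finite U" "U \<subseteq> sphere 0 1"
  shows "discrete_measure U w \<in> sphere_measures"
proof -
  have "space sphere_borel \<in> sets sphere_borel" by simp
  from emeasure_discrete_measure[OF U this, of w]
  have "emeasure (discrete_measure U w) (space (discrete_measure U w)) \<noteq> \<infinity>"
    using U by (simp add: discrete_measure_def ennreal_mult_eq_top_iff indicator_def)
  then show ?thesis by (auto simp: sphere_measures_def intro: finite_measureI)
qed

lemma integral_discrete_measure:
  fixes f :: "'a::euclidean_space \<Rightarrow> real"
  assumes U: "finite U" "U \<subseteq> sphere 0 1" and w: "\<And>u. u \<in> U \<Longrightarrow> 0 \<le> w u"
    and f: "f \<in> borel_measurable sphere_borel"
  shows "(\<integral>x. f x \<partial>discrete_measure U w) = (\<Sum>u\<in>U. w u * f u)"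
  unfolding discrete_measure_def using U w f
  by (subst integral_distr)
     (auto simp: measurable_point_measure_eq1 space_sphere_borel lebesgue_integral_point_measure_finite)

text \<open>The measure that puts mass \<open>w u\<close> on every unit vector \<open>u\<close>, where only finitely many masses are nonzero. The
function \<open>w\<close> is defined on the whole space, so weights of different polytopes can be compared without
keeping track of their normals.\<close>

definition has_weights :: "'a::euclidean_space measure \<Rightarrow> ('a \<Rightarrow> real) \<Rightarrow> bool" where
  "has_weights M w \<longleftrightarrow> (\<forall>u. 0 \<le> w u) \<and> finite {u \<in> sphere 0 1. w u \<noteq> 0} \<and>
    M = discrete_measure {u \<in> sphere 0 1. w u \<noteq> 0} w"

lemma has_weights_sphere_measures: "has_weights M w \<Longrightarrow> M \<in> sphere_measures"
  unfolding has_weights_def by (metis (no_types, lifting) discrete_measure_in_sphere_measures mem_Collect_eq subsetI)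

lemma has_weights_measure:
  assumes M: "has_weights M w" and U: "finite U" "U \<subseteq> sphere 0 1" "{u \<in> sphere 0 1. w u \<noteq> 0} \<subseteq> U"
    and A: "A \<in> sets sphere_borel"
  shows "measure M A = (\<Sum>u\<in>U. w u * indicator A u)"
proof -
  let ?S = "{u \<in> sphere 0 1. w u \<noteq> 0}"
  have "measure M A = measure (discrete_measure ?S w) A" using M by (simp add: has_weights_def)
  also have "\<dots> = (\<Sum>u\<in>?S. w u * indicator A u)"
    using M A by (intro measure_discrete_measure) (auto simp: has_weights_def)
  also have "\<dots> = (\<Sum>u\<in>U. w u * indicator A u)"
    using U by (intro sum.mono_neutral_left) auto
  finally show ?thesis .
qed

lemma has_weights_integral:
  fixes f :: "'a::euclidean_space \<Rightarrow> real"
  assumes M: "has_weights M w" and U: "finite U" "U \<subseteq> sphere 0 1" "{u \<in> sphere 0 1. w u \<noteq> 0} \<subseteq> U"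
    and f: "f \<in> borel_measurable sphere_borel"
  shows "(\<integral>x. f x \<partial>M) = (\<Sum>u\<in>U. w u * f u)"
proof -
  let ?S = "{u \<in> sphere 0 1. w u \<noteq> 0}"
  have "(\<integral>x. f x \<partial>M) = (\<integral>x. f x \<partial>discrete_measure ?S w)" using M by (simp add: has_weights_def)
  also have "\<dots> = (\<Sum>u\<in>?S. w u * f u)"
    using M f by (intro integral_discrete_measure) (auto simp: has_weights_def)
  also have "\<dots> = (\<Sum>u\<in>U. w u * f u)"
    using U by (intro sum.mono_neutral_left) auto
  finally show ?thesis .
qed

lemma has_weightsI:
  assumes M: "M \<in> sphere_measures" and w: "\<And>u. 0 \<le> w u"
    and U: "finite U" "U \<subseteq> sphere 0 1" "{u \<in> sphere 0 1. w u \<noteq> 0} \<subseteq> U"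
    and meas: "\<And>A. A \<in> sets sphere_borel \<Longrightarrow> measure M A = (\<Sum>u\<in>U. w u * indicator A u)"
  shows "has_weights M w"
proof -
  let ?S = "{u \<in> sphere 0 1. w u \<noteq> 0}"
  have S: "finite ?S" using U by (blast intro: finite_subset)
  have "M = discrete_measure ?S w"
  proof (rule measure_eqI)
    show "sets M = sets (discrete_measure ?S w)" using M by (simp add: sphere_measures_def)
    fix A assume "A \<in> sets M"
    then have A: "A \<in> sets sphere_borel" using M by (simp add: sphere_measures_def)
    have D: "discrete_measure ?S w \<in> sphere_measures"
      by (rule discrete_measure_in_sphere_measures[OF S]) auto
    have "measure M A = (\<Sum>u\<in>?S. w u * indicator A u)"
      unfolding meas[OF A] using U by (intro sum.mono_neutral_right) auto
    also have "\<dots> = measure (discrete_measure ?S w) A"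
      using w by (intro measure_discrete_measure[OF S _ A, symmetric]) auto
    finally show "emeasure M A = emeasure (discrete_measure ?S w) A"
      using M D by (simp add: sphere_measures_def finite_measure.emeasure_eq_measure)
  qed
  then show ?thesis using w S by (simp add: has_weights_def)
qed

lemma facet_directions_subset:
  assumes P: "P \<in> polytopes_o"
  shows "{u \<in> sphere 0 1. facet_weight p P u \<noteq> 0} \<subseteq> facet_normals_off_origin P"
  using facet_weight_not_facet_normal[OF P] by auto

lemma has_weights_Lp_surface_area_measure:
  assumes P: "P \<in> polytopes_o"
  shows "has_weights (Lp_surface_area_measure p P) (facet_weight p P)"
proof -
  let ?N = "facet_normals_off_origin P"
  have N: "finite ?N" "?N \<subseteq> sphere 0 1"
    using finite_facet_normals[OF P] by (auto simp: facet_normals_off_origin_def)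
  let ?D = "discrete_measure ?N (facet_weight p P)"
  have sp: "space ?D = sphere 0 1" by (simp add: discrete_measure_def space_sphere_borel)
  have "Lp_surface_area_measure p P = measure_of (sphere 0 1) (sets sphere_borel) (emeasure ?D)"
    unfolding Lp_surface_area_measure_def
  proof (rule measure_of_eq)
    show "sets sphere_borel \<subseteq> Pow (sphere (0::real^'a) 1)"
      using sets.space_closed[of sphere_borel] by (simp add: space_sphere_borel)
    fix A :: "(real^'a) set" assume "A \<in> sigma_sets (sphere 0 1) (sets sphere_borel)"
    then have A: "A \<in> sets sphere_borel"
      using sets.sigma_sets_eq[of "sphere_borel :: (real^'a) measure"] by (simp add: space_sphere_borel)
    show "(\<Sum>u\<in>?N. ennreal (support_fun P u powr (1 - p) * affine_volume (support_face P u)) *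
        emeasure (return sphere_borel u) A) = emeasure ?D A"
      unfolding emeasure_discrete_measure[OF N A] using A
      by (intro sum.cong refl) (simp add: facet_weight_facet_normal[OF P])
  qed
  also have "\<dots> = ?D" using measure_of_of_measure[of ?D] by (simp add: sp)
  finally have "Lp_surface_area_measure p P = ?D" .
  then show ?thesis
    using N facet_directions_subset[OF P]
    by (intro has_weightsI[of _ _ ?N])
       (auto simp: discrete_measure_in_sphere_measures measure_discrete_measure facet_weight_nonneg)
qed

section \<open>Combinations of surface area measures are contravariant valuations\<close>

lemma support_face_dominating_Un:
  assumes P: "compact P" "P \<noteq> {}" and Q: "compact Q" and lt: "support_fun Q u < support_fun P u"
  shows "support_fun (P \<union> Q) u = support_fun P u \<and> support_face (P \<union> Q) u = support_face P u"
proof -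
  obtain z where z: "z \<in> P" "u \<bullet> z = support_fun P u"
    using support_face_nonempty[OF P, of u] by (auto simp: support_face_def)
  have "support_fun (P \<union> Q) u = u \<bullet> z"
    using z support_fun_ge[OF P(1), of _ u] support_fun_ge[OF Q, of _ u] lt
    by (intro support_fun_eqI) force+
  then show ?thesis using z support_fun_ge[OF Q, of _ u] lt by (force simp: support_face_def)
qed

text \<open>A point \<open>y\<close> of the lower support set belongs to \<open>P\<close>: join it to a point of \<open>P\<close> that lies further out. The
segment stays in the convex set \<open>P \<union> Q\<close> and, apart from \<open>y\<close>, it is too high for \<open>Q\<close>, so it lies in the closed set \<open>P\<close>.\<close>

lemma support_face_dominating_Int:
  fixes P Q :: "'a::euclidean_space set"
  assumes P: "compact P" "convex P" "P \<noteq> {}" and Q: "compact Q" "convex Q" "Q \<noteq> {}"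
    and PQ: "convex (P \<union> Q)" and lt: "support_fun Q u < support_fun P u"
  shows "support_fun (P \<inter> Q) u = support_fun Q u \<and> support_face (P \<inter> Q) u = support_face Q u"
proof -
  obtain z where z: "z \<in> P" "u \<bullet> z = support_fun P u"
    using support_face_nonempty[OF P(1,3), of u] by (auto simp: support_face_def)
  have inP: "y \<in> P" if y: "y \<in> support_face Q u" for y
  proof -
    have yQ: "y \<in> Q" "u \<bullet> y = support_fun Q u" using y by (auto simp: support_face_def)
    have "y \<noteq> z" using yQ z lt by auto
    have "open_segment y z \<subseteq> P"
    proof
      fix x assume "x \<in> open_segment y z"
      then obtain t where t: "0 < t" "t < 1" and x: "x = (1 - t) *\<^sub>R y + t *\<^sub>R z"
        by (auto simp: in_segment)
      have "x \<in> P \<union> Q"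
        unfolding x using yQ z t by (intro convexD[OF PQ]) auto
      moreover have "u \<bullet> x = support_fun Q u + t * (support_fun P u - support_fun Q u)"
        by (simp add: x inner_add_right yQ z algebra_simps)
      then have "support_fun Q u < u \<bullet> x" using t lt by simp
      then have "x \<notin> Q" using support_fun_ge[OF Q(1), of x u] by auto
      ultimately show "x \<in> P" by blast
    qed
    then have "closure (open_segment y z) \<subseteq> P"
      by (intro closure_minimal compact_imp_closed[OF P(1)])
    then have "closed_segment y z \<subseteq> P" using \<open>y \<noteq> z\<close> by (simp add: closure_open_segment)
    then show "y \<in> P" using ends_in_segment(1) by blast
  qed
  obtain y where y: "y \<in> support_face Q u" using support_face_nonempty[OF Q(1,3)] by blast
  then have "support_fun (P \<inter> Q) u = u \<bullet> y"
    using inP[OF y] support_fun_ge[OF Q(1), of _ u]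
    by (intro support_fun_eqI) (auto simp: support_face_def)
  then have eq: "support_fun (P \<inter> Q) u = support_fun Q u" using y by (simp add: support_face_def)
  then show ?thesis using inP by (auto simp: support_face_def)
qed

text \<open>The two support sets meet because their union is a support set of the convex set \<open>P \<union> Q\<close>, hence connected,
and both are closed.\<close>

lemma support_face_tie:
  fixes P Q :: "'a::euclidean_space set"
  assumes P: "compact P" "P \<noteq> {}" and Q: "compact Q" "Q \<noteq> {}"
    and PQ: "convex (P \<union> Q)" and eq: "support_fun P u = support_fun Q u"
  shows "support_fun (P \<union> Q) u = support_fun P u" "support_fun (P \<inter> Q) u = support_fun P u"
    "support_face (P \<union> Q) u = support_face P u \<union> support_face Q u"
    "support_face (P \<inter> Q) u = support_face P u \<inter> support_face Q u"
    "support_face P u \<inter> support_face Q u \<noteq> {}"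
proof -
  let ?F = "support_face P u" and ?G = "support_face Q u"
  obtain z where z: "z \<in> P" "u \<bullet> z = support_fun P u"
    using support_face_nonempty[OF P, of u] by (auto simp: support_face_def)
  have "support_fun (P \<union> Q) u = u \<bullet> z"
    using z support_fun_ge[OF P(1), of _ u] support_fun_ge[OF Q(1), of _ u] eq
    by (intro support_fun_eqI) auto
  then show hU: "support_fun (P \<union> Q) u = support_fun P u" using z by simp
  then show FU: "support_face (P \<union> Q) u = ?F \<union> ?G" using eq by (auto simp: support_face_def)
  have "connected (?F \<union> ?G)"
    unfolding FU[symmetric] by (intro convex_connected convex_support_face PQ)
  moreover have "closed ?F" "closed ?G"
    using P Q by (auto intro!: compact_imp_closed compact_support_face)
  moreover have "?F \<noteq> {}" "?G \<noteq> {}" using support_face_nonempty P Q by auto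
  ultimately show ne: "?F \<inter> ?G \<noteq> {}"
    unfolding connected_closed by blast
  then obtain y where y: "y \<in> ?F" "y \<in> ?G" by blast
  then have "support_fun (P \<inter> Q) u = u \<bullet> y"
    using support_fun_ge[OF P(1), of _ u] by (intro support_fun_eqI) (auto simp: support_face_def)
  then show hI: "support_fun (P \<inter> Q) u = support_fun P u" using y by (simp add: support_face_def)
  then show "support_face (P \<inter> Q) u = ?F \<inter> ?G" using eq by (auto simp: support_face_def)
qed

lemma pyramid_Int:
  assumes F: "F \<subseteq> {x. u \<bullet> x = h}" and G: "G \<subseteq> {x. u \<bullet> x = h}" and h: "h \<noteq> 0" and ne: "F \<inter> G \<noteq> {}"
  shows "pyramid (F \<inter> G) = pyramid F \<inter> pyramid G"
proof
  show "pyramid (F \<inter> G) \<subseteq> pyramid F \<inter> pyramid G" by (auto simp: pyramid_def)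
  show "pyramid F \<inter> pyramid G \<subseteq> pyramid (F \<inter> G)"
  proof
    fix z assume "z \<in> pyramid F \<inter> pyramid G"
    then obtain s x t y where z: "z = s *\<^sub>R x" "x \<in> F" "0 \<le> s" "s \<le> 1" "z = t *\<^sub>R y" "y \<in> G"
      unfolding pyramid_def by blast
    have "u \<bullet> z = s * h" using z(1,2) F by auto
    moreover have "u \<bullet> z = t * h" using z(5,6) G by auto
    ultimately have st: "s = t" using h by simp
    show "z \<in> pyramid (F \<inter> G)"
    proof (cases "s = 0")
      case True
      obtain w where "w \<in> F \<inter> G" using ne by blast
      moreover have "z = 0 *\<^sub>R w" using True z(1) by simp
      ultimately show ?thesis unfolding pyramid_def by (intro CollectI exI[of _ 0] exI[of _ w]) simp
    next
      case False
      then have "x = y" using z st by simp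
      then have "x \<in> F \<inter> G" using z by blast
      then show ?thesis unfolding pyramid_def using z(1,3,4) by blast
    qed
  qed
qed

lemma facet_weight_valuation_of_le:
  fixes P Q :: "(real^'n) set"
  assumes P: "P \<in> polytopes_o" and Q: "Q \<in> polytopes_o" and PQ: "convex (P \<union> Q)"
    and le: "support_fun Q u \<le> support_fun P u"
  shows "facet_weight p (P \<union> Q) u + facet_weight p (P \<inter> Q) u = facet_weight p P u + facet_weight p Q u"
proof (cases "support_fun Q u = support_fun P u")
  case False
  then have lt: "support_fun Q u < support_fun P u" using le by simp
  show ?thesis
    using support_face_dominating_Un[OF _ _ _ lt] support_face_dominating_Int[OF _ _ _ _ _ _ PQ lt]
      polytopes_oD[OF P] polytopes_oD[OF Q]
    by (simp add: facet_weight_def)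
next
  case True
  let ?h = "support_fun P u" and ?F = "support_face P u" and ?G = "support_face Q u"
  note tie = support_face_tie[OF polytopes_oD(2,5)[OF P] polytopes_oD(2,5)[OF Q] PQ True[symmetric]]
  show ?thesis
  proof (cases "?h = 0")
    case True
    then show ?thesis using tie \<open>support_fun Q u = ?h\<close> by (simp add: facet_weight_def)
  next
    case False
    have cF: "pyramid ?F \<in> lmeasurable" "pyramid ?G \<in> lmeasurable"
      by (intro lmeasurable_compact compact_pyramid compact_support_face polytopes_oD P Q)+
    have "pyramid (?F \<union> ?G) = pyramid ?F \<union> pyramid ?G" by (auto simp: pyramid_def)
    moreover have "pyramid (?F \<inter> ?G) = pyramid ?F \<inter> pyramid ?G"
      using False True tie(5) by (intro pyramid_Int[of _ u ?h]) (auto simp: support_face_def)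
    ultimately have "measure lebesgue (pyramid (?F \<union> ?G)) + measure lebesgue (pyramid (?F \<inter> ?G)) =
        measure lebesgue (pyramid ?F) + measure lebesgue (pyramid ?G)"
      using measure_Un3[OF cF] by simp
    then show ?thesis
      using True by (simp add: facet_weight_def tie(1-4) distrib_left[symmetric])
  qed
qed

lemma facet_weight_valuation:
  fixes P Q :: "(real^'n) set"
  assumes P: "P \<in> polytopes_o" and Q: "Q \<in> polytopes_o" and PQ: "P \<union> Q \<in> polytopes_o"
  shows "facet_weight p (P \<union> Q) u + facet_weight p (P \<inter> Q) u = facet_weight p P u + facet_weight p Q u"
proof (cases "support_fun Q u \<le> support_fun P u")
  case True
  then show ?thesis using facet_weight_valuation_of_le[OF P Q] polytopes_oD[OF PQ] by blast
next
  case False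
  then have "facet_weight p (Q \<union> P) u + facet_weight p (Q \<inter> P) u = facet_weight p Q u + facet_weight p P u"
    using polytopes_oD(3)[OF PQ] by (intro facet_weight_valuation_of_le[OF Q P]) (auto simp: Un_commute)
  then show ?thesis by (simp add: Un_commute Int_commute)
qed

text \<open>The map \<open>g\<close> is the inverse of the adjoint of \<open>f\<close>; it carries the normals of \<open>P\<close> to those of \<open>f ` P\<close>
without changing the support numbers.\<close>

lemma facet_weight_linear_image:
  fixes f g :: "real^'n \<Rightarrow> real^'n"
  assumes f: "linear f" and fg: "\<And>x y. f x \<bullet> g y = x \<bullet> y" and P: "compact P"
  shows "facet_weight p (f ` P) (g u) = \<bar>det (matrix f)\<bar> * facet_weight p P u"
proof -
  have fg': "g y \<bullet> f x = y \<bullet> x" for x y by (metis fg inner_commute)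
  have h: "support_fun (f ` P) (g u) = support_fun P u"
    by (simp add: support_fun_def image_image fg')
  have "support_face (f ` P) (g u) = f ` support_face P u"
    by (auto simp: support_face_def h fg')
  then have "measure lebesgue (pyramid (support_face (f ` P) (g u))) =
      \<bar>det (matrix f)\<bar> * measure lebesgue (pyramid (support_face P u))"
    using P by (simp add: pyramid_linear_image f volume_linear_image lmeasurable_compact
        compact_pyramid compact_support_face)
  then show ?thesis by (simp add: facet_weight_def h)
qed

lemma facet_weight_scaleR:
  fixes P :: "(real^'n) set"
  assumes P: "P \<in> polytopes_o" and r: "r > 0"
  shows "facet_weight p P (r *\<^sub>R u) = r powr (- p) * facet_weight p P u"
proof -
  obtain z where z: "z \<in> P" "u \<bullet> z = support_fun P u"
    using support_face_nonempty[OF polytopes_oD(2,5)[OF P], of u] by (auto simp: support_face_def)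
  have "support_fun P (r *\<^sub>R u) = (r *\<^sub>R u) \<bullet> z"
    using z support_fun_ge[OF polytopes_oD(2)[OF P], of _ u] r by (intro support_fun_eqI) auto
  then have h: "support_fun P (r *\<^sub>R u) = r * support_fun P u" using z by simp
  moreover have "support_face P (r *\<^sub>R u) = support_face P u"
    using r by (auto simp: support_face_def h)
  ultimately show ?thesis
    using r support_fun_nonneg[OF P, of u] by (simp add: facet_weight_def powr_mult mult_ac)
qed

lemma polytopes_o_linear_image:
  assumes "linear f" "P \<in> polytopes_o" shows "f ` P \<in> polytopes_o"
  using assms by (force simp: polytopes_o_def polytope_linear_image image_iff linear_0)

lemma facet_weight_uminus:
  fixes P :: "(real^'n) set"
  assumes P: "P \<in> polytopes_o"
  shows "facet_weight p (uminus ` P) u = facet_weight p P (- u)"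
proof -
  have lin: "linear (uminus :: real^'n \<Rightarrow> real^'n)" by (rule linearI) auto
  have "matrix (uminus :: real^'n \<Rightarrow> real^'n) ** matrix uminus = matrix (uminus \<circ> uminus)"
    by (rule matrix_compose[OF lin lin, symmetric])
  also have "uminus \<circ> uminus = (id :: real^'n \<Rightarrow> real^'n)" by auto
  finally have "det (matrix (uminus :: real^'n \<Rightarrow> real^'n)) * det (matrix (uminus :: real^'n \<Rightarrow> real^'n)) = 1"
    by (metis det_I det_mul matrix_id_mat_1)
  then have "\<bar>det (matrix (uminus :: real^'n \<Rightarrow> real^'n))\<bar> = 1" by (auto simp: square_eq_1_iff)
  then show ?thesis
    using facet_weight_linear_image[OF lin, of uminus P p "- u"] polytopes_oD[OF P] by simp
qed

lemma GL_adjoint: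
  assumes "\<phi> \<in> GL"
  shows "(\<phi> *v x) \<bullet> (transpose (matrix_inv \<phi>) *v y) = x \<bullet> y"
    "transpose (matrix_inv \<phi>) *v (transpose \<phi> *v y) = y"
    "transpose \<phi> *v (transpose (matrix_inv \<phi>) *v y) = y"
proof -
  have inv: "matrix_inv \<phi> ** \<phi> = mat 1" "\<phi> ** matrix_inv \<phi> = mat 1"
  proof -
    have "\<exists>B. \<phi> ** B = mat 1 \<and> B ** \<phi> = mat 1" using assms by (simp add: GL_def invertible_def)
    from someI_ex[OF this] show "matrix_inv \<phi> ** \<phi> = mat 1" "\<phi> ** matrix_inv \<phi> = mat 1"
      by (simp_all add: matrix_inv_def)
  qed
  have "(\<phi> *v x) \<bullet> (transpose (matrix_inv \<phi>) *v y) = (matrix_inv \<phi> *v (\<phi> *v x)) \<bullet> y"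
    by (metis dot_lmul_matrix transpose_matrix_vector inner_commute transpose_transpose)
  then show "(\<phi> *v x) \<bullet> (transpose (matrix_inv \<phi>) *v y) = x \<bullet> y"
    by (simp add: matrix_vector_mul_assoc inv)
  show "transpose (matrix_inv \<phi>) *v (transpose \<phi> *v y) = y"
    unfolding matrix_vector_mul_assoc matrix_transpose_mul[symmetric] inv by (simp add: transpose_mat del: transpose_matrix_vector)
  show "transpose \<phi> *v (transpose (matrix_inv \<phi>) *v y) = y"
    unfolding matrix_vector_mul_assoc matrix_transpose_mul[symmetric] inv by (simp add: transpose_mat del: transpose_matrix_vector)
qed

lemma continuous_on_punctured_linear:
  fixes F :: "'a::euclidean_space \<Rightarrow> real" and g :: "'a \<Rightarrow> 'a"
  assumes F: "continuous_on (- {0}) F" and g: "linear g" "\<And>x. g x = 0 \<Longrightarrow> x = 0"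
  shows "continuous_on (- {0}) (\<lambda>x. F (g x))"
proof (rule continuous_on_compose2[OF F])
  show "continuous_on (- {0}) g"
    using g(1) by (simp add: linear_conv_bounded_linear linear_continuous_on)
  show "g ` (- {0}) \<subseteq> - {0}" using g(2) by auto
qed

text \<open>The valuation property holds for the weight at each direction. For contravariance, \<open>\<psi>\<close> maps the
directions of \<open>P\<close> to those of its image. Normalizing a direction multiplies the weight by a power of its
length with exponent \<open>p\<close> and the test function by the reciprocal power, so that the product is unaffected.\<close>

lemma weighted_valuation_contravariant:
  fixes \<mu> :: "(real^'n) set \<Rightarrow> (real^'n) measure"
  assumes c: "0 \<le> c1" "0 \<le> c2"
    and hw: "\<And>P. P \<in> polytopes_o \<Longrightarrow>
      has_weights (\<mu> P) (\<lambda>u. c1 * facet_weight p P u + c2 * facet_weight p P (- u))"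
  shows "valuation \<mu> \<and> contravariant GL p \<mu>"
proof -
  let ?W = "\<lambda>(P :: (real^'n) set) u. c1 * facet_weight p P u + c2 * facet_weight p P (- u)"
  let ?S = "\<lambda>P. {u \<in> sphere 0 1. ?W P u \<noteq> 0}"
  have fin: "finite (?S P)" if "P \<in> polytopes_o" for P
    using hw[OF that] by (simp add: has_weights_def)
  have "valuation \<mu>"
    unfolding valuation_def
  proof (intro allI impI ballI)
    fix P Q :: "(real^'n) set" and A assume P: "P \<in> polytopes_o" and Q: "Q \<in> polytopes_o" and U: "P \<union> Q \<in> polytopes_o"
      and I: "P \<inter> Q \<in> polytopes_o" and A: "A \<in> sets (sphere_borel :: (real^'n) measure)"
    let ?U = "?S P \<union> ?S Q \<union> ?S (P \<union> Q) \<union> ?S (P \<inter> Q)"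
    have finU: "finite ?U" using fin P Q U I by blast
    have m: "measure (\<mu> R) A = (\<Sum>u\<in>?U. ?W R u * indicator A u)"
      if "R \<in> polytopes_o" "?S R \<subseteq> ?U" for R
      using that by (intro has_weights_measure[OF hw finU _ _ A]) auto
    have val: "?W (P \<union> Q) u + ?W (P \<inter> Q) u = ?W P u + ?W Q u" for u
    proof -
      have "?W (P \<union> Q) u + ?W (P \<inter> Q) u = c1 * (facet_weight p (P \<union> Q) u + facet_weight p (P \<inter> Q) u) +
         c2 * (facet_weight p (P \<union> Q) (- u) + facet_weight p (P \<inter> Q) (- u))"
        by (simp add: algebra_simps)
      then show ?thesis unfolding facet_weight_valuation[OF P Q U] by (simp add: algebra_simps)
    qed
    have "measure (\<mu> (P \<union> Q)) A + measure (\<mu> (P \<inter> Q)) A =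
        (\<Sum>u\<in>?U. (?W (P \<union> Q) u + ?W (P \<inter> Q) u) * indicator A u)"
      using m[OF U] m[OF I] by (simp add: sum.distrib[symmetric] distrib_right Un_upper1 Un_upper2 le_supI1)
    also have "\<dots> = (\<Sum>u\<in>?U. ?W P u * indicator A u) + (\<Sum>u\<in>?U. ?W Q u * indicator A u)"
      unfolding val by (simp add: sum.distrib[symmetric] distrib_right)
    also have "\<dots> = measure (\<mu> P) A + measure (\<mu> Q) A"
      using m[OF P] m[OF Q] by (simp add: le_supI1)
    finally show "measure (\<mu> (P \<union> Q)) A + measure (\<mu> (P \<inter> Q)) A = measure (\<mu> P) A + measure (\<mu> Q) A" .
  qed
  moreover have "contravariant GL p \<mu>"
    unfolding contravariant_def
  proof (intro ballI allI impI)
    fix \<phi> :: "real^'n^'n" and P :: "(real^'n) set" and F :: "real^'n \<Rightarrow> real"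
    assume \<phi>: "\<phi> \<in> GL" and P: "P \<in> polytopes_o" and F: "continuous_on (- {0}) F" and hom: "homogeneous p F"
    define f where "f = (*v) \<phi>"
    define g where "g = (*v) (transpose (matrix_inv \<phi>))"
    define g' where "g' = (*v) (transpose \<phi>)"
    have lin: "linear f" "linear g" "linear g'" by (simp_all add: f_def g_def g'_def del: transpose_matrix_vector)
    have fg: "f x \<bullet> g y = x \<bullet> y" and gg': "g (g' y) = y" and g'g: "g' (g y) = y" for x y
      using GL_adjoint[OF \<phi>] by (auto simp: f_def g_def g'_def simp del: transpose_matrix_vector)
    have g0: "g x = 0 \<longleftrightarrow> x = 0" for x using g'g[of x] lin by (metis linear_0)
    have g'0: "g' x = 0 \<longleftrightarrow> x = 0" for x using gg'[of x] lin by (metis linear_0)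
    have fP: "f ` P \<in> polytopes_o" using lin P by (simp add: polytopes_o_linear_image)
    define \<psi> where "\<psi> u = g u /\<^sub>R norm (g u)" for u
    have W0: "?W (f ` P) (\<psi> u) = \<bar>det \<phi>\<bar> * (inverse (norm (g u)) powr (- p) * ?W P u)" if "u \<noteq> 0" for u
    proof -
      let ?r = "inverse (norm (g u))"
      have r: "?r > 0" using that g0 by simp
      have neg: "- \<psi> u = ?r *\<^sub>R g (- u)" by (simp add: \<psi>_def linear_neg[OF lin(2)])
      have w: "facet_weight p (f ` P) (?r *\<^sub>R g v) = \<bar>det \<phi>\<bar> * (?r powr (- p) * facet_weight p P v)" for v
        unfolding facet_weight_scaleR[OF fP r] facet_weight_linear_image[OF lin(1) fg polytopes_oD(2)[OF P]]
        by (simp add: f_def)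
      show ?thesis unfolding neg unfolding \<psi>_def w by (simp add: algebra_simps)
    qed
    have W: "?W (f ` P) (\<psi> u) * F (\<psi> u) = \<bar>det \<phi>\<bar> * (?W P u * F (g u))" if "u \<noteq> 0" for u
    proof -
      let ?r = "inverse (norm (g u))"
      have r: "?r > 0" using that g0 by simp
      have "F (\<psi> u) = ?r powr p * F (g u)"
        using hom r that g0 by (simp add: homogeneous_def \<psi>_def)
      moreover have "?r powr (- p) * ?r powr p = 1" using r by (simp add: powr_add[symmetric])
      ultimately show ?thesis unfolding W0[OF that] by (simp add: algebra_simps)
    qed
    have inj: "inj_on \<psi> (?S P)"
    proof (rule inj_onI)
      fix u v assume u: "u \<in> ?S P" and v: "v \<in> ?S P" and eq: "\<psi> u = \<psi> v"
      let ?r = "inverse (norm (g u))" and ?s = "inverse (norm (g v))"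
      have uv: "norm u = 1" "norm v = 1" using u v by simp_all
      then have "g u \<noteq> 0" "g v \<noteq> 0" using g0 by (metis norm_zero zero_neq_one)+
      then have rs: "?r > 0" "?s > 0" by simp_all
      have "g' (\<psi> u) = ?r *\<^sub>R u" "g' (\<psi> v) = ?s *\<^sub>R v"
        by (simp_all add: \<psi>_def linear_cmul[OF lin(3)] g'g)
      then have e: "?r *\<^sub>R u = ?s *\<^sub>R v" using eq by simp
      then have "norm (?r *\<^sub>R u) = norm (?s *\<^sub>R v)" by simp
      then have "?r = ?s" using uv rs unfolding norm_scaleR by simp
      then show "u = v" using e rs by (metis less_irrefl scaleR_cancel_left)
    qed
    have sub: "?S (f ` P) \<subseteq> \<psi> ` ?S P"
    proof
      fix v assume v: "v \<in> ?S (f ` P)"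
      then have "v \<noteq> 0" by auto
      define u where "u = g' v /\<^sub>R norm (g' v)"
      have n0: "norm (g' v) > 0" using \<open>v \<noteq> 0\<close> g'0 by simp
      have gu: "g u = v /\<^sub>R norm (g' v)" by (simp add: u_def linear_cmul[OF lin(2)] gg')
      then have "\<psi> u = v" using v n0 by (simp add: \<psi>_def)
      moreover have u1: "norm u = 1" using n0 by (simp add: u_def)
      moreover have "?W P u \<noteq> 0"
      proof -
        have "u \<noteq> 0" using u1 by auto
        from W0[OF this] show ?thesis using v \<open>\<psi> u = v\<close> by auto
      qed
      ultimately show "v \<in> \<psi> ` ?S P" by auto
    qed
    have img1: "finite (\<psi> ` ?S P)" using fin[OF P] by simp
    have img2: "\<psi> ` ?S P \<subseteq> sphere 0 1"
    proof
      fix v assume "v \<in> \<psi> ` ?S P"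
      then obtain u where u: "norm u = 1" and v: "v = \<psi> u" by auto
      then have "g u \<noteq> 0" using g0 by (metis norm_zero zero_neq_one)
      then show "v \<in> sphere 0 1" by (simp add: v \<psi>_def)
    qed
    have cont: "continuous_on (- {0}) (\<lambda>x. F (g x))"
      using lin(2) g0 by (intro continuous_on_punctured_linear[OF F]) auto
    have "(\<integral>x. F x \<partial>\<mu> (f ` P)) = (\<Sum>v\<in>\<psi> ` ?S P. ?W (f ` P) v * F v)"
      by (rule has_weights_integral[OF hw[OF fP] img1 img2 sub measurable_sphere_borel[OF F]])
    also have "\<dots> = (\<Sum>u\<in>?S P. ?W (f ` P) (\<psi> u) * F (\<psi> u))" using inj by (simp add: sum.reindex)
    also have "\<dots> = \<bar>det \<phi>\<bar> * (\<Sum>u\<in>?S P. ?W P u * F (g u))"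
      unfolding sum_distrib_left by (intro sum.cong refl W) auto
    also have "(\<Sum>u\<in>?S P. ?W P u * F (g u)) = (\<integral>x. F (g x) \<partial>\<mu> P)"
      by (rule has_weights_integral[OF hw[OF P] fin[OF P] _ subset_refl measurable_sphere_borel[OF cont], symmetric]) auto
    finally show "(\<integral>x. F x \<partial>\<mu> ((*v) \<phi> ` P)) = \<bar>det \<phi>\<bar> * (\<integral>x. F (transpose (matrix_inv \<phi>) *v x) \<partial>\<mu> P)"
      by (simp add: f_def g_def)
  qed
  ultimately show ?thesis ..
qed

section \<open>Simple valuations vanishing on simplices\<close>

text \<open>Since the polytope contains the origin, the right-hand sides of its inequalities are nonnegative and
can be normalized to \<open>1\<close> and \<open>0\<close>.\<close>

lemma polytopes_o_halfspace_representation: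
  fixes P :: "'a::euclidean_space set"
  assumes P: "P \<in> polytopes_o"
  obtains W Z where "finite W" "finite Z" "0 \<notin> W" "0 \<notin> Z"
    "\<forall>x. x \<in> P \<longleftrightarrow> (\<forall>w\<in>W. w \<bullet> x \<le> 1) \<and> (\<forall>z\<in>Z. z \<bullet> x \<le> 0)"
proof -
  have "polyhedron P" using polytopes_oD(1)[OF P] by (rule polytope_imp_polyhedron)
  then obtain H where H: "finite H" "P = \<Inter>H" and hs: "\<forall>h\<in>H. \<exists>a b. a \<noteq> 0 \<and> h = {x. a \<bullet> x \<le> b}"
    unfolding polyhedron_def by blast
  from bchoice[OF hs] obtain a where "\<forall>h\<in>H. \<exists>b. a h \<noteq> 0 \<and> h = {x. a h \<bullet> x \<le> b}" ..
  from bchoice[OF this] obtain b where ab: "\<forall>h\<in>H. a h \<noteq> 0 \<and> h = {x. a h \<bullet> x \<le> b h}" ..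
  have a0: "a h \<noteq> 0" if "h \<in> H" for h by (rule bspec[OF ab that, THEN conjunct1])
  have mem: "x \<in> h \<longleftrightarrow> a h \<bullet> x \<le> b h" if "h \<in> H" for h x
  proof -
    have "(x \<in> h) = (x \<in> {x. a h \<bullet> x \<le> b h})" by (rule arg_cong[OF bspec[OF ab that, THEN conjunct2]])
    then show ?thesis by simp
  qed
  have b0: "0 \<le> b h" if "h \<in> H" for h
    using polytopes_oD(4)[OF P] mem[OF that, of 0] that unfolding H(2) by auto
  let ?W = "(\<lambda>h. a h /\<^sub>R b h) ` {h \<in> H. 0 < b h}" and ?Z = "a ` {h \<in> H. b h = 0}"
  show thesis
  proof (rule that)
    show "finite ?W" "finite ?Z" using H(1) by auto
    show "0 \<notin> ?W" "0 \<notin> ?Z" using a0 by force+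
    show "\<forall>x. x \<in> P \<longleftrightarrow> (\<forall>w\<in>?W. w \<bullet> x \<le> 1) \<and> (\<forall>z\<in>?Z. z \<bullet> x \<le> 0)"
    proof
      fix x
      have "x \<in> P \<longleftrightarrow> (\<forall>h\<in>H. a h \<bullet> x \<le> b h)" using mem unfolding H(2) by blast
      also have "\<dots> \<longleftrightarrow> (\<forall>h\<in>H. (0 < b h \<longrightarrow> (a h /\<^sub>R b h) \<bullet> x \<le> 1) \<and> (b h = 0 \<longrightarrow> a h \<bullet> x \<le> 0))"
      proof (intro ball_cong refl)
        fix h assume "h \<in> H"
        then have "0 < b h \<or> b h = 0" using b0[of h] by linarith
        then show "a h \<bullet> x \<le> b h \<longleftrightarrow> (0 < b h \<longrightarrow> (a h /\<^sub>R b h) \<bullet> x \<le> 1) \<and> (b h = 0 \<longrightarrow> a h \<bullet> x \<le> 0)"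
          by (auto simp: field_simps)
      qed
      also have "\<dots> \<longleftrightarrow> (\<forall>w\<in>?W. w \<bullet> x \<le> 1) \<and> (\<forall>z\<in>?Z. z \<bullet> x \<le> 0)" by blast
      finally show "x \<in> P \<longleftrightarrow> (\<forall>w\<in>?W. w \<bullet> x \<le> 1) \<and> (\<forall>z\<in>?Z. z \<bullet> x \<le> 0)" .
    qed
  qed
qed

lemma convex_hull_insert_0_eq_pyramid:
  assumes "convex K"
  shows "convex hull (insert 0 K) = insert 0 (pyramid K)"
proof (cases "K = {}")
  case True
  then show ?thesis by (simp add: pyramid_def)
next
  case False
  have "convex hull (insert 0 K) = {z. \<exists>u v b. 0 \<le> u \<and> 0 \<le> v \<and> u + v = 1 \<and> b \<in> K \<and> z = u *\<^sub>R 0 + v *\<^sub>R b}"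
    using convex_hull_insert[OF False, of 0] assms by (simp add: convex_hull_eq[symmetric] hull_same)
  also have "\<dots> = pyramid K"
  proof (intro set_eqI iffI)
    fix z assume "z \<in> pyramid K"
    then obtain t b where "0 \<le> t" "t \<le> 1" "b \<in> K" "z = t *\<^sub>R b" unfolding pyramid_def by blast
    then have "0 \<le> 1 - t \<and> 0 \<le> t \<and> 1 - t + t = 1 \<and> b \<in> K \<and> z = (1 - t) *\<^sub>R 0 + t *\<^sub>R b" by simp
    then show "z \<in> {z. \<exists>u v b. 0 \<le> u \<and> 0 \<le> v \<and> u + v = 1 \<and> b \<in> K \<and> z = u *\<^sub>R 0 + v *\<^sub>R b}" by blast
  next
    fix z assume "z \<in> {z. \<exists>u v b. 0 \<le> u \<and> 0 \<le> v \<and> u + v = 1 \<and> b \<in> K \<and> z = u *\<^sub>R 0 + v *\<^sub>R b}"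
    then obtain u v b where "0 \<le> u" "0 \<le> v" "u + v = 1" "b \<in> K" "z = v *\<^sub>R b" by auto
    then show "z \<in> pyramid K" unfolding pyramid_def by (intro CollectI exI[of _ v] exI[of _ b]) simp
  qed
  also have "\<dots> = insert 0 (pyramid K)"
  proof -
    obtain b where "b \<in> K" using False by blast
    then have "0 \<in> pyramid K" unfolding pyramid_def by (intro CollectI exI[of _ 0] exI[of _ b]) simp
    then show ?thesis by blast
  qed
  finally show ?thesis .
qed

text \<open>If the hull has interior points, then \<open>C\<close> spans the space, so it is a basis and the linear map that
carries the standard basis to \<open>C\<close> is invertible.\<close>

lemma simplex_cone_is_linear_image:
  fixes C :: "'a::euclidean_space set"
  assumes C: "finite C" "card C \<le> DIM('a)" and int: "interior (convex hull (insert 0 C)) \<noteq> {}"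
  obtains f :: "'a \<Rightarrow> 'a" where "linear f" "inj f" "f ` (convex hull (insert 0 Basis)) = convex hull (insert 0 C)"
proof -
  have "convex hull (insert 0 C) \<subseteq> span C"
    by (intro hull_minimal subspace_imp_convex) (auto intro: span_base span_zero)
  then have "interior (span C) \<noteq> {}" using int interior_mono by blast
  then have dim: "dim C = DIM('a)"
    using empty_interior_lowdim[of "span C"] dim_subset_UNIV[of C] by fastforce
  then have "card C = card (Basis :: 'a set)" using C dim_le_card'[OF C(1)] by simp
  then obtain c where c: "bij_betw c (Basis :: 'a set) C"
    using finite_same_card_bij[OF finite_Basis C(1)] by auto
  define f where "f x = (\<Sum>b\<in>Basis. (x \<bullet> b) *\<^sub>R c b)" for x
  have lin: "linear f"
    by (rule linearI) (simp_all add: f_def inner_add_left scaleR_add_left sum.distrib scaleR_sum_right)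
  have "f b = c b" if "b \<in> Basis" for b
  proof -
    have "f b = (\<Sum>b'\<in>Basis. if b' = b then c b else 0)"
      unfolding f_def using that by (intro sum.cong refl) (auto simp: inner_Basis)
    then show ?thesis using that by simp
  qed
  then have fB: "f ` Basis = C" using c by (auto simp: bij_betw_def)
  have "range f = span C"
    using linear_span_image[OF lin, of Basis] by (simp add: fB)
  then have "surj f" using dim by (simp add: dim_eq_full)
  then have "inj f" using lin linear_surjective_imp_injective by blast
  moreover have "f ` (convex hull (insert 0 Basis)) = convex hull (insert 0 C)"
    using lin by (simp add: convex_hull_linear_image fB linear_0)
  ultimately show thesis using that lin by blast
qed

text \<open>The faces of \<open>P\<close> in the hyperplanes \<open>w \<bullet> x = 1\<close> are exactly what is seen from the origin: the ray through a
nonzero point of \<open>P\<close> leaves \<open>P\<close> through one of them. The hulls \<open>S K\<close> of the origin and the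
simplices \<open>K\<close> of a triangulation of these faces therefore cover \<open>P\<close>. They overlap in null sets because two
points on a common ray that both lie in such faces agree, so \<open>S K\<close> and \<open>S K'\<close> only meet above the common
face of \<open>K\<close> and \<open>K'\<close>.\<close>

lemma simple_valuation_eq_0:
  fixes P :: "'a::euclidean_space set"
  assumes \<nu>: "simple_valuation \<nu>"
    and simplices: "\<And>f :: 'a \<Rightarrow> 'a. linear f \<Longrightarrow> inj f \<Longrightarrow> \<nu> (f ` (convex hull (insert 0 Basis))) = 0"
    and P: "P \<in> polytopes_o"
  shows "\<nu> P = 0"
proof (cases "interior P = {}")
  case True
  then show ?thesis using \<nu> P by (auto simp: simple_valuation_def)
next
  case intP: False
  obtain W Z where W: "finite W" "finite Z" "0 \<notin> W" "0 \<notin> Z"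
    and memP': "\<forall>x. x \<in> P \<longleftrightarrow> (\<forall>w\<in>W. w \<bullet> x \<le> 1) \<and> (\<forall>z\<in>Z. z \<bullet> x \<le> 0)"
    by (rule polytopes_o_halfspace_representation[OF P])
  note memP = memP'[rule_format]
  define \<M> where "\<M> = (\<lambda>w. P \<inter> {x. w \<bullet> x = 1}) ` W"
  have face: "C face_of P" if "C \<in> \<M>" for C
    using that memP polytopes_oD(3)[OF P] by (auto simp: \<M>_def intro!: face_of_Int_supporting_hyperplane_le)
  obtain \<T> where T: "simplicial_complex \<T>" "\<Union>\<T> = \<Union>\<M>" and TM: "\<And>K. K \<in> \<T> \<Longrightarrow> \<exists>C. C \<in> \<M> \<and> K \<subseteq> C"
  proof (rule simplicial_subdivision_of_cell_complex[of \<M>])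
    show "finite \<M>" using W by (simp add: \<M>_def)
    show "polytope C" if "C \<in> \<M>" for C
      using face_of_polytope_polytope[OF polytopes_oD(1)[OF P] face[OF that]] .
    show "C1 \<inter> C2 face_of C1" if "C1 \<in> \<M>" "C2 \<in> \<M>" for C1 C2
      by (rule face_of_subset[OF face_of_Int[OF face[OF that(1)] face[OF that(2)]] Int_lower1
            face_of_imp_subset[OF face[OF that(1)]]])
  qed (use that in blast)
  have finT: "finite \<T>" using T(1) by (simp add: simplicial_complex_def)
  have Tface: "K \<inter> K' face_of K" if "K \<in> \<T>" "K' \<in> \<T>" for K K'
    using T(1) that by (simp add: simplicial_complex_def)
  have KW: "\<exists>w\<in>W. \<forall>x\<in>K. w \<bullet> x = 1" if "K \<in> \<T>" for K
    using TM[OF that] by (auto simp: \<M>_def)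
  have KP: "K \<subseteq> P" if "K \<in> \<T>" for K using TM[OF that] by (auto simp: \<M>_def)
  have dimK: "aff_dim K \<le> int DIM('a) - 1" if K: "K \<in> \<T>" for K
  proof -
    obtain w where w: "w \<in> W" "\<forall>x\<in>K. w \<bullet> x = 1" using KW[OF K] by blast
    then have "aff_dim K \<le> aff_dim {x. w \<bullet> x = 1}" by (intro aff_dim_subset) auto
    moreover have "w \<noteq> 0" using w(1) W(3) by auto
    ultimately show ?thesis using aff_dim_hyperplane[of w 1] by simp
  qed
  have simplex: "\<exists>C. finite C \<and> card C \<le> DIM('a) \<and> K = convex hull C" if K: "K \<in> \<T>" for K
  proof -
    obtain n where n: "n simplex K" using T(1) K by (auto simp: simplicial_complex_def)
    then obtain C where C: "finite C" "int (card C) = n + 1" "K = convex hull C"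
      by (auto simp: simplex)
    then have "card C \<le> DIM('a)" using dimK[OF K] aff_dim_simplex[OF n] by simp
    then show ?thesis using C by blast
  qed
  define S where "S K = convex hull (insert 0 K)" for K :: "'a set"
  have convK: "convex K" if "K \<in> \<T>" for K using simplex[OF that] convex_convex_hull by blast
  have Spyr: "S K = insert 0 (pyramid K)" if "convex K" for K
    unfolding S_def by (rule convex_hull_insert_0_eq_pyramid[OF that])
  have Spo: "S K \<in> polytopes_o" if K: "K \<in> \<T>" for K
  proof -
    obtain C where C: "finite C" "K = convex hull C" using simplex[OF K] by blast
    have "S K = convex hull (insert 0 C)"
      unfolding S_def C(2) by (metis hull_insert)
    then show ?thesis using C hull_inc[of 0 "insert 0 C" convex] by (auto simp: polytopes_o_def polytope_def)
  qed
  have SP: "S K \<subseteq> P" if "K \<in> \<T>" for K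
    unfolding S_def using KP[OF that] polytopes_oD[OF P] by (intro hull_minimal) auto
  have cover: "\<exists>K\<in>\<T>. x \<in> S K" if x: "x \<in> P" "x \<noteq> 0" for x
  proof -
    have "\<exists>w\<in>W. 0 < w \<bullet> x"
    proof (rule ccontr)
      assume neg: "\<not> ?thesis"
      obtain B where B: "\<And>y. y \<in> P \<Longrightarrow> norm y \<le> B"
        using compact_imp_bounded[OF polytopes_oD(2)[OF P]] by (auto simp: bounded_iff)
      let ?t = "(\<bar>B\<bar> + 1) / norm x"
      have t: "0 < ?t" using x by simp
      have "?t *\<^sub>R x \<in> P"
        unfolding memP
      proof (intro conjI ballI)
        fix w assume "w \<in> W"
        then have "?t * (w \<bullet> x) \<le> 0" using neg t by (intro mult_nonneg_nonpos) auto
        then show "w \<bullet> (?t *\<^sub>R x) \<le> 1" by simp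
      next
        fix z assume "z \<in> Z"
        then have "?t * (z \<bullet> x) \<le> 0" using memP x t by (intro mult_nonneg_nonpos) auto
        then show "z \<bullet> (?t *\<^sub>R x) \<le> 0" by simp
      qed
      from B[OF this] show False using x by simp
    qed
    then have ne: "W \<noteq> {}" and pos: "\<exists>w\<in>W. 0 < w \<bullet> x" by auto
    \<comment> \<open>\<open>m\<close> is the gauge of \<open>P\<close> at \<open>x\<close>, so that \<open>x / m\<close> lies on one of the faces\<close>
    define m where "m = Max ((\<lambda>w. w \<bullet> x) ` W)"
    have m_ge: "w \<bullet> x \<le> m" if "w \<in> W" for w using W that by (auto simp: m_def)
    have "m \<in> (\<lambda>w. w \<bullet> x) ` W" unfolding m_def using W ne by (intro Max_in) auto
    then obtain w where w: "w \<in> W" "m = w \<bullet> x" by blast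
    have m0: "0 < m" using pos m_ge by force
    have m1: "m \<le> 1" using w x memP by simp
    let ?y = "x /\<^sub>R m"
    have "?y \<in> P"
      unfolding memP using m_ge m0 x memP by (auto simp: field_simps mult_le_0_iff)
    moreover have "w \<bullet> ?y = 1" using w m0 by simp
    ultimately have "?y \<in> \<Union>\<M>" using w by (auto simp: \<M>_def)
    then obtain K where K: "K \<in> \<T>" "?y \<in> K" using T(2) by blast
    have "x = m *\<^sub>R ?y" using m0 by simp
    then have "x \<in> pyramid K" unfolding pyramid_def using K m0 m1 by (intro CollectI exI[of _ m] exI[of _ ?y]) simp
    then show ?thesis using K Spyr[OF convK[OF K(1)]] by blast
  qed
  have "P \<noteq> {0}" using intP by auto
  then obtain x0 where "x0 \<in> P" "x0 \<noteq> 0" using polytopes_oD(5)[OF P] by blast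
  then have Tne: "\<T> \<noteq> {}" using cover by blast
  have "\<nu> P = (\<Sum>K\<in>S ` \<T>. \<nu> K)"
  proof (rule simple_valuation_dissection[OF \<nu> P])
    show "finite (S ` \<T>)" using finT by simp
    show "S ` \<T> \<subseteq> polytopes_o" using Spo by auto
    show "P = \<Union>(S ` \<T>)"
    proof
      show "\<Union>(S ` \<T>) \<subseteq> P" using SP by auto
      show "P \<subseteq> \<Union>(S ` \<T>)"
      proof
        fix x assume "x \<in> P"
        then show "x \<in> \<Union>(S ` \<T>)"
          using cover[of x] Tne polytopes_oD(4)[OF Spo] by (cases "x = 0") auto
      qed
    qed
  next
    fix R assume "R \<in> S ` \<T>"
    then obtain K where K: "K \<in> \<T>" and R: "R = S K" by blast
    obtain w where w: "w \<in> W" "\<forall>x\<in>K. w \<bullet> x = 1" using KW[OF K] by blast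
    obtain W' Z' where W': "finite W'" "finite Z'" "0 \<notin> W'" "0 \<notin> Z'"
      and mem': "\<forall>x. x \<in> S K \<longleftrightarrow> (\<forall>w\<in>W'. w \<bullet> x \<le> 1) \<and> (\<forall>z\<in>Z'. z \<bullet> x \<le> 0)"
      by (rule polytopes_o_halfspace_representation[OF Spo[OF K]])
    note mem = mem'[folded R, rule_format]
    have "R = P \<inter> {x. \<forall>a\<in>Z'. a \<bullet> x \<le> 0}"
    proof
      show "R \<subseteq> P \<inter> {x. \<forall>a\<in>Z'. a \<bullet> x \<le> 0}" using SP[OF K] mem R by auto
      show "P \<inter> {x. \<forall>a\<in>Z'. a \<bullet> x \<le> 0} \<subseteq> R"
      proof
        fix y assume y: "y \<in> P \<inter> {x. \<forall>a\<in>Z'. a \<bullet> x \<le> 0}"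
        show "y \<in> R"
        proof (cases "y = 0")
          case True
          then show ?thesis using polytopes_oD(4)[OF Spo[OF K]] R by simp
        next
          case False
          \<comment> \<open>shrink \<open>y\<close> until the constraints that are not active at the origin hold\<close>
          define e where "e = 1 / (1 + (\<Sum>v\<in>W'. \<bar>v \<bullet> y\<bar>))"
          have s: "0 \<le> (\<Sum>v\<in>W'. \<bar>v \<bullet> y\<bar>)" by (simp add: sum_nonneg)
          then have e: "0 < e" unfolding e_def by (intro divide_pos_pos add_pos_nonneg) auto
          have "e *\<^sub>R y \<in> R"
            unfolding mem
          proof (intro conjI ballI)
            fix v assume "v \<in> W'"
            then have "v \<bullet> y \<le> (\<Sum>v\<in>W'. \<bar>v \<bullet> y\<bar>)"
              using member_le_sum[of v W' "\<lambda>v. \<bar>v \<bullet> y\<bar>"] W' by force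
            then have "(v \<bullet> y) / (1 + (\<Sum>v\<in>W'. \<bar>v \<bullet> y\<bar>)) \<le> 1"
              using s by (subst divide_le_eq_1_pos) linarith+
            then show "v \<bullet> (e *\<^sub>R y) \<le> 1" by (simp add: e_def)
          next
            fix z assume "z \<in> Z'"
            then show "z \<bullet> (e *\<^sub>R y) \<le> 0" using y e by (auto simp: mult_le_0_iff)
          qed
          then have "e *\<^sub>R y \<in> pyramid K"
            using False e R Spyr[OF convK[OF K]] by auto
          then obtain t k where tk: "0 \<le> t" "k \<in> K" "e *\<^sub>R y = t *\<^sub>R k" unfolding pyramid_def by blast
          have yk: "y = (t / e) *\<^sub>R k"
          proof -
            have "y = inverse e *\<^sub>R (e *\<^sub>R y)" using e by simp
            then show ?thesis unfolding tk(3) by (simp add: divide_inverse_commute)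
          qed
          have "w \<bullet> y \<le> 1" using y memP w by blast
          then have "t / e \<le> 1" unfolding yk using w tk by simp
          then have "y \<in> pyramid K"
            unfolding pyramid_def using yk tk e by (intro CollectI exI[of _ "t / e"] exI[of _ k]) simp
          then show ?thesis using R Spyr[OF convK[OF K]] by simp
        qed
      qed
    qed
    then show "\<exists>A. finite A \<and> 0 \<notin> A \<and> R = P \<inter> {x. \<forall>a\<in>A. a \<bullet> x \<le> 0}"
      using W' by (intro exI[of _ Z']) blast
  next
    fix R R' assume "R \<in> S ` \<T>" "R' \<in> S ` \<T>" "R \<noteq> R'"
    then obtain K K' where K: "K \<in> \<T>" "R = S K" and K': "K' \<in> \<T>" "R' = S K'" and ne: "K \<noteq> K'" by blast
    obtain w where w: "w \<in> W" "\<forall>x\<in>K. w \<bullet> x = 1" using KW[OF K(1)] by blast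
    obtain w' where w': "w' \<in> W" "\<forall>x\<in>K'. w' \<bullet> x = 1" using KW[OF K'(1)] by blast
    have cKK: "convex (K \<inter> K')" using convK K K' by (intro convex_Int) auto
    have sub: "S K \<inter> S K' \<subseteq> S (K \<inter> K')"
    proof
      fix z assume z: "z \<in> S K \<inter> S K'"
      show "z \<in> S (K \<inter> K')"
      proof (cases "z = 0")
        case True
        then show ?thesis using Spyr[OF cKK] by simp
      next
        case False
        then have "z \<in> pyramid K" "z \<in> pyramid K'"
          using z Spyr[OF convK] K K' by auto
        then obtain t k t' k' where tk: "0 \<le> t" "t \<le> 1" "k \<in> K" "z = t *\<^sub>R k"
          and tk': "0 \<le> t'" "k' \<in> K'" "z = t' *\<^sub>R k'"
          unfolding pyramid_def by blast
        have "w' \<bullet> k \<le> 1" "w \<bullet> k' \<le> 1" using memP KP K K' w w' tk tk' by blast+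
        moreover have "w' \<bullet> z = t * (w' \<bullet> k)" unfolding tk(4) by simp
        moreover have "w \<bullet> z = t' * (w \<bullet> k')" unfolding tk'(3) by simp
        ultimately have "w' \<bullet> z \<le> t" "w \<bullet> z \<le> t'"
          using mult_left_mono[of "w' \<bullet> k" 1 t] mult_left_mono[of "w \<bullet> k'" 1 t'] tk(1) tk'(1) by simp_all
        moreover have "w' \<bullet> z = t'" using w' tk' by simp
        moreover have "w \<bullet> z = t" using w tk by simp
        ultimately have "t = t'" by simp
        then have "k = k'" using tk tk' False by auto
        then have "z \<in> pyramid (K \<inter> K')" unfolding pyramid_def using tk tk' by blast
        then show ?thesis using Spyr[OF cKK] by simp
      qed
    qed
    show "interior (R \<inter> R') = {}"
    proof (rule ccontr)
      assume "interior (R \<inter> R') \<noteq> {}"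
      then have "interior (S (K \<inter> K')) \<noteq> {}" using interior_mono[OF sub] K K' by blast
      then have "aff_dim (insert 0 (K \<inter> K')) = int DIM('a)"
        unfolding S_def using aff_dim_nonempty_interior by (metis aff_dim_convex_hull)
      then have d: "int DIM('a) - 1 \<le> aff_dim (K \<inter> K')"
        by (simp add: aff_dim_insert split: if_splits)
      have full: "L = L \<inter> L'" if "L \<in> \<T>" "L' \<in> \<T>" "L \<inter> L' = K \<inter> K'" for L L'
      proof (rule ccontr)
        assume "L \<noteq> L \<inter> L'"
        then have "aff_dim (L \<inter> L') < aff_dim L"
          using face_of_aff_dim_lt[OF convK[OF that(1)] Tface[OF that(1,2)]] by metis
        then show False using dimK[OF that(1)] d that(3) by simp
      qed
      have "K = K \<inter> K'" "K' = K' \<inter> K" using full K K' by (auto simp: Int_commute)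
      then show False using ne by blast
    qed
  qed
  also have "\<dots> = 0"
  proof (rule sum.neutral, rule ballI)
    fix R assume "R \<in> S ` \<T>"
    then obtain K where K: "K \<in> \<T>" and R: "R = S K" by blast
    show "\<nu> R = 0"
    proof (cases "interior R = {}")
      case True
      then show ?thesis using \<nu> Spo[OF K] R by (auto simp: simple_valuation_def)
    next
      case False
      obtain C where C: "finite C" "card C \<le> DIM('a)" "K = convex hull C" using simplex[OF K] by blast
      have RC: "R = convex hull (insert 0 C)"
        unfolding R S_def C(3) by (metis hull_insert)
      have "interior (convex hull (insert 0 C)) \<noteq> {}" using False unfolding RC .
      then obtain f :: "'a \<Rightarrow> 'a" where f: "linear f" "inj f"
        "f ` (convex hull (insert 0 Basis)) = convex hull (insert 0 C)"
        by (rule simplex_cone_is_linear_image[OF C(1,2)])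
      show ?thesis using simplices[OF f(1,2)] unfolding f(3) RC .
    qed
  qed
  finally show ?thesis .
qed

section \<open>Finite measures on the sphere and homogeneous test functions\<close>

lemma sphere_measuresD:
  fixes M :: "'a::euclidean_space measure"
  assumes "M \<in> sphere_measures"
  shows "finite_measure M" "sets M = sets sphere_borel" "space M = sphere 0 1"
  using assms sets_eq_imp_space_eq[of M sphere_borel] by (auto simp: sphere_measures_def space_sphere_borel)

lemma sphere_measures_measurable:
  fixes F :: "'a::euclidean_space \<Rightarrow> real"
  assumes M: "M \<in> sphere_measures" and F: "continuous_on (- {0}) F"
  shows "F \<in> borel_measurable M"
  using measurable_sphere_borel[OF F] measurable_cong_sets[OF sphere_measuresD(2)[OF M] refl] by blast

lemma sphere_measures_integrable:
  fixes F :: "'a::euclidean_space \<Rightarrow> real"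
  assumes M: "M \<in> sphere_measures" and F: "continuous_on (- {0}) F"
  shows "integrable M F"
proof -
  interpret finite_measure M by (rule sphere_measuresD[OF M])
  have "continuous_on (sphere 0 1) F" by (rule continuous_on_subset[OF F]) auto
  then have "bounded (F ` sphere 0 1)" by (intro compact_imp_bounded compact_continuous_image) auto
  then obtain B where "\<forall>x\<in>sphere 0 1. norm (F x) \<le> B" unfolding bounded_iff by blast
  then show ?thesis
    using sphere_measures_measurable[OF M F] sphere_measuresD(3)[OF M]
    by (intro integrable_const_bound[of _ B] AE_I2) auto
qed

lemma sphere_measures_AE_zero:
  fixes F :: "'a::euclidean_space \<Rightarrow> real"
  assumes M: "M \<in> sphere_measures" and F: "continuous_on (- {0}) F" and nn: "\<And>x. x \<noteq> 0 \<Longrightarrow> 0 \<le> F x"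
    and z: "(\<integral>x. F x \<partial>M) \<le> 0"
  shows "AE x in M. F x = 0"
proof -
  have nnAE: "AE x in M. 0 \<le> F x"
    using sphere_measuresD(3)[OF M] nn by (intro AE_I2) (metis mem_sphere_0 norm_zero zero_neq_one)
  have "(\<integral>x. F x \<partial>M) = 0" using z integral_nonneg_AE[OF nnAE] by simp
  then show ?thesis using integral_nonneg_eq_0_iff_AE[OF sphere_measures_integrable[OF M F] nnAE] by simp
qed

text \<open>The valuation property is an identity of measures, while contravariance is an identity of integrals;
this lemma passes from the first form to the second.\<close>

lemma sphere_measures_integral_add:
  fixes F :: "'a::euclidean_space \<Rightarrow> real"
  assumes M: "M \<in> sphere_measures" "M1 \<in> sphere_measures" "M2 \<in> sphere_measures"
    and add: "\<And>A. A \<in> sets sphere_borel \<Longrightarrow> measure M A = measure M1 A + measure M2 A"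
    and F: "continuous_on (- {0}) F" and nn: "\<And>x. x \<noteq> 0 \<Longrightarrow> 0 \<le> F x"
  shows "(\<integral>x. F x \<partial>M) = (\<integral>x. F x \<partial>M1) + (\<integral>x. F x \<partial>M2)"
proof -
  note S = sphere_measuresD(2)[OF M(1)] sphere_measuresD(2)[OF M(2)] sphere_measuresD(2)[OF M(3)]
  note sp = sphere_measuresD(3)[OF M(1)] sphere_measuresD(3)[OF M(2)] sphere_measuresD(3)[OF M(3)]
  have e: "emeasure M A = emeasure M1 A + emeasure M2 A" if "A \<in> sets sphere_borel" for A
    using add[OF that] M by (simp add: finite_measure.emeasure_eq_measure sphere_measuresD ennreal_plus)
  have tr: "u \<in> borel_measurable M" "u \<in> borel_measurable M1" "u \<in> borel_measurable M2"
    if "u \<in> borel_measurable sphere_borel" for u :: "'a \<Rightarrow> ennreal"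
    by (unfold measurable_cong_sets[OF S(1) refl] measurable_cong_sets[OF S(2) refl]
      measurable_cong_sets[OF S(3) refl]) (rule that)+
  have nni: "(\<integral>\<^sup>+x. u x \<partial>M) = (\<integral>\<^sup>+x. u x \<partial>M1) + (\<integral>\<^sup>+x. u x \<partial>M2)"
    if "u \<in> borel_measurable (sphere_borel :: 'a measure)" for u
    using that
  proof (induction rule: borel_measurable_induct)
    case (cong f g)
    have "integral\<^sup>N N f = integral\<^sup>N N g" if "space N = sphere 0 1" for N
      using cong(3) that by (intro nn_integral_cong) (auto simp: space_sphere_borel)
    then show ?case using cong(4) sp by simp
  next
    case (set A)
    then show ?case using e S by simp
  next
    case (mult u c)
    show ?case using mult.IH tr[OF mult.hyps(2)] by (simp add: nn_integral_cmult distrib_left)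
  next
    case (add u v)
    show ?case using add.IH tr[OF add.hyps(1)] tr[OF add.hyps(3)] by (simp add: nn_integral_add ac_simps)
  next
    case (seq U)
    note m = tr[OF seq.hyps(1)]
    have mono: "incseq (\<lambda>i. integral\<^sup>N N (U i))" for N
      using seq.hyps(3) by (auto simp: incseq_def le_fun_def intro!: nn_integral_mono)
    have sup: "(\<integral>\<^sup>+x. (SUP i. U i) x \<partial>N) = (SUP i. integral\<^sup>N N (U i))"
      if "\<And>i. U i \<in> borel_measurable N" for N
      unfolding SUP_apply by (rule nn_integral_monotone_convergence_SUP[OF seq.hyps(3) that])
    have "(SUP i. integral\<^sup>N M (U i)) = (SUP i. integral\<^sup>N M1 (U i)) + (SUP i. integral\<^sup>N M2 (U i))"
      unfolding seq.IH by (rule ennreal_SUP_add[OF mono mono])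
    then show ?case using sup[of M] sup[of M1] sup[of M2] m by simp
  qed
  have ae: "AE x in N. 0 \<le> F x" if "space N = sphere 0 1" for N
    using nn that by (intro AE_I2) (metis mem_sphere_0 norm_zero zero_neq_one)
  have i: "(\<integral>\<^sup>+x. ennreal (F x) \<partial>N) = ennreal (\<integral>x. F x \<partial>N)" if "N \<in> sphere_measures" for N
    using sphere_measures_integrable[OF that F] ae[OF sphere_measuresD(3)[OF that]] by (rule nn_integral_eq_integral)
  have "ennreal (\<integral>x. F x \<partial>M) = ennreal (\<integral>x. F x \<partial>M1) + ennreal (\<integral>x. F x \<partial>M2)"
    using nni[of "\<lambda>x. ennreal (F x)"] measurable_sphere_borel[OF F] i[OF M(1)] i[OF M(2)] i[OF M(3)] by simp
  then show ?thesis
    using integral_nonneg_AE[OF ae[OF sp(1)]] integral_nonneg_AE[OF ae[OF sp(2)]] integral_nonneg_AE[OF ae[OF sp(3)]]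
    by (simp add: ennreal_plus[symmetric] del: ennreal_plus)
qed

text \<open>Every continuous function on the sphere has a \<open>p\<close>-homogeneous extension. The functions \<open>G k\<close> decrease on
the sphere to the indicator of a closed set, and closed sets generate the Borel sets.\<close>

lemma sphere_measures_eqI:
  fixes M N :: "'a::euclidean_space measure"
  assumes M: "M \<in> sphere_measures" and N: "N \<in> sphere_measures"
    and eq: "\<And>F. continuous_on (- {0}) F \<Longrightarrow> homogeneous p F \<Longrightarrow> (\<integral>x. F x \<partial>M) = (\<integral>x. F x \<partial>N)"
  shows "M = N"
proof -
  have closed_eq: "measure M (C \<inter> sphere 0 1) = measure N (C \<inter> sphere 0 1)" if C: "closed C" "C \<noteq> {}" for C
  proof -
    define G where "G k x = norm x powr p * max 0 (1 - real k * infdist (sgn x) C)" for k :: nat and x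
    have cont: "continuous_on (- {0}) (G k)" for k
      unfolding G_def by (intro continuous_intros) auto
    have hom: "homogeneous p (G k)" for k
      by (auto simp: homogeneous_def G_def powr_mult sgn_scaleR)
    have lim: "(\<lambda>k. \<integral>x. G k x \<partial>L) \<longlonglongrightarrow> measure L (C \<inter> sphere 0 1)" if L: "L \<in> sphere_measures" for L
    proof -
      interpret finite_measure L by (rule sphere_measuresD[OF L])
      have CS: "C \<inter> sphere 0 1 \<in> sets L"
        unfolding sphere_measuresD(2)[OF L] sphere_borel_def sets_restrict_space Int_commute[of C]
        by (intro imageI borel_closed C)
      have "(\<lambda>k. \<integral>x. G k x \<partial>L) \<longlonglongrightarrow> (\<integral>x. indicator (C \<inter> sphere 0 1) x \<partial>L)"
      proof (rule integral_dominated_convergence[where w="\<lambda>_. 1"])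
        show "AE x in L. (\<lambda>k. G k x) \<longlonglongrightarrow> indicator (C \<inter> sphere 0 1) x"
        proof (rule AE_I2)
          fix x assume "x \<in> space L"
          then have x: "norm x = 1" and sgn: "sgn x = x" using sphere_measuresD(3)[OF L] by (simp_all add: sgn_div_norm)
          show "(\<lambda>k. G k x) \<longlonglongrightarrow> indicator (C \<inter> sphere 0 1) x"
          proof (cases "x \<in> C")
            case True
            then show ?thesis using x sgn by (simp add: G_def)
          next
            case False
            then have d: "0 < infdist x C" using C by (metis in_closed_iff_infdist_zero infdist_nonneg less_le)
            obtain K where K: "1 < real K * infdist x C" using reals_Archimedean3[OF d] by blast
            have "G k x = 0" if "k \<ge> K" for k
            proof -
              have "real K * infdist x C \<le> real k * infdist x C" using that d by (intro mult_right_mono) auto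
              then show ?thesis using K x sgn by (simp add: G_def)
            qed
            then have "eventually (\<lambda>k. G k x = 0) sequentially" using eventually_sequentially by blast
            then show ?thesis using False by (auto intro: tendsto_eventually)
          qed
        qed
        show "AE x in L. norm (G k x) \<le> 1" for k
          using sphere_measuresD(3)[OF L] by (intro AE_I2) (auto simp: G_def infdist_nonneg)
      qed (use CS sphere_measures_measurable[OF L cont] in auto)
      then show ?thesis using CS sphere_measuresD(3)[OF L] by (simp add: Int_absorb2 sets.sets_into_space)
    qed
    show ?thesis
      using lim[OF M] lim[OF N] eq[OF cont hom] LIMSEQ_unique by simp
  qed
  have idm: "(\<lambda>x. x) \<in> measurable L borel" if "L \<in> sphere_measures" for L :: "'a measure"
    by (unfold measurable_cong_sets[OF sphere_measuresD(2)[OF that] refl] sphere_borel_def)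
      (intro measurable_restrict_space1 measurable_ident_sets refl)
  have d: "distr M borel (\<lambda>x. x) = distr N borel (\<lambda>x. x)"
  proof (rule measure_eqI_generator_eq[where E="Collect closed" and A="\<lambda>_. UNIV" and \<Omega>=UNIV])
    show "Int_stable (Collect closed :: 'a set set)" by (auto simp: Int_stable_def)
    show "sets (distr M borel (\<lambda>x. x)) = sigma_sets UNIV (Collect closed)"
      "sets (distr N borel (\<lambda>x. x)) = sigma_sets UNIV (Collect closed)"
      by (simp_all add: borel_eq_closed)
    interpret M: finite_measure M by (rule sphere_measuresD[OF M])
    interpret N: finite_measure N by (rule sphere_measuresD[OF N])
    show "emeasure (distr M borel (\<lambda>x. x)) UNIV \<noteq> \<infinity>"
      using idm[OF M] by (simp add: emeasure_distr)
    fix C :: "'a set" assume "C \<in> Collect closed"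
    then have C: "closed C" by simp
    have "measure M (C \<inter> sphere 0 1) = measure N (C \<inter> sphere 0 1)"
      using closed_eq[OF C] by (cases "C = {}") auto
    then show "emeasure (distr M borel (\<lambda>x. x)) C = emeasure (distr N borel (\<lambda>x. x)) C"
      using C idm[OF M] idm[OF N] sphere_measuresD(3)[OF M] sphere_measuresD(3)[OF N]
      by (simp add: emeasure_distr M.emeasure_eq_measure N.emeasure_eq_measure)
  qed auto
  show "M = N"
  proof (rule measure_eqI)
    show "sets M = sets N" by (simp only: sphere_measuresD(2)[OF M] sphere_measuresD(2)[OF N])
    fix A assume A: "A \<in> sets M"
    then have "A \<in> sets sphere_borel" using sphere_measuresD(2)[OF M] by simp
    then have bA: "A \<in> sets borel"
      by (auto simp: sphere_borel_def sets_restrict_space intro!: sets.Int[OF borel_closed])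
    have sub: "A \<subseteq> sphere 0 1" using sets.sets_into_space[OF A] sphere_measuresD(3)[OF M] by simp
    have "emeasure L A = emeasure (distr L borel (\<lambda>x. x)) A" if "L \<in> sphere_measures" for L
      using bA idm[OF that] sub sphere_measuresD(3)[OF that] by (simp add: emeasure_distr Int_absorb2)
    then show "emeasure M A = emeasure N A" using M N d by simp
  qed
qed

section \<open>Contravariant maps vanish on polytopes without interior\<close>

text \<open>Contravariance with the inverse transpose described by adjointness, which avoids computing inverse matrices.\<close>

lemma contravariant_adjoint:
  fixes f g :: "real^'n \<Rightarrow> real^'n"
  assumes \<mu>: "contravariant GL p \<mu>" and f: "linear f" and fg: "\<And>x y. f x \<bullet> g y = x \<bullet> y"
    and P: "P \<in> polytopes_o" and F: "continuous_on (- {0}) F" "homogeneous p F"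
  shows "(\<integral>x. F x \<partial>\<mu> (f ` P)) = \<bar>det (matrix f)\<bar> * (\<integral>x. F (g x) \<partial>\<mu> P)"
proof -
  have "inj f"
  proof (rule injI)
    fix x y assume "f x = f y"
    then have "(x - y) \<bullet> (x - y) = 0" by (metis fg inner_diff_left right_minus_eq)
    then show "x = y" by simp
  qed
  then have surj: "surj f" using f linear_injective_imp_surjective by blast
  have "invertible (matrix f)"
    using det_nz_iff_inj[OF f] \<open>inj f\<close> invertible_det_nz by blast
  then have GL: "matrix f \<in> GL" by (simp add: GL_def)
  have fm: "matrix f *v x = f x" for x using matrix_works[of f x] f by (simp add: linear_matrix_vector_mul_eq)
  have "transpose (matrix_inv (matrix f)) *v y = g y" for y
  proof (rule vector_eq_rdot[THEN iffD1], rule allI)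
    fix z
    obtain x where "z = f x" using surj by blast
    then show "(transpose (matrix_inv (matrix f)) *v y) \<bullet> z = g y \<bullet> z"
      using GL_adjoint(1)[OF GL, of x y] fg[of x y] unfolding fm by (metis inner_commute)
  qed
  moreover have "(\<lambda>x. matrix f *v x) ` P = f ` P" by (simp add: fm)
  ultimately show ?thesis
    using \<mu>[unfolded contravariant_def, rule_format, OF GL P F] by simp
qed

lemma two_powr_eq_1_iff: "(2::real) powr q = 1 \<longleftrightarrow> q = 0"
  by (metis powr_inj powr_zero_eq_one zero_neq_numeral one_eq_numeral_iff semiring_norm(83) zero_less_numeral)

text \<open>The map \<open>f s\<close> fixes the hyperplane orthogonal to \<open>u\<close> pointwise and has determinant \<open>s\<close>; \<open>g s\<close> is the
inverse of its adjoint. The projection \<open>\<pi>\<close> along \<open>u\<close> is invariant under \<open>g s\<close>, and the norm of \<open>g s y\<close> stays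
bounded for \<open>s \<ge> 1\<close>. The test function \<open>G\<close> is built so that it decreases at most by a
constant factor while the determinant grows with \<open>s\<close>; hence its integral is zero and the measure
lives on the line of \<open>u\<close>. There \<open>g 2\<close> is multiplication by \<open>1 / 2\<close>, and comparing the total mass
gives a factor \<open>2 powr (1 - p)\<close>, which is not \<open>1\<close>.\<close>

lemma contravariant_null_of_empty_interior:
  fixes \<mu> :: "(real^'n) set \<Rightarrow> (real^'n) measure"
  assumes p: "p \<noteq> 1" and contra: "contravariant GL p \<mu>" and \<mu>: "\<mu> \<in> polytopes_o \<rightarrow> sphere_measures"
    and P: "P \<in> polytopes_o" and int: "interior P = {}"
  shows "measure (\<mu> P) A = 0"
proof -
  obtain u b where u: "u \<noteq> 0" "P \<subseteq> {x. u \<bullet> x = b}"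
    using empty_interior_subset_hyperplane[OF polytopes_oD(3)[OF P] int] by blast
  then have Pu: "u \<bullet> x = 0" if "x \<in> P" for x
    using subsetD[OF u(2) that] subsetD[OF u(2) polytopes_oD(4)[OF P]] by simp
  obtain k where k: "u $ k \<noteq> 0" using u(1) by (auto simp: vec_eq_iff)
  define M where "M = \<mu> P"
  have M: "M \<in> sphere_measures" using \<mu> P by (auto simp: M_def)
  note fin = sphere_measuresD(1)[OF M] and space = sphere_measuresD(3)[OF M]
  define f where "f s x = x + (((s - 1) / u $ k) *\<^sub>R u \<bullet> x) *\<^sub>R axis k 1" for s :: real and x :: "real^'n"
  define g where "g s y = y - ((1 - 1 / s) * (y $ k / u $ k)) *\<^sub>R u" for s :: real and y :: "real^'n"
  have lin: "linear (f s)" for s by (rule linearI) (simp_all add: f_def inner_add_right algebra_simps)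
  have fP: "f s ` P = P" for s using Pu by (simp add: f_def)
  have det: "det (matrix (f s)) = s" for s unfolding f_def det_matrix_add_row using k by simp
  have adj: "f s x \<bullet> g s y = x \<bullet> y" if "s > 0" for s x y
  proof -
    define c d where "c = (s - 1) / u $ k" and "d = (1 - 1 / s) / u $ k"
    have fc: "f s x = x + (c * (u \<bullet> x)) *\<^sub>R axis k 1" and gd: "g s y = y - (d * y $ k) *\<^sub>R u"
      by (simp_all add: f_def g_def c_def d_def)
    have "f s x \<bullet> g s y = x \<bullet> y + (u \<bullet> x) * (y $ k) * (c - d - c * d * u $ k)"
      unfolding fc gd by (simp add: inner_add_left inner_diff_right inner_axis' inner_commute[of x u] algebra_simps)
    also have "c - d - c * d * u $ k = 0"
      using that k by (simp add: c_def d_def field_simps)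
    finally show ?thesis by simp
  qed
  have g0: "y = 0" if "g s y = 0" "s > 0" for s y
    using adj[OF that(2), of y y] that(1) by simp
  have key: "(\<integral>x. F x \<partial>M) = s * (\<integral>x. F (g s x) \<partial>M)"
    if "s > 0" "continuous_on (- {0}) F" "homogeneous p F" for s F
    using contravariant_adjoint[OF contra lin adj[OF that(1)] P that(2,3)] that(1) by (simp add: M_def fP det)
  define \<pi> where "\<pi> y = y - (y $ k / u $ k) *\<^sub>R u" for y :: "real^'n"
  \<comment> \<open>\<open>q > 0\<close> makes \<open>G\<close> continuous, \<open>q > p\<close> makes its second factor antitone in the norm\<close>
  define q where "q = max p 0 + 1"
  define G where "G y = norm (\<pi> y) powr q * norm y powr (p - q)" for y
  have q: "q > 0" "q > p" by (auto simp: q_def)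
  have \<pi>g: "\<pi> (g s y) = \<pi> y" for s y using k by (simp add: \<pi>_def g_def vec_eq_iff field_simps)
  have \<pi>s: "\<pi> (t *\<^sub>R y) = t *\<^sub>R \<pi> y" for t y by (simp add: \<pi>_def vec_eq_iff algebra_simps)
  have contG: "continuous_on (- {0}) G"
    unfolding G_def \<pi>_def using q k by (intro continuous_intros continuous_on_powr') auto
  have homG: "homogeneous p G"
  proof (unfold homogeneous_def, intro allI impI)
    fix x :: "real^'n" and t :: real assume "x \<noteq> 0" "t > 0"
    then have "G (t *\<^sub>R x) = (t powr q * t powr (p - q)) * G x"
      by (simp add: G_def \<pi>s powr_mult)
    also have "t powr q * t powr (p - q) = t powr p" by (simp add: powr_add[symmetric])
    finally show "G (t *\<^sub>R x) = t powr p * G x" .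
  qed
  define C where "C = 1 + norm u / \<bar>u $ k\<bar>"
  have C: "C \<ge> 1" by (simp add: C_def)
  have gC: "norm (g s y) \<le> C * norm y" if "s \<ge> 1" for s y
  proof -
    have "norm (g s y) \<le> norm y + \<bar>1 - 1 / s\<bar> * (\<bar>y $ k\<bar> / \<bar>u $ k\<bar> * norm u)"
      unfolding g_def by (rule order_trans[OF norm_triangle_ineq4]) (simp add: abs_mult)
    also have "\<dots> \<le> norm y + 1 * (norm y / \<bar>u $ k\<bar> * norm u)"
      using that component_le_norm_cart[of y k]
      by (intro add_left_mono mult_mono divide_right_mono mult_right_mono) (auto simp: abs_if field_simps)
    also have "\<dots> = C * norm y" by (simp add: C_def algebra_simps)
    finally show ?thesis .
  qed
  \<comment> \<open>this choice makes \<open>s * C powr (p - q)\<close> larger than \<open>1\<close>\<close>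
  define s where "s = 1 + C powr (q - p)"
  have s: "s \<ge> 1" "s > 0" using C by (auto simp: s_def add_pos_nonneg)
  have Gs: "C powr (p - q) * G y \<le> G (g s y)" if "y \<noteq> 0" for y
  proof -
    have "(C * norm y) powr (p - q) \<le> norm (g s y) powr (p - q)"
      using gC[OF s(1), of y] g0[OF _ s(2), of y] that q by (intro powr_mono2') auto
    then have "norm (\<pi> y) powr q * (C powr (p - q) * norm y powr (p - q)) \<le> norm (\<pi> y) powr q * norm (g s y) powr (p - q)"
      using C by (intro mult_left_mono) (simp_all add: powr_mult)
    then show ?thesis by (simp add: G_def \<pi>g mult_ac)
  qed
  have ling: "linear (g s)" for s by (rule linearI) (simp_all add: g_def vec_eq_iff algebra_simps add_divide_distrib)
  have contg: "continuous_on (- {0}) (\<lambda>x. F (g s x))" if "continuous_on (- {0}) F" "s > 0" for F :: "real^'n \<Rightarrow> real" and s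
    by (rule continuous_on_punctured_linear[OF that(1) ling g0[OF _ that(2)]])
  have intG: "(\<integral>x. G x \<partial>M) \<le> 0"
  proof -
    have "C powr (p - q) * (\<integral>x. G x \<partial>M) \<le> (\<integral>x. G (g s x) \<partial>M)"
      unfolding integral_mult_right_zero[symmetric]
    proof (rule integral_mono_AE)
      show "integrable M (\<lambda>x. C powr (p - q) * G x)" "integrable M (\<lambda>x. G (g s x))"
        by (intro integrable_mult_right sphere_measures_integrable[OF M] contG contg[OF contG s(2)])+
      show "AE x in M. C powr (p - q) * G x \<le> G (g s x)"
      proof (rule AE_I2)
        fix x assume "x \<in> space M"
        then have "x \<noteq> 0" unfolding space by auto
        then show "C powr (p - q) * G x \<le> G (g s x)" by (rule Gs)
      qed
    qed
    then have "s * (C powr (p - q) * (\<integral>x. G x \<partial>M)) \<le> (\<integral>x. G x \<partial>M)"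
      using key[OF s(2) contG homG] s by (simp add: mult_left_mono)
    then have "(s * C powr (p - q)) * (\<integral>x. G x \<partial>M) \<le> (\<integral>x. G x \<partial>M)" by (simp only: mult.assoc)
    moreover have "s * C powr (p - q) = C powr (p - q) + 1"
      using C by (simp add: s_def distrib_right powr_add[symmetric])
    ultimately have "C powr (p - q) * (\<integral>x. G x \<partial>M) \<le> 0" by (simp add: distrib_right)
    moreover have "0 < C powr (p - q)" using C by simp
    ultimately show ?thesis by (simp add: mult_le_0_iff)
  qed
  have "AE x in M. G x = 0"
    by (rule sphere_measures_AE_zero[OF M contG _ intG]) (simp add: G_def)
  then have ae: "AE x in M. g 2 x = (1 / 2) *\<^sub>R x"
  proof (rule AE_mp, intro AE_I2 impI)
    fix x assume "x \<in> space M" "G x = 0"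
    then have "\<pi> x = 0" using space by (auto simp: G_def)
    then have e: "x = (x $ k / u $ k) *\<^sub>R u" by (simp add: \<pi>_def)
    have "g 2 x = x - (1 / 2) *\<^sub>R ((x $ k / u $ k) *\<^sub>R u)" by (simp add: g_def)
    also have "\<dots> = x - (1 / 2) *\<^sub>R x" using e by simp
    also have "\<dots> = (1 / 2) *\<^sub>R x" by (simp add: vec_eq_iff)
    finally show "g 2 x = (1 / 2) *\<^sub>R x" .
  qed
  define N where "N y = norm y powr p" for y :: "real^'n"
  have contN: "continuous_on (- {0}) N" unfolding N_def by (intro continuous_intros) auto
  have homN: "homogeneous p N" by (auto simp: homogeneous_def N_def powr_mult)
  have N_half: "N ((1 / 2) *\<^sub>R x) = (1 / 2) powr p * N x" for x
    unfolding N_def norm_scaleR by (subst powr_mult) simp_all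
  have "(\<integral>x. N x \<partial>M) = 2 * (\<integral>x. N (g 2 x) \<partial>M)" by (rule key[OF _ contN homN]) simp
  also have "(\<integral>x. N (g 2 x) \<partial>M) = (\<integral>x. (1 / 2) powr p * N x \<partial>M)"
  proof (rule integral_cong_AE)
    show "AE x in M. N (g 2 x) = (1 / 2) powr p * N x"
      using ae by eventually_elim (simp only: N_half)
    show "(\<lambda>x. N (g 2 x)) \<in> borel_measurable M" "(\<lambda>x. (1 / 2) powr p * N x) \<in> borel_measurable M"
      by (rule sphere_measures_measurable[OF M contg[OF contN]], simp)
        (intro borel_measurable_times borel_measurable_const sphere_measures_measurable[OF M contN])
  qed
  also have "\<dots> = (1 / 2) powr p * (\<integral>x. N x \<partial>M)" by simp
  finally have eq: "(\<integral>x. N x \<partial>M) = (2 * (1 / 2) powr p) * (\<integral>x. N x \<partial>M)" by (simp only: mult.assoc)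
  have "2 * (1 / 2) powr p = 2 powr (1 - p)" by (simp add: powr_diff powr_divide)
  moreover have "2 powr (1 - p) \<noteq> 1" using p unfolding two_powr_eq_1_iff by simp
  ultimately have "2 * (1 / 2) powr p \<noteq> 1" by (simp only: not_False_eq_True)
  then have "(\<integral>x. N x \<partial>M) = 0" using iffD1[OF mult_cancel_right1 eq] by blast
  moreover have "(\<integral>x. N x \<partial>M) = (\<integral>x. 1 \<partial>M)"
    using space by (intro Bochner_Integration.integral_cong) (auto simp: N_def)
  ultimately have z: "measure M (space M) = 0" by simp
  interpret finite_measure M by (rule fin)
  have "measure M A \<le> measure M (space M)" by (rule bounded_measure)
  then show ?thesis using z measure_nonneg[of M A] unfolding M_def by (intro antisym) simp_all
qed

section \<open>The measure of the standard simplex\<close>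

lemma sum_Basis_cart: "(\<Sum>b\<in>(Basis :: (real^'n) set). g b) = (\<Sum>i\<in>UNIV. g (axis i 1))"
proof -
  have B: "(Basis :: (real^'n) set) = range (\<lambda>i. axis i 1)" by (auto simp: Basis_vec_def)
  have inj: "inj (\<lambda>i::'n. axis i 1 :: real^'n)" by (auto simp: inj_on_def axis_eq_axis)
  show ?thesis unfolding B sum.reindex[OF inj] o_def ..
qed

lemma std_simplex_cart:
  "convex hull (insert 0 Basis) = {x :: real^'n. (\<forall>i. 0 \<le> x $ i) \<and> (\<Sum>i\<in>UNIV. x $ i) \<le> 1}"
  unfolding std_simplex sum_Basis_cart by (auto simp: Basis_vec_def inner_axis)

lemma std_simplex_polytopes_o: "convex hull (insert 0 Basis) \<in> (polytopes_o :: 'a::euclidean_space set set)"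
  using hull_inc[of 0 "insert 0 (Basis :: 'a set)" convex]
  by (auto simp: polytopes_o_def polytope_def intro!: exI[of _ "insert 0 Basis"])

text \<open>The linear map that replaces the basis vector \<open>e\<^sub>i\<close> by the midpoint of \<open>e\<^sub>i\<close> and \<open>e\<^sub>j\<close>.\<close>

definition half_map :: "'n \<Rightarrow> 'n \<Rightarrow> real^'n \<Rightarrow> real^'n" where
  "half_map i j x = x + (x $ i) *\<^sub>R ((1 / 2) *\<^sub>R (axis j 1 - axis i 1))"

text \<open>The inverse of the adjoint of \<open>half_map i j\<close>: it replaces \<open>y\<^sub>i\<close> by \<open>2 * y\<^sub>i - y\<^sub>j\<close>.\<close>

definition half_map_dual :: "'n \<Rightarrow> 'n \<Rightarrow> real^'n \<Rightarrow> real^'n" where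
  "half_map_dual i j y = y + (y $ i - y $ j) *\<^sub>R axis i 1"

lemma half_map_nth: "i \<noteq> j \<Longrightarrow> half_map i j x $ k = (if k = i then x $ i / 2 else if k = j then x $ j + x $ i / 2 else x $ k)"
  by (auto simp: half_map_def axis_def)

lemma half_map_dual_nth: "half_map_dual i j y $ k = (if k = i then 2 * y $ i - y $ j else y $ k)"
  by (auto simp: half_map_dual_def axis_def)

lemma linear_half_map: "linear (half_map i j)"
  by (rule linearI) (auto simp: half_map_def vec_eq_iff algebra_simps)

lemma linear_half_map_dual: "linear (half_map_dual i j)"
  by (rule linearI) (auto simp: half_map_dual_def vec_eq_iff algebra_simps)

lemma det_half_map: "i \<noteq> j \<Longrightarrow> det (matrix (half_map i j)) = 1 / 2"
  unfolding half_map_def det_matrix_add_column by (simp add: axis_def)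

lemma half_map_adjoint:
  assumes "i \<noteq> j" shows "half_map i j x \<bullet> half_map_dual i j y = x \<bullet> y"
proof -
  have "axis i 1 $ j = (0::real)" "axis j 1 $ i = (0::real)" "axis i 1 $ i = (1::real)"
    using assms by (simp_all add: axis_def)
  then show ?thesis
    unfolding half_map_def half_map_dual_def
    by (simp add: inner_add_left inner_add_right inner_axis inner_axis' inner_diff_left inner_diff_right
        del: inner_axis_axis)
       (simp add: algebra_simps add_divide_distrib diff_divide_distrib)
qed

lemma sum_remove2:
  fixes g :: "'n::finite \<Rightarrow> real"
  assumes "i \<noteq> j"
  shows "(\<Sum>k\<in>UNIV. g k) = g i + g j + (\<Sum>k\<in>UNIV - {i, j}. g k)"
proof -
  have "(\<Sum>k\<in>UNIV. g k) = (\<Sum>k\<in>{i, j}. g k) + (\<Sum>k\<in>UNIV - {i, j}. g k)"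
    by (rule sum.subset_diff[THEN trans]) (auto simp: add.commute)
  then show ?thesis using assms by simp
qed

lemma half_map_std_simplex:
  fixes i j :: "'n::finite"
  assumes ij: "i \<noteq> j"
  shows "half_map i j ` (convex hull (insert 0 Basis)) =
    convex hull (insert 0 Basis) \<inter> {x. (axis i 1 - axis j 1) \<bullet> x \<le> 0}"
proof (intro equalityI subsetI)
  fix y :: "real^'n" assume "y \<in> half_map i j ` (convex hull (insert 0 Basis))"
  then obtain x where x: "\<And>k. 0 \<le> x $ k" "(\<Sum>k\<in>UNIV. x $ k) \<le> 1" and y: "y = half_map i j x"
    unfolding std_simplex_cart by blast
  have "(\<Sum>k\<in>UNIV. y $ k) = (\<Sum>k\<in>UNIV. x $ k)"
    unfolding sum_remove2[OF ij] by (auto simp: y half_map_nth[OF ij] ij ij[symmetric] intro!: sum.cong)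
  moreover have "0 \<le> y $ k" for k using x(1)[of i] x(1)[of j] x(1)[of k] by (simp add: y half_map_nth[OF ij])
  ultimately show "y \<in> convex hull (insert 0 Basis) \<inter> {x. (axis i 1 - axis j 1) \<bullet> x \<le> 0}"
    using x(1)[of j] x(2) ij
    by (simp add: std_simplex_cart inner_diff_left inner_axis') (simp add: y half_map_nth)
next
  fix y :: "real^'n" assume y: "y \<in> convex hull (insert 0 Basis) \<inter> {x. (axis i 1 - axis j 1) \<bullet> x \<le> 0}"
  then have y0: "\<And>k. 0 \<le> y $ k" and y1: "(\<Sum>k\<in>UNIV. y $ k) \<le> 1" and le: "y $ i \<le> y $ j"
    by (auto simp: std_simplex_cart inner_diff_left inner_axis')
  define x where "x = (\<chi> k. if k = i then 2 * y $ i else if k = j then y $ j - y $ i else y $ k)"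
  have "half_map i j x = y" using ij by (simp add: vec_eq_iff half_map_nth x_def)
  moreover have "x \<in> convex hull (insert 0 Basis)"
  proof -
    have "(\<Sum>k\<in>UNIV. x $ k) = (\<Sum>k\<in>UNIV. y $ k)"
      unfolding sum_remove2[OF ij] using ij by (auto simp: x_def intro!: sum.cong)
    then show ?thesis using y0 y1 le by (auto simp: std_simplex_cart x_def)
  qed
  ultimately show "y \<in> half_map i j ` (convex hull (insert 0 Basis))" by blast
qed

locale contravariant_valuation =
  fixes p :: real and \<mu> :: "(real^'n) set \<Rightarrow> (real^'n) measure"
  assumes p: "p \<noteq> 1" and \<mu>: "\<mu> \<in> polytopes_o \<rightarrow> sphere_measures"
    and val: "valuation \<mu>" and contra: "contravariant GL p \<mu>"
begin

abbreviation \<tau> :: "(real^'n) measure" where "\<tau> \<equiv> \<mu> (convex hull (insert 0 Basis))"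

lemma simplex_measure_in_sphere_measures: "\<tau> \<in> sphere_measures"
  using \<mu> std_simplex_polytopes_o by blast

text \<open>The functional equation for the measure of the standard simplex: the hyperplane \<open>x\<^sub>i = x\<^sub>j\<close> cuts the simplex
into two linear images of determinant \<open>1 / 2\<close>, and the common part of the two pieces contributes nothing.\<close>

lemma simplex_integral_halving:
  fixes F :: "real^'n \<Rightarrow> real"
  assumes ij: "i \<noteq> j" and F: "continuous_on (- {0}) F" "homogeneous p F" and nn: "\<And>x. x \<noteq> 0 \<Longrightarrow> 0 \<le> F x"
  shows "(\<integral>x. F x \<partial>\<tau>) = 1 / 2 * (\<integral>x. F (half_map_dual i j x) \<partial>\<tau>) + 1 / 2 * (\<integral>x. F (half_map_dual j i x) \<partial>\<tau>)"
proof -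
  let ?T = "convex hull (insert 0 Basis) :: (real^'n) set"
  let ?a = "axis i 1 - axis j 1 :: real^'n"
  let ?A = "half_map i j ` ?T" and ?B = "half_map j i ` ?T"
  have T: "?T \<in> polytopes_o" by (rule std_simplex_polytopes_o)
  have A: "?A \<in> polytopes_o" and B: "?B \<in> polytopes_o" by (intro polytopes_o_linear_image linear_half_map T)+
  have Aeq: "?A = ?T \<inter> {x. ?a \<bullet> x \<le> 0}" by (rule half_map_std_simplex[OF ij])
  have Beq: "?B = ?T \<inter> {x. 0 \<le> ?a \<bullet> x}" using half_map_std_simplex[of j i] ij by (simp add: inner_diff_left)
  have U: "?A \<union> ?B = ?T" unfolding Aeq Beq by auto
  have I: "?A \<inter> ?B = ?T \<inter> {x. ?a \<bullet> x = 0}" unfolding Aeq Beq by auto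
  have Ipo: "?A \<inter> ?B \<in> polytopes_o" unfolding I by (rule polytopes_o_Int_halfspaces(3)[OF T])
  have "?a \<noteq> 0" using ij by (auto simp: vec_eq_iff axis_def)
  then have "interior (?A \<inter> ?B) = {}"
    unfolding I by (intro interior_subset_hyperplane_empty[of _ ?a]) auto
  then have "measure (\<mu> (?A \<inter> ?B)) X = 0" for X
    by (rule contravariant_null_of_empty_interior[OF p contra \<mu> Ipo])
  then have "measure \<tau> X = measure (\<mu> ?A) X + measure (\<mu> ?B) X" if "X \<in> sets sphere_borel" for X
    using val[unfolded valuation_def, rule_format, OF A B _ Ipo that] T unfolding U by simp
  then have "(\<integral>x. F x \<partial>\<tau>) = (\<integral>x. F x \<partial>\<mu> ?A) + (\<integral>x. F x \<partial>\<mu> ?B)"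
    using \<mu> T A B by (intro sphere_measures_integral_add F(1) nn) auto
  then show ?thesis
    using contravariant_adjoint[OF contra linear_half_map half_map_adjoint T F, of i j]
      contravariant_adjoint[OF contra linear_half_map half_map_adjoint T F, of j i] ij
    by (simp add: det_half_map)
qed

lemma half_map_dual_eq_0: "i \<noteq> j \<Longrightarrow> half_map_dual i j x = 0 \<Longrightarrow> x = 0"
  using half_map_adjoint[of i j x x] by simp

lemma continuous_on_half_map_dual:
  fixes F :: "real^'n \<Rightarrow> real"
  assumes "continuous_on (- {0}) F" "i \<noteq> j"
  shows "continuous_on (- {0}) (\<lambda>x. F (half_map_dual i j x))"
  by (rule continuous_on_punctured_linear[OF assms(1) linear_half_map_dual half_map_dual_eq_0[OF assms(2)]])

text \<open>If a test function changes in the same direction, up or down according to the sign of \<open>\<sigma>\<close>, under both dual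
maps, then the functional equation leaves no room for a change on a set of positive measure.\<close>

lemma AE_invariant_of_monotone:
  fixes F :: "real^'n \<Rightarrow> real"
  assumes ij: "i \<noteq> j" and F: "continuous_on (- {0}) F" "homogeneous p F" and nn: "\<And>x. x \<noteq> 0 \<Longrightarrow> 0 \<le> F x"
    and le: "\<And>x. x \<noteq> 0 \<Longrightarrow> \<sigma> * F x \<le> \<sigma> * F (half_map_dual i j x)" "\<And>x. x \<noteq> 0 \<Longrightarrow> \<sigma> * F x \<le> \<sigma> * F (half_map_dual j i x)"
    and \<sigma>: "\<sigma> \<noteq> 0"
  shows "AE x in \<tau>. F (half_map_dual i j x) = F x"
proof -
  define D where "D x = \<sigma> * F (half_map_dual i j x) + \<sigma> * F (half_map_dual j i x) - 2 * (\<sigma> * F x)" for x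
  note int = sphere_measures_integrable[OF simplex_measure_in_sphere_measures]
  have c: "continuous_on (- {0}) (\<lambda>x. F (half_map_dual i j x))" "continuous_on (- {0}) (\<lambda>x. F (half_map_dual j i x))"
    using continuous_on_half_map_dual F(1) ij by auto
  have "(\<integral>x. D x \<partial>\<tau>) = \<sigma> * (\<integral>x. F (half_map_dual i j x) \<partial>\<tau>) + \<sigma> * (\<integral>x. F (half_map_dual j i x) \<partial>\<tau>) - 2 * (\<sigma> * (\<integral>x. F x \<partial>\<tau>))"
    unfolding D_def using int[OF c(1)] int[OF c(2)] int[OF F(1)] by simp
  also have "\<dots> = 0" unfolding simplex_integral_halving[OF ij F nn, simplified] by (simp add: algebra_simps)
  finally have z: "(\<integral>x. D x \<partial>\<tau>) \<le> 0" by simp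
  have "AE x in \<tau>. D x = 0"
  proof (rule sphere_measures_AE_zero[OF simplex_measure_in_sphere_measures _ _ z])
    show "continuous_on (- {0}) D" unfolding D_def by (intro continuous_intros c F)
    show "0 \<le> D x" if "x \<noteq> 0" for x using le[OF that] by (simp add: D_def)
  qed
  then show ?thesis
  proof (rule AE_mp, intro AE_I2 impI)
    fix x assume "x \<in> space \<tau>" "D x = 0"
    then have "x \<noteq> 0" using sphere_measuresD(3)[OF simplex_measure_in_sphere_measures] by auto
    then have "\<sigma> * F (half_map_dual i j x) = \<sigma> * F x" using le[of x] \<open>D x = 0\<close> unfolding D_def by linarith
    then show "F (half_map_dual i j x) = F x" using \<sigma> by simp
  qed
qed

text \<open>The difference \<open>x\<^sub>i - x\<^sub>j\<close> is doubled by both dual maps, up to sign, so the integral of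
\<open>\<bar>x\<^sub>i - x\<^sub>j\<bar> powr p\<close> equals \<open>2 powr p\<close> times itself.\<close>

lemma diagonal_pos_degree:
  assumes p0: "p > 0" and ij: "i \<noteq> j"
  shows "AE x in \<tau>. x $ i = x $ j"
proof -
  define F where "F x = \<bar>x $ i - x $ j\<bar> powr p" for x :: "real^'n"
  have F: "continuous_on (- {0}) F" unfolding F_def using p0
    by (intro continuous_on_powr' continuous_intros) auto
  have hom: "homogeneous p F"
    by (auto simp: homogeneous_def F_def powr_mult[symmetric] abs_mult right_diff_distrib[symmetric])
  have nn: "0 \<le> F x" for x by (simp add: F_def)
  have two: "\<bar>2 * d\<bar> powr p = 2 powr p * \<bar>d\<bar> powr p" for d :: real
    by (simp add: abs_mult powr_mult)
  have pull: "F (half_map_dual i j x) = 2 powr p * F x" "F (half_map_dual j i x) = 2 powr p * F x" for x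
    using ij two[of "x $ i - x $ j"] by (simp_all add: F_def half_map_dual_nth abs_minus_commute algebra_simps)
  have "(\<integral>x. F x \<partial>\<tau>) = 2 powr p * (\<integral>x. F x \<partial>\<tau>)"
    using simplex_integral_halving[OF ij F hom nn] unfolding pull by simp
  moreover have "2 powr p \<noteq> 1" unfolding two_powr_eq_1_iff using p0 by simp
  ultimately have "(\<integral>x. F x \<partial>\<tau>) = 0" by (metis mult_cancel_right1)
  then have "AE x in \<tau>. F x = 0" by (intro sphere_measures_AE_zero[OF simplex_measure_in_sphere_measures F nn]) simp
  then show ?thesis by eventually_elim (simp add: F_def)
qed

text \<open>For negative \<open>p\<close> the power of \<open>\<bar>x\<^sub>i - x\<^sub>j\<bar>\<close> is unbounded. Instead, \<open>N\<close> is a norm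
that grows under both dual maps by at least \<open>\<bar>x\<^sub>i - x\<^sub>j\<bar>\<close>, so \<open>N powr p\<close> decreases strictly where
\<open>x\<^sub>i \<noteq> x\<^sub>j\<close>.\<close>

lemma diagonal_neg_degree:
  assumes p0: "p < 0" and ij: "i \<noteq> j"
  shows "AE x in \<tau>. x $ i = x $ j"
proof -
  define N where "N x = \<bar>x $ i - x $ j\<bar> + (max \<bar>x $ i\<bar> \<bar>x $ j\<bar> + (\<Sum>k\<in>UNIV - {i, j}. \<bar>x $ k\<bar>))" for x :: "real^'n"
  define F where "F x = N x powr p" for x
  have Nn: "0 \<le> N x" for x by (simp add: N_def sum_nonneg)
  have Npos: "0 < N x" if "x \<noteq> 0" for x
  proof (rule ccontr)
    assume "\<not> 0 < N x"
    then have z: "N x = 0" using Nn[of x] by simp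
    have s: "0 \<le> (\<Sum>k\<in>UNIV - {i, j}. \<bar>x $ k\<bar>)" by (simp add: sum_nonneg)
    have "x $ i = 0" using z s unfolding N_def by linarith
    moreover have "x $ j = 0" using z s unfolding N_def by linarith
    moreover have "(\<Sum>k\<in>UNIV - {i, j}. \<bar>x $ k\<bar>) = 0" using z s unfolding N_def by linarith
    ultimately have "x $ k = 0" for k by (cases "k \<in> {i, j}") (auto simp: sum_nonneg_eq_0_iff)
    then show False using that by (simp add: vec_eq_iff)
  qed
  have F: "continuous_on (- {0}) F" unfolding F_def
  proof (rule continuous_on_powr)
    show "continuous_on (- {0}) N" unfolding N_def by (intro continuous_intros continuous_on_max)
    show "\<forall>x\<in>- {0}. N x \<noteq> 0" using Npos by force
  qed simp
  have "N (t *\<^sub>R x) = t * N x" if "t > 0" for t x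
    using that by (simp add: N_def abs_mult right_diff_distrib[symmetric] distrib_left sum_distrib_left max_mult_distrib_left)
  then have hom: "homogeneous p F" using Nn by (auto simp: homogeneous_def F_def powr_mult)
  have nn: "0 \<le> F x" for x by (simp add: F_def)
  have sum_half_map_dual: "(\<Sum>k\<in>UNIV - {i, j}. \<bar>half_map_dual a b x $ k\<bar>) = (\<Sum>k\<in>UNIV - {i, j}. \<bar>x $ k\<bar>)" if "a \<in> {i, j}" for a b x
    using that by (intro sum.cong) (auto simp: half_map_dual_nth)
  have grow: "N x + \<bar>x $ i - x $ j\<bar> \<le> N (half_map_dual i j x)" "N x + \<bar>x $ i - x $ j\<bar> \<le> N (half_map_dual j i x)" for x
  proof -
    have core: "max \<bar>a\<bar> \<bar>b\<bar> + 2 * \<bar>a - b\<bar> \<le> \<bar>2 * a - b - b\<bar> + max \<bar>2 * a - b\<bar> \<bar>b\<bar>"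
      "max \<bar>b\<bar> \<bar>a\<bar> + 2 * \<bar>b - a\<bar> \<le> \<bar>b - (2 * a - b)\<bar> + max \<bar>b\<bar> \<bar>2 * a - b\<bar>" for a b :: real
    proof -
      have 1: "\<bar>2 * a - b - b\<bar> = 2 * \<bar>a - b\<bar>" "\<bar>b - (2 * a - b)\<bar> = 2 * \<bar>b - a\<bar>" by (auto simp: abs_if)
      have 2: "2 * \<bar>a\<bar> \<le> \<bar>2 * a - b\<bar> + \<bar>b\<bar>" by linarith
      show "max \<bar>a\<bar> \<bar>b\<bar> + 2 * \<bar>a - b\<bar> \<le> \<bar>2 * a - b - b\<bar> + max \<bar>2 * a - b\<bar> \<bar>b\<bar>"
        unfolding 1 using 2 by (simp add: max_def)
      show "max \<bar>b\<bar> \<bar>a\<bar> + 2 * \<bar>b - a\<bar> \<le> \<bar>b - (2 * a - b)\<bar> + max \<bar>b\<bar> \<bar>2 * a - b\<bar>"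
        unfolding 1 using 2 by (simp add: max_def)
    qed
    let ?S = "\<Sum>k\<in>UNIV - {i, j}. \<bar>x $ k\<bar>"
    have "N (half_map_dual i j x) = \<bar>2 * x $ i - x $ j - x $ j\<bar> + (max \<bar>2 * x $ i - x $ j\<bar> \<bar>x $ j\<bar> + ?S)"
      "N (half_map_dual j i x) = \<bar>x $ i - (2 * x $ j - x $ i)\<bar> + (max \<bar>x $ i\<bar> \<bar>2 * x $ j - x $ i\<bar> + ?S)"
      using ij not_sym[OF ij]
      by (simp_all only: N_def sum_half_map_dual insertI1 insertI2 singletonI)
        (simp_all only: half_map_dual_nth if_True if_False refl simp_thms)
    then show "N x + \<bar>x $ i - x $ j\<bar> \<le> N (half_map_dual i j x)" "N x + \<bar>x $ i - x $ j\<bar> \<le> N (half_map_dual j i x)"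
      using core(1)[of "x $ i" "x $ j"] core(2)[of "x $ i" "x $ j"] unfolding N_def[of x]
      by linarith+
  qed
  have mono: "F (half_map_dual i j x) \<le> F x" "F (half_map_dual j i x) \<le> F x" if "x \<noteq> 0" for x
    unfolding F_def using p0 Npos[OF that] grow[of x] by (auto intro!: powr_mono2')
  have "AE x in \<tau>. F (half_map_dual i j x) = F x"
    using mono by (intro AE_invariant_of_monotone[OF ij F hom nn, of "-1"]) auto
  then show ?thesis
  proof (rule AE_mp, intro AE_I2 impI)
    fix x assume "x \<in> space \<tau>" and eq: "F (half_map_dual i j x) = F x"
    then have "x \<noteq> 0" using sphere_measuresD(3)[OF simplex_measure_in_sphere_measures] by auto
    show "x $ i = x $ j"
    proof (rule ccontr)
      assume "x $ i \<noteq> x $ j"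
      then have "N x < N (half_map_dual i j x)" using grow(1)[of x] by simp
      then have "F (half_map_dual i j x) < F x"
        unfolding F_def using p0 Npos[OF \<open>x \<noteq> 0\<close>] by (intro powr_less_mono2_neg) auto
      then show False using eq by simp
    qed
  qed
qed

text \<open>For \<open>p = 0\<close> the quotient of \<open>\<bar>x\<^sub>i - x\<^sub>j\<bar>\<close> and the sum norm does not decrease under the dual maps: the
numerator doubles and the denominator grows by at most the numerator. It stays constant off the hyperplane
\<open>x\<^sub>i = x\<^sub>j\<close> only if the numerator equals the denominator, which makes all other coordinates vanish.\<close>

lemma equal_or_rest_zero_zero_degree:
  assumes p0: "p = 0" and ij: "i \<noteq> j"
  shows "AE x in \<tau>. x $ i = x $ j \<or> (\<forall>k. k \<noteq> i \<longrightarrow> k \<noteq> j \<longrightarrow> x $ k = 0)"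
proof -
  define N where "N x = (\<Sum>k\<in>UNIV. \<bar>x $ k\<bar>)" for x :: "real^'n"
  define F where "F x = \<bar>x $ i - x $ j\<bar> / N x" for x
  have Nn: "0 \<le> N x" for x by (simp add: N_def sum_nonneg)
  have Npos: "0 < N x" if "x \<noteq> 0" for x
  proof (rule ccontr)
    assume "\<not> 0 < N x"
    then have "N x = 0" using Nn[of x] by simp
    then have "x $ k = 0" for k by (auto simp: N_def sum_nonneg_eq_0_iff)
    then show False using that by (simp add: vec_eq_iff)
  qed
  have F: "continuous_on (- {0}) F" unfolding F_def
  proof (rule continuous_on_divide)
    show "continuous_on (- {0}) N" unfolding N_def by (intro continuous_intros)
    show "\<forall>x\<in>- {0}. N x \<noteq> 0" using Npos by force
  qed (intro continuous_intros)
  have "F (t *\<^sub>R x) = F x" if "t > 0" for t x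
    using that by (simp add: F_def N_def abs_mult right_diff_distrib[symmetric] sum_distrib_left[symmetric])
  then have hom: "homogeneous p F" by (simp add: homogeneous_def p0)
  have nn: "0 \<le> F x" for x using Nn by (simp add: F_def)
  have dN: "\<bar>x $ i - x $ j\<bar> + (\<Sum>k\<in>UNIV - {i, j}. \<bar>x $ k\<bar>) \<le> N x" for x
    unfolding N_def sum_remove2[OF ij] by linarith
  have sum_half_map_dual: "(\<Sum>k\<in>UNIV - {i, j}. \<bar>half_map_dual a b x $ k\<bar>) = (\<Sum>k\<in>UNIV - {i, j}. \<bar>x $ k\<bar>)" if "a \<in> {i, j}" for a b x
    using that by (intro sum.cong) (auto simp: half_map_dual_nth)
  have N_half_map_dual: "N (half_map_dual i j x) \<le> N x + \<bar>x $ i - x $ j\<bar>" "N (half_map_dual j i x) \<le> N x + \<bar>x $ i - x $ j\<bar>" for x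
  proof -
    have "\<bar>2 * a - b\<bar> \<le> \<bar>a\<bar> + \<bar>a - b\<bar>" for a b :: real by linarith
    from this[of "x $ i" "x $ j"] this[of "x $ j" "x $ i"]
    show "N (half_map_dual i j x) \<le> N x + \<bar>x $ i - x $ j\<bar>" "N (half_map_dual j i x) \<le> N x + \<bar>x $ i - x $ j\<bar>"
      unfolding N_def sum_remove2[OF ij] using ij by (simp_all add: sum_half_map_dual half_map_dual_nth abs_minus_commute)
  qed
  have d_half_map_dual: "F (half_map_dual i j x) = 2 * \<bar>x $ i - x $ j\<bar> / N (half_map_dual i j x)"
    "F (half_map_dual j i x) = 2 * \<bar>x $ i - x $ j\<bar> / N (half_map_dual j i x)" for x
  proof -
    have "\<bar>2 * x $ i - x $ j - x $ j\<bar> = 2 * \<bar>x $ i - x $ j\<bar>" "\<bar>x $ i - (2 * x $ j - x $ i)\<bar> = 2 * \<bar>x $ i - x $ j\<bar>"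
      by (auto simp: abs_if)
    then show "F (half_map_dual i j x) = 2 * \<bar>x $ i - x $ j\<bar> / N (half_map_dual i j x)"
      "F (half_map_dual j i x) = 2 * \<bar>x $ i - x $ j\<bar> / N (half_map_dual j i x)"
      using ij by (simp_all add: F_def half_map_dual_nth)
  qed
  have frac: "d / n \<le> 2 * d / n'" if "0 < n" "0 < n'" "0 \<le> d" "n' \<le> n + d" "d \<le> n" for d n n' :: real
  proof -
    have "d * n' \<le> d * (2 * n)" using that by (intro mult_left_mono) auto
    then show ?thesis using that by (simp add: field_simps)
  qed
  have mono: "F x \<le> F (half_map_dual i j x)" "F x \<le> F (half_map_dual j i x)" if "x \<noteq> 0" for x
  proof -
    have s: "0 \<le> (\<Sum>k\<in>UNIV - {i, j}. \<bar>x $ k\<bar>)" by (simp add: sum_nonneg)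
    have pp: "0 < N (half_map_dual i j x)" "0 < N (half_map_dual j i x)" using Npos half_map_dual_eq_0 ij that by metis+
    show "F x \<le> F (half_map_dual i j x)"
      unfolding d_half_map_dual(1) unfolding F_def using pp Npos[OF that] N_half_map_dual[of x] dN[of x] s by (intro frac; linarith)
    show "F x \<le> F (half_map_dual j i x)"
      unfolding d_half_map_dual(2) unfolding F_def using pp Npos[OF that] N_half_map_dual[of x] dN[of x] s by (intro frac; linarith)
  qed
  have "AE x in \<tau>. F (half_map_dual i j x) = F x"
    using mono by (intro AE_invariant_of_monotone[OF ij F hom nn, of 1]) auto
  then show ?thesis
  proof (rule AE_mp, intro AE_I2 impI)
    fix x assume "x \<in> space \<tau>" and eq: "F (half_map_dual i j x) = F x"
    then have x0: "x \<noteq> 0" using sphere_measuresD(3)[OF simplex_measure_in_sphere_measures] by auto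
    have pp: "0 < N (half_map_dual i j x)" using Npos half_map_dual_eq_0 ij x0 by metis
    show "x $ i = x $ j \<or> (\<forall>k. k \<noteq> i \<longrightarrow> k \<noteq> j \<longrightarrow> x $ k = 0)"
    proof (cases "x $ i = x $ j")
      case False
      let ?d = "\<bar>x $ i - x $ j\<bar>"
      have "2 * ?d / N (half_map_dual i j x) = ?d / N x" using eq unfolding d_half_map_dual(1) unfolding F_def .
      then have "?d * (2 * N x) = ?d * N (half_map_dual i j x)" using pp Npos[OF x0] by (simp add: field_simps)
      then have "2 * N x = N (half_map_dual i j x)" using False by simp
      then have "(\<Sum>k\<in>UNIV - {i, j}. \<bar>x $ k\<bar>) \<le> 0" using N_half_map_dual(1)[of x] dN[of x] by linarith
      then have "(\<Sum>k\<in>UNIV - {i, j}. \<bar>x $ k\<bar>) = 0" by (simp add: sum_nonneg antisym)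
      then show ?thesis by (auto simp: sum_nonneg_eq_0_iff)
    qed simp
  qed
qed

text \<open>With a third index available, the previous lemma for all pairs leaves only the diagonal and the coordinate
axes. The function \<open>F\<close> vanishes there, so by the functional equation it also vanishes almost everywhere after
each of the two dual maps. But these maps make it positive on the \<open>j\<close>-th and on the \<open>i\<close>-th axis, respectively.\<close>

lemma diagonal_zero_degree:
  assumes p0: "p = 0" and n3: "CARD('n) \<ge> 3" and ij: "i \<noteq> j"
  shows "AE x in \<tau>. x $ i = x $ j"
proof -
  have "AE x in \<tau>. \<forall>a b. a \<noteq> b \<longrightarrow> x $ a = x $ b \<or> (\<forall>k. k \<noteq> a \<longrightarrow> k \<noteq> b \<longrightarrow> x $ k = 0)"
    unfolding AE_all_countable using equal_or_rest_zero_zero_degree[OF p0] by auto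
  then have dich: "AE x in \<tau>. (\<forall>a b. x $ a = x $ b) \<or> (\<exists>a. \<forall>k. k \<noteq> a \<longrightarrow> x $ k = 0)"
  proof (rule AE_mp, intro AE_I2 impI)
    fix x :: "real^'n" assume H: "\<forall>a b. a \<noteq> b \<longrightarrow> x $ a = x $ b \<or> (\<forall>k. k \<noteq> a \<longrightarrow> k \<noteq> b \<longrightarrow> x $ k = 0)"
    show "(\<forall>a b. x $ a = x $ b) \<or> (\<exists>a. \<forall>k. k \<noteq> a \<longrightarrow> x $ k = 0)"
    proof (cases "\<forall>a b. x $ a = x $ b")
      case False
      then obtain a b where ab: "x $ a \<noteq> x $ b" by blast
      then have z: "\<And>k. k \<noteq> a \<Longrightarrow> k \<noteq> b \<Longrightarrow> x $ k = 0" using H by metis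
      have "card {a, b} \<le> 2" by (simp add: card_insert_if)
      then have "\<not> (UNIV :: 'n set) \<subseteq> {a, b}"
        using n3 card_mono[of "{a, b}" "UNIV :: 'n set"] by auto
      then obtain c where c: "c \<noteq> a" "c \<noteq> b" by blast
      then have "x $ c = 0" using z by blast
      then have "x $ a = 0 \<or> x $ b = 0" using H c ab by metis
      then show ?thesis using z by metis
    qed simp
  qed
  define F where "F x = max 0 (- (x $ i * x $ j)) / (norm x)\<^sup>2" for x :: "real^'n"
  have F: "continuous_on (- {0}) F" unfolding F_def
    by (intro continuous_on_divide continuous_on_max continuous_intros) auto
  have hom: "homogeneous p F"
  proof (unfold homogeneous_def, intro allI impI)
    fix x :: "real^'n" and t :: real assume "t > 0"
    then have "max 0 (- (t * x $ i * (t * x $ j))) = t\<^sup>2 * max 0 (- (x $ i * x $ j))"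
      by (simp add: max_mult_distrib_left power2_eq_square mult_ac)
    then show "F (t *\<^sub>R x) = t powr p * F x" using \<open>t > 0\<close> by (simp add: F_def p0 power_mult_distrib)
  qed
  have nn: "0 \<le> F x" for x by (simp add: F_def)
  have "AE x in \<tau>. F x = 0"
    using dich
  proof (rule AE_mp, intro AE_I2 impI)
    fix x :: "real^'n" assume "(\<forall>a b. x $ a = x $ b) \<or> (\<exists>a. \<forall>k. k \<noteq> a \<longrightarrow> x $ k = 0)"
    then have "x $ i = x $ j \<or> x $ i = 0 \<or> x $ j = 0" using ij by metis
    then show "F x = 0" by (auto simp: F_def)
  qed
  then have "(\<integral>x. F x \<partial>\<tau>) = 0" by (rule integral_eq_zero_AE)
  moreover have "0 \<le> (\<integral>x. F (half_map_dual i j x) \<partial>\<tau>)" "0 \<le> (\<integral>x. F (half_map_dual j i x) \<partial>\<tau>)"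
    using nn by (auto intro: integral_nonneg_AE)
  ultimately have z: "(\<integral>x. F (half_map_dual i j x) \<partial>\<tau>) \<le> 0" "(\<integral>x. F (half_map_dual j i x) \<partial>\<tau>) \<le> 0"
    using simplex_integral_halving[OF ij F hom nn] by linarith+
  have "AE x in \<tau>. F (half_map_dual i j x) = 0"
    by (rule sphere_measures_AE_zero[OF simplex_measure_in_sphere_measures continuous_on_half_map_dual[OF F ij] nn z(1)])
  moreover have "AE x in \<tau>. F (half_map_dual j i x) = 0"
    by (rule sphere_measures_AE_zero[OF simplex_measure_in_sphere_measures continuous_on_half_map_dual[OF F ij[symmetric]] nn z(2)])
  ultimately show ?thesis
    using dich AE_space
  proof eventually_elim
    fix x :: "real^'n" assume a: "F (half_map_dual i j x) = 0" "F (half_map_dual j i x) = 0"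
      and d: "(\<forall>a b. x $ a = x $ b) \<or> (\<exists>a. \<forall>k. k \<noteq> a \<longrightarrow> x $ k = 0)" and "x \<in> space \<tau>"
    then have x0: "x \<noteq> 0" using sphere_measuresD(3)[OF simplex_measure_in_sphere_measures] by auto
    have pos: "norm (half_map_dual i j x) \<noteq> 0" "norm (half_map_dual j i x) \<noteq> 0" using half_map_dual_eq_0 ij x0 by (metis norm_eq_zero)+
    show "x $ i = x $ j"
    proof (rule ccontr)
      assume ne: "x $ i \<noteq> x $ j"
      then have "x $ i = 0 \<or> x $ j = 0" using d ij by metis
      then show False
      proof
        assume "x $ i = 0"
        then have "(x $ j)\<^sup>2 \<le> 0" using a(1) pos(1) ij by (simp add: F_def half_map_dual_nth power2_eq_square max_def split: if_splits)
        then show False using ne \<open>x $ i = 0\<close> by simp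
      next
        assume "x $ j = 0"
        then have "(x $ i)\<^sup>2 \<le> 0" using a(2) pos(2) ij by (simp add: F_def half_map_dual_nth power2_eq_square max_def split: if_splits)
        then show False using ne \<open>x $ j = 0\<close> by simp
      qed
    qed
  qed
qed

lemma simplex_measure_on_diagonal:
  assumes n3: "CARD('n) \<ge> 3"
  shows "AE x in \<tau>. \<forall>i j. x $ i = x $ j"
  unfolding AE_all_countable
proof (intro allI)
  fix i j :: 'n
  consider "i = j" | "i \<noteq> j" "p > 0" | "i \<noteq> j" "p < 0" | "i \<noteq> j" "p = 0" by linarith
  then show "AE x in \<tau>. x $ i = x $ j"
    using diagonal_pos_degree diagonal_neg_degree diagonal_zero_degree[OF _ n3] by cases auto
qed

end

section \<open>Uniqueness and the classification\<close>

definition unit_diagonal :: "real^'n" where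
  "unit_diagonal = (\<chi> i. 1 / sqrt CARD('n))"

lemma norm_const_vec: "norm (\<chi> i. c :: real^'n) = \<bar>c\<bar> * sqrt CARD('n)"
  by (simp add: norm_vec_def L2_set_def real_sqrt_mult)

lemma norm_unit_diagonal [simp]: "norm (unit_diagonal :: real^'n) = 1"
  unfolding unit_diagonal_def norm_const_vec by simp

lemma unit_diagonal_neq_uminus: "(unit_diagonal :: real^'n) \<noteq> - unit_diagonal"
proof
  assume "(unit_diagonal :: real^'n) = - unit_diagonal"
  then have "norm ((unit_diagonal :: real^'n) + unit_diagonal) = 0" by simp
  then have "norm ((2::real) *\<^sub>R (unit_diagonal :: real^'n)) = 0" by (simp only: scaleR_2)
  then show False by simp
qed

lemma sum_two: "a \<noteq> b \<Longrightarrow> (\<Sum>x\<in>{a, b}. h x) = h a + (h b :: real)"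
  by simp

lemma singleton_sets_sphere_borel: "norm u = 1 \<Longrightarrow> {u} \<in> sets sphere_borel"
  unfolding sphere_borel_def sets_restrict_space by (auto intro!: image_eqI[of _ _ "{u}"])

lemma (in contravariant_valuation) measure_simplex_two_atoms:
  assumes n3: "CARD('n) \<ge> 3" and A: "A \<in> sets sphere_borel"
  shows "measure \<tau> A = measure \<tau> {unit_diagonal} * indicator A unit_diagonal +
    measure \<tau> {- unit_diagonal} * indicator A (- unit_diagonal)"
proof -
  let ?v = "unit_diagonal :: real^'n"
  interpret \<tau>: finite_measure \<tau> by (rule sphere_measuresD[OF simplex_measure_in_sphere_measures])
  have s: "{?v} \<in> sets \<tau>" "{- ?v} \<in> sets \<tau>" "A \<in> sets \<tau>"
    using A by (simp_all add: sphere_measuresD(2)[OF simplex_measure_in_sphere_measures] singleton_sets_sphere_borel)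
  have s2: "A \<inter> {?v, - ?v} \<in> sets \<tau>" using s by (metis insert_is_Un sets.Int sets.Un)
  have "AE x in \<tau>. x \<in> {?v, - ?v}"
    using simplex_measure_on_diagonal[OF n3] AE_space
  proof eventually_elim
    fix x :: "real^'n" assume eq: "\<forall>i j. x $ i = x $ j" and "x \<in> space \<tau>"
    then have n1: "norm x = 1" using sphere_measuresD(3)[OF simplex_measure_in_sphere_measures] by simp
    obtain k :: 'n where True by blast
    define c where "c = x $ k"
    have x: "x = (\<chi> i. c)" using eq by (auto simp: vec_eq_iff c_def)
    have "\<bar>c\<bar> * sqrt CARD('n) = 1" using n1 unfolding x norm_const_vec .
    then have "\<bar>c\<bar> = 1 / sqrt CARD('n)" by (simp add: eq_divide_eq)
    then have "c = 1 / sqrt CARD('n) \<or> c = - (1 / sqrt CARD('n))" by linarith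
    then show "x \<in> {?v, - ?v}" unfolding x by (auto simp: unit_diagonal_def vec_eq_iff)
  qed
  then have "AE x in \<tau>. x \<in> A \<longleftrightarrow> x \<in> A \<inter> {?v, - ?v}" by eventually_elim auto
  then have "measure \<tau> A = measure \<tau> (A \<inter> {?v, - ?v})"
    using s(3) s2 by (rule measure_eq_AE)
  also have "\<dots> = (\<Sum>x\<in>A \<inter> {?v, - ?v}. measure \<tau> {x})"
    by (rule \<tau>.finite_measure_eq_sum_singleton) (use s in auto)
  also have "\<dots> = (\<Sum>x\<in>{?v, - ?v}. measure \<tau> {x} * indicator A x)"
    by (auto simp: sum.inter_restrict Int_commute[of A] indicator_def intro!: sum.cong)
  finally show ?thesis unfolding sum_two[OF unit_diagonal_neq_uminus] .
qed

text \<open>The difference of the two maps is a simple valuation for each Borel set, and by contravariance it vanishes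
at all invertible linear images of the standard simplex.\<close>

lemma contravariant_valuation_unique:
  fixes \<mu> \<kappa> :: "(real^'n) set \<Rightarrow> (real^'n) measure"
  assumes \<mu>: "contravariant_valuation p \<mu>" and \<kappa>: "contravariant_valuation p \<kappa>"
    and eq: "\<And>A. A \<in> sets sphere_borel \<Longrightarrow>
      measure (\<mu> (convex hull (insert 0 Basis))) A = measure (\<kappa> (convex hull (insert 0 Basis))) A"
    and P: "P \<in> polytopes_o" and A: "A \<in> sets sphere_borel"
  shows "measure (\<mu> P) A = measure (\<kappa> P) A"
proof -
  interpret \<mu>: contravariant_valuation p \<mu> by (rule \<mu>)
  interpret \<kappa>: contravariant_valuation p \<kappa> by (rule \<kappa>)
  let ?T = "convex hull (insert 0 Basis) :: (real^'n) set"
  have T: "?T \<in> polytopes_o" by (rule std_simplex_polytopes_o)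
  have eqT: "\<mu> ?T = \<kappa> ?T"
  proof (rule measure_eqI)
    show "sets (\<mu> ?T) = sets (\<kappa> ?T)"
      by (simp only: sphere_measuresD(2)[OF \<mu>.simplex_measure_in_sphere_measures] sphere_measuresD(2)[OF \<kappa>.simplex_measure_in_sphere_measures])
    fix X assume "X \<in> sets (\<mu> ?T)"
    then have "X \<in> sets sphere_borel" by (simp add: sphere_measuresD(2)[OF \<mu>.simplex_measure_in_sphere_measures])
    from eq[OF this] show "emeasure (\<mu> ?T) X = emeasure (\<kappa> ?T) X"
      by (simp add: finite_measure.emeasure_eq_measure[OF sphere_measuresD(1)[OF \<mu>.simplex_measure_in_sphere_measures]]
          finite_measure.emeasure_eq_measure[OF sphere_measuresD(1)[OF \<kappa>.simplex_measure_in_sphere_measures]])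
  qed
  define \<nu> where "\<nu> Q = measure (\<mu> Q) A - measure (\<kappa> Q) A" for Q
  have "\<nu> P = 0"
  proof (rule simple_valuation_eq_0[OF _ _ P])
    show "simple_valuation \<nu>"
      unfolding simple_valuation_def
    proof (intro conjI allI impI ballI)
      fix Q R :: "(real^'n) set"
      assume "Q \<in> polytopes_o" "R \<in> polytopes_o" "Q \<union> R \<in> polytopes_o" "Q \<inter> R \<in> polytopes_o"
      then show "\<nu> (Q \<union> R) + \<nu> (Q \<inter> R) = \<nu> Q + \<nu> R"
        using \<mu>.val[unfolded valuation_def, rule_format, of Q R A]
          \<kappa>.val[unfolded valuation_def, rule_format, of Q R A] A by (simp add: \<nu>_def)
    next
      fix Q :: "(real^'n) set" assume "Q \<in> polytopes_o" "interior Q = {}"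
      then show "\<nu> Q = 0"
        using contravariant_null_of_empty_interior[OF \<mu>.p \<mu>.contra \<mu>.\<mu>, of Q A]
          contravariant_null_of_empty_interior[OF \<kappa>.p \<kappa>.contra \<kappa>.\<mu>, of Q A] by (simp add: \<nu>_def)
    qed
  next
    fix f :: "real^'n \<Rightarrow> real^'n" assume f: "linear f" "inj f"
    then have "invertible (matrix f)" using det_nz_iff_inj invertible_det_nz by blast
    then have GL: "matrix f \<in> GL" by (simp add: GL_def)
    have im: "(\<lambda>x. matrix f *v x) ` ?T = f ` ?T" using f by simp
    have fT: "f ` ?T \<in> polytopes_o" by (rule polytopes_o_linear_image[OF f(1) T])
    have "\<mu> (f ` ?T) = \<kappa> (f ` ?T)"
    proof (rule sphere_measures_eqI)
      show "\<mu> (f ` ?T) \<in> sphere_measures" "\<kappa> (f ` ?T) \<in> sphere_measures"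
        using \<mu>.\<mu> \<kappa>.\<mu> fT by blast+
      fix F :: "real^'n \<Rightarrow> real" assume F: "continuous_on (- {0}) F" "homogeneous p F"
      show "(\<integral>x. F x \<partial>\<mu> (f ` ?T)) = (\<integral>x. F x \<partial>\<kappa> (f ` ?T))"
        using \<mu>.contra[unfolded contravariant_def, rule_format, OF GL T F]
          \<kappa>.contra[unfolded contravariant_def, rule_format, OF GL T F] unfolding im eqT by (simp only:)
    qed
    then show "\<nu> (f ` ?T) = 0" by (simp add: \<nu>_def)
  qed
  then show ?thesis by (simp add: \<nu>_def)
qed

text \<open>The combinations of the theorem are the measures with weight \<open>c1 * w u + c2 * w (- u)\<close>, where \<open>w\<close> denotes the
facet weight of \<open>P\<close>, because the weight of \<open>- P\<close> at \<open>u\<close> is the weight of \<open>P\<close> at \<open>- u\<close>.\<close>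

lemma has_weights_Lp_combination_iff:
  fixes P :: "(real^'n) set"
  assumes M: "M \<in> sphere_measures" and P: "P \<in> polytopes_o" and c: "0 \<le> c1" "0 \<le> c2"
  shows "(\<forall>A \<in> sets sphere_borel. measure M A = c1 * measure (Lp_surface_area_measure p P) A +
      c2 * measure (Lp_surface_area_measure p (uminus ` P)) A) \<longleftrightarrow>
    has_weights M (\<lambda>u. c1 * facet_weight p P u + c2 * facet_weight p P (- u))"
proof -
  let ?W = "\<lambda>u. c1 * facet_weight p P u + c2 * facet_weight p P (- u)"
  define U where "U = facet_normals_off_origin P \<union> uminus ` facet_normals_off_origin P"
  have U: "finite U" "U \<subseteq> sphere 0 1"
    using finite_facet_normals[OF P] by (auto simp: U_def facet_normals_off_origin_def)
  have zero: "facet_weight p P u = 0" "facet_weight p P (- u) = 0" if "norm u = 1" "u \<notin> U" for u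
  proof -
    have "- u \<notin> facet_normals_off_origin P"
      using that(2) unfolding U_def by (metis UnI2 imageI minus_minus)
    then show "facet_weight p P u = 0" "facet_weight p P (- u) = 0"
      using that facet_weight_not_facet_normal[OF P, of u p] facet_weight_not_facet_normal[OF P, of "- u" p]
      by (auto simp: U_def)
  qed
  have mP: "uminus ` P \<in> polytopes_o"
    using P by (intro polytopes_o_linear_image) (auto intro: linearI)
  have sum: "c1 * measure (Lp_surface_area_measure p P) A + c2 * measure (Lp_surface_area_measure p (uminus ` P)) A =
      (\<Sum>u\<in>U. ?W u * indicator A u)" if A: "A \<in> sets sphere_borel" for A
  proof -
    have "measure (Lp_surface_area_measure p P) A = (\<Sum>u\<in>U. facet_weight p P u * indicator A u)"
      using zero by (intro has_weights_measure[OF has_weights_Lp_surface_area_measure[OF P] U _ A]) auto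
    moreover have "measure (Lp_surface_area_measure p (uminus ` P)) A = (\<Sum>u\<in>U. facet_weight p (uminus ` P) u * indicator A u)"
      using zero by (intro has_weights_measure[OF has_weights_Lp_surface_area_measure[OF mP] U _ A])
        (auto simp: facet_weight_uminus[OF P])
    ultimately show ?thesis
      by (simp add: facet_weight_uminus[OF P] sum_distrib_left sum.distrib[symmetric] algebra_simps)
  qed
  have supp: "{u \<in> sphere 0 1. ?W u \<noteq> 0} \<subseteq> U"
  proof (rule subsetI, rule ccontr)
    fix u assume u: "u \<in> {u \<in> sphere 0 1. ?W u \<noteq> 0}" and "u \<notin> U"
    then have "facet_weight p P u = 0" "facet_weight p P (- u) = 0" using zero by auto
    then show False using u by simp
  qed
  show ?thesis
  proof
    assume H: "\<forall>A \<in> sets sphere_borel. measure M A = c1 * measure (Lp_surface_area_measure p P) A +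
      c2 * measure (Lp_surface_area_measure p (uminus ` P)) A"
    show "has_weights M ?W"
      using c H sum by (intro has_weightsI[OF M _ U supp]) (auto simp: facet_weight_nonneg)
  next
    assume H: "has_weights M ?W"
    show "\<forall>A \<in> sets sphere_borel. measure M A = c1 * measure (Lp_surface_area_measure p P) A +
      c2 * measure (Lp_surface_area_measure p (uminus ` P)) A"
      using has_weights_measure[OF H U supp] sum by simp
  qed
qed

lemma inner_unit_diagonal: "unit_diagonal \<bullet> (x :: real^'n) = (\<Sum>k\<in>UNIV. x $ k) / sqrt CARD('n)"
  by (simp add: unit_diagonal_def inner_vec_def sum_divide_distrib)

text \<open>The supporting hyperplane with normal \<open>- unit_diagonal\<close> passes through the origin.\<close>

lemma facet_weight_std_simplex_neg:
  "facet_weight p (convex hull (insert 0 Basis)) (- unit_diagonal :: real^'n) = 0"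
proof -
  have "support_fun (convex hull (insert 0 Basis)) (- unit_diagonal :: real^'n) = (- unit_diagonal :: real^'n) \<bullet> 0"
    by (rule support_fun_eqI) (auto simp: std_simplex_cart inner_unit_diagonal sum_nonneg)
  then show ?thesis by (simp add: facet_weight_def)
qed

text \<open>The pyramid over the facet with normal \<open>unit_diagonal\<close> contains the standard simplex, which has positive volume.\<close>

lemma facet_weight_std_simplex_pos:
  "0 < facet_weight p (convex hull (insert 0 Basis)) (unit_diagonal :: real^'n)"
proof -
  let ?T = "convex hull (insert 0 Basis) :: (real^'n) set" and ?v = "unit_diagonal :: real^'n"
  let ?F = "support_face ?T ?v"
  obtain k :: 'n where True by blast
  let ?e = "axis k 1 :: real^'n"
  have sum_e: "(\<Sum>i\<in>UNIV. ?e $ i) = 1" by (simp add: axis_def)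
  have e: "?e \<in> ?T" using sum_e by (simp add: std_simplex_cart) (simp add: axis_def)
  have "support_fun ?T ?v = ?v \<bullet> ?e"
    using e sum_e by (intro support_fun_eqI) (auto simp: inner_unit_diagonal std_simplex_cart divide_right_mono)
  then have h: "support_fun ?T ?v = 1 / sqrt CARD('n)" using sum_e by (simp add: inner_unit_diagonal)
  have F: "x \<in> ?F \<longleftrightarrow> (\<forall>i. 0 \<le> x $ i) \<and> (\<Sum>i\<in>UNIV. x $ i) = 1" for x
    unfolding support_face_def h unfolding inner_unit_diagonal std_simplex_cart by auto
  have "?T \<subseteq> pyramid ?F"
  proof
    fix x assume x: "x \<in> ?T"
    let ?s = "\<Sum>i\<in>UNIV. x $ i"
    have s: "0 \<le> ?s" "?s \<le> 1" and x0: "\<And>i. 0 \<le> x $ i" using x by (auto simp: std_simplex_cart sum_nonneg)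
    show "x \<in> pyramid ?F"
    proof (cases "?s = 0")
      case True
      then have "x = 0 *\<^sub>R ?e" using x0 by (simp add: sum_nonneg_eq_0_iff vec_eq_iff)
      moreover have "?e \<in> ?F" unfolding F using e sum_e by (simp add: std_simplex_cart)
      ultimately show ?thesis unfolding pyramid_def by (intro CollectI exI[of _ 0] exI[of _ ?e]) simp
    next
      case False
      have "(1 / ?s) *\<^sub>R x \<in> ?F"
        unfolding F using x0 s False by (simp add: sum_divide_distrib[symmetric])
      moreover have "x = ?s *\<^sub>R ((1 / ?s) *\<^sub>R x)" using False by simp
      ultimately show ?thesis unfolding pyramid_def using s by blast
    qed
  qed
  moreover have cT: "compact ?T" using polytopes_oD(2)[OF std_simplex_polytopes_o] .
  ultimately have "measure lebesgue ?T \<le> measure lebesgue (pyramid ?F)"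
    by (intro measure_mono_fmeasurable lmeasurable_compact compact_pyramid compact_support_face)
      (auto simp: fmeasurableD lmeasurable_compact)
  moreover have "measure lebesgue ?T = 1 / fact DIM(real^'n)"
    using content_std_simplex[where 'a="real^'n"] cT by (simp add: measure_completion borel_compact)
  ultimately have "0 < measure lebesgue (pyramid ?F)"
    by (metis divide_pos_pos fact_gt_zero less_le_trans zero_less_one)
  then show ?thesis unfolding facet_weight_def h by simp
qed

theorem theorem3:
  fixes p :: real and \<mu> :: "(real^'n) set \<Rightarrow> (real^'n) measure"
  assumes "CARD('n) \<ge> 3"
    and "p \<noteq> 1"
    and "\<mu> \<in> polytopes_o \<rightarrow> sphere_measures"
  shows "(valuation \<mu> \<and> contravariant GL p \<mu>) \<longleftrightarrow>
    (\<exists>c1 c2. 0 \<le> c1 \<and> 0 \<le> c2 \<and>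
      (\<forall>P \<in> polytopes_o. \<forall>A \<in> sets sphere_borel.
        measure (\<mu> P) A =
          c1 * measure (Lp_surface_area_measure p P) A +
          c2 * measure (Lp_surface_area_measure p (uminus ` P)) A))"
proof
  assume "\<exists>c1 c2. 0 \<le> c1 \<and> 0 \<le> c2 \<and>
      (\<forall>P \<in> polytopes_o. \<forall>A \<in> sets sphere_borel.
        measure (\<mu> P) A =
          c1 * measure (Lp_surface_area_measure p P) A +
          c2 * measure (Lp_surface_area_measure p (uminus ` P)) A)"
  then obtain c1 c2 where c: "0 \<le> c1" "0 \<le> c2" and eq: "\<forall>P \<in> polytopes_o. \<forall>A \<in> sets sphere_borel.
        measure (\<mu> P) A =
          c1 * measure (Lp_surface_area_measure p P) A +
          c2 * measure (Lp_surface_area_measure p (uminus ` P)) A" by blast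
  have "has_weights (\<mu> P) (\<lambda>u. c1 * facet_weight p P u + c2 * facet_weight p P (- u))"
    if P: "P \<in> polytopes_o" for P
    using has_weights_Lp_combination_iff[OF _ P c, of "\<mu> P" p] eq P assms(3) by blast
  then show "valuation \<mu> \<and> contravariant GL p \<mu>"
    by (rule weighted_valuation_contravariant[OF c])
next
  assume H: "valuation \<mu> \<and> contravariant GL p \<mu>"
  then interpret \<mu>: contravariant_valuation p \<mu> by unfold_locales (use assms in auto)
  let ?S = "Lp_surface_area_measure p :: (real^'n) set \<Rightarrow> _"
  let ?T = "convex hull (insert 0 Basis) :: (real^'n) set" and ?v = "unit_diagonal :: real^'n"
  have T: "?T \<in> polytopes_o" by (rule std_simplex_polytopes_o)
  have "valuation ?S \<and> contravariant GL p ?S"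
    using has_weights_Lp_surface_area_measure[of _ p]
    by (intro weighted_valuation_contravariant[of 1 0]) simp_all
  then interpret S: contravariant_valuation p ?S
    by unfold_locales (use assms(2) has_weights_sphere_measures[OF has_weights_Lp_surface_area_measure] in auto)
  \<comment> \<open>\<open>S\<^sub>p(T)\<close> has no atoms off the diagonal, because the support result applies to \<open>S\<^sub>p\<close> itself\<close>
  have off_diagonal: "facet_weight p ?T u = 0" if u: "norm u = 1" "u \<noteq> ?v" "u \<noteq> - ?v" for u
  proof -
    have "measure (?S ?T) {u} = (\<Sum>x\<in>insert u (facet_normals_off_origin ?T). facet_weight p ?T x * indicator {u} x)"
      using finite_facet_normals[OF T] facet_directions_subset[OF T, of p] u
      by (intro has_weights_measure[OF has_weights_Lp_surface_area_measure[OF T]] singleton_sets_sphere_borel)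
        (auto simp: facet_normals_off_origin_def)
    also have "\<dots> = facet_weight p ?T u"
      using finite_facet_normals[OF T] by (subst sum.mono_neutral_right[of _ "{u}"]) (auto simp: indicator_def)
    finally show ?thesis
      using S.measure_simplex_two_atoms[OF assms(1) singleton_sets_sphere_borel[OF u(1)]] u by simp
  qed
  define w where "w = facet_weight p ?T ?v"
  have w: "0 < w" unfolding w_def by (rule facet_weight_std_simplex_pos)
  define c1 where "c1 = measure (\<mu> ?T) {?v} / w"
  define c2 where "c2 = measure (\<mu> ?T) {- ?v} / w"
  have c: "0 \<le> c1" "0 \<le> c2" using w by (simp_all add: c1_def c2_def)
  let ?W = "\<lambda>(P :: (real^'n) set) u. c1 * facet_weight p P u + c2 * facet_weight p P (- u)"
  define \<kappa> :: "(real^'n) set \<Rightarrow> (real^'n) measure" where "\<kappa> P = discrete_measure {u \<in> sphere 0 1. ?W P u \<noteq> 0} (?W P)" for P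
  have \<kappa>: "has_weights (\<kappa> P) (?W P)" if P: "P \<in> polytopes_o" for P
  proof -
    have "{u \<in> sphere 0 1. ?W P u \<noteq> 0} \<subseteq> facet_normals_off_origin P \<union> uminus ` facet_normals_off_origin P"
    proof
      fix u assume u: "u \<in> {u \<in> sphere 0 1. ?W P u \<noteq> 0}"
      then have "facet_weight p P u \<noteq> 0 \<or> facet_weight p P (- u) \<noteq> 0" by auto
      then have "u \<in> facet_normals_off_origin P \<or> - u \<in> facet_normals_off_origin P"
        using facet_weight_not_facet_normal[OF P, of u p] facet_weight_not_facet_normal[OF P, of "- u" p] u by auto
      then show "u \<in> facet_normals_off_origin P \<union> uminus ` facet_normals_off_origin P"
        by (metis UnI1 UnI2 imageI minus_minus)
    qed
    then have "finite {u \<in> sphere 0 1. ?W P u \<noteq> 0}"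
      by (rule finite_subset) (use finite_facet_normals[OF P] in simp)
    then show ?thesis using c by (simp add: has_weights_def \<kappa>_def facet_weight_nonneg)
  qed
  have "contravariant_valuation p \<kappa>"
    using weighted_valuation_contravariant[OF c \<kappa>] has_weights_sphere_measures[OF \<kappa>] assms(2)
    by unfold_locales auto
  moreover have "measure (\<mu> ?T) A = measure (\<kappa> ?T) A" if A: "A \<in> sets sphere_borel" for A
  proof -
    have "measure (\<kappa> ?T) A = (\<Sum>u\<in>{?v, - ?v}. ?W ?T u * indicator A u)"
    proof (rule has_weights_measure[OF \<kappa>[OF T] _ _ _ A])
      show "{u \<in> sphere 0 1. ?W ?T u \<noteq> 0} \<subseteq> {?v, - ?v}"
      proof (rule subsetI, rule ccontr)
        fix u assume u: "u \<in> {u \<in> sphere 0 1. ?W ?T u \<noteq> 0}" and "u \<notin> {?v, - ?v}"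
        moreover from this have "- u \<noteq> ?v" by (metis insertI1 insertI2 minus_minus)
        ultimately have "facet_weight p ?T u = 0" "facet_weight p ?T (- u) = 0"
          using off_diagonal[of u] off_diagonal[of "- u"] by auto
        then show False using u by simp
      qed
    qed auto
    also have "\<dots> = measure (\<mu> ?T) {?v} * indicator A ?v + measure (\<mu> ?T) {- ?v} * indicator A (- ?v)"
      unfolding sum_two[OF unit_diagonal_neq_uminus] using w
      by (simp add: facet_weight_std_simplex_neg w_def[symmetric] c1_def c2_def)
    finally show ?thesis using \<mu>.measure_simplex_two_atoms[OF assms(1) A] by simp
  qed
  ultimately have eq: "measure (\<mu> P) A = measure (\<kappa> P) A" if "P \<in> polytopes_o" "A \<in> sets sphere_borel" for P A
    using contravariant_valuation_unique[OF \<mu>.contravariant_valuation_axioms] that by blast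
  have "\<forall>P \<in> polytopes_o. \<forall>A \<in> sets sphere_borel. measure (\<mu> P) A =
      c1 * measure (?S P) A + c2 * measure (?S (uminus ` P)) A"
  proof
    fix P :: "(real^'n) set" assume P: "P \<in> polytopes_o"
    show "\<forall>A \<in> sets sphere_borel. measure (\<mu> P) A = c1 * measure (?S P) A + c2 * measure (?S (uminus ` P)) A"
      using has_weights_Lp_combination_iff[OF has_weights_sphere_measures[OF \<kappa>[OF P]] P c, of p] \<kappa>[OF P] eq[OF P]
      by simp
  qed
  then show "\<exists>c1 c2. 0 \<le> c1 \<and> 0 \<le> c2 \<and>
      (\<forall>P \<in> polytopes_o. \<forall>A \<in> sets sphere_borel.
        measure (\<mu> P) A =
          c1 * measure (Lp_surface_area_measure p P) A +
          c2 * measure (Lp_surface_area_measure p (uminus ` P)) A)"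
    using c by blast
qed

end
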